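(* Let $A$ be a finite-dimensional basic algebra of finite representation type over an algebraically closed field $K$, let $T\in\mathrm{mod}\,A$ be a support $\tau$-tilting module and $B=\mathrm{End}_A T$. Then $\mathrm{findim}\,B^{op}<\infty$.
   Context: All algebras (including $B$) are finite-dimensional basic algebras over an algebraically closed field $K$; all modules are finitely generated right modules. $\tau$ is the Auslander-Reiten translation and $|M|$ is the number of isomorphism classes of indecomposable direct summands of $M$. A module $M$ is $\tau$-rigid if $\mathrm{Hom}_A(M,\tau M)=0$; it is $\tau$-tilting if it is $\tau$-rigid and $|M|=|A|$; it is support $\tau$-tilting if there is an idempotent $e\in A$ such that $M$ is a $\tau$-tilting $(A/\langle e\rangle)$-module. $\mathrm{findim}\,B^{op}$ is the supremum of the projective dimensions of the modules in $\mathrm{mod}\,B^{op}$ having finite projective dimension. *)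

theory Defs
  imports
    "HOL-Algebra.Module"
    "HOL-Algebra.QuotRing"
    "HOL-Algebra.Algebraic_Closure"
    "HOL-Library.Extended_Nat"
begin

section \<open>Modules over a not necessarily commutative ring\<close>

text \<open>
  HOL-Algebra's \<open>module\<close> locale needs a commutative ring of scalars, but its record type does not.
  A right module is a record of that type in which the right action \<open>x \<cdot> a\<close> is written
  \<open>a \<odot> x\<close>; hence the order of the factors in \<open>smult_assoc\<close>.  A left module over \<open>R\<close> is a right
  module over the opposite ring, so that \<open>a \<odot> x\<close> is then the left action \<open>a x\<close>.
  The fields \<open>mult\<close> and \<open>one\<close> of a record that represents a mere module carry no meaning.
\<close>

locale right_module = R?: ring R + M?: abelian_group M
  for R :: "('a, 'b) ring_scheme" (structure) and M :: "('a, 'm, 'c) module_scheme" (structure) +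
  assumes smult_closed:
      "\<lbrakk>a \<in> carrier R; x \<in> carrier M\<rbrakk> \<Longrightarrow> a \<odot>\<^bsub>M\<^esub> x \<in> carrier M"
    and smult_l_distr:
      "\<lbrakk>a \<in> carrier R; b \<in> carrier R; x \<in> carrier M\<rbrakk>
        \<Longrightarrow> (a \<oplus>\<^bsub>R\<^esub> b) \<odot>\<^bsub>M\<^esub> x = a \<odot>\<^bsub>M\<^esub> x \<oplus>\<^bsub>M\<^esub> b \<odot>\<^bsub>M\<^esub> x"
    and smult_r_distr:
      "\<lbrakk>a \<in> carrier R; x \<in> carrier M; y \<in> carrier M\<rbrakk>
        \<Longrightarrow> a \<odot>\<^bsub>M\<^esub> (x \<oplus>\<^bsub>M\<^esub> y) = a \<odot>\<^bsub>M\<^esub> x \<oplus>\<^bsub>M\<^esub> a \<odot>\<^bsub>M\<^esub> y"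
    and smult_assoc:
      "\<lbrakk>a \<in> carrier R; b \<in> carrier R; x \<in> carrier M\<rbrakk>
        \<Longrightarrow> (a \<otimes>\<^bsub>R\<^esub> b) \<odot>\<^bsub>M\<^esub> x = b \<odot>\<^bsub>M\<^esub> (a \<odot>\<^bsub>M\<^esub> x)"
    and smult_one: "x \<in> carrier M \<Longrightarrow> \<one>\<^bsub>R\<^esub> \<odot>\<^bsub>M\<^esub> x = x"

definition opposite :: "('a, 'b) ring_scheme \<Rightarrow> ('a, 'b) ring_scheme" where
  "opposite R = R\<lparr>monoid.mult := (\<lambda>x y. y \<otimes>\<^bsub>R\<^esub> x)\<rparr>"

definition finitely_generated :: "('a, 'b) ring_scheme \<Rightarrow> ('a, 'm, 'c) module_scheme \<Rightarrow> bool" where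
  "finitely_generated R M \<longleftrightarrow>
     (\<exists>S. finite S \<and> S \<subseteq> carrier M \<and>
        (\<forall>x\<in>carrier M. \<exists>c\<in>S \<rightarrow> carrier R. x = (\<Oplus>\<^bsub>M\<^esub>s\<in>S. c s \<odot>\<^bsub>M\<^esub> s)))"

definition fg_module :: "('a, 'b) ring_scheme \<Rightarrow> ('a, 'm, 'c) module_scheme \<Rightarrow> bool" where
  "fg_module R M \<longleftrightarrow> right_module R M \<and> finitely_generated R M"

text \<open>Homomorphisms are extensional functions, so that \<open>homs R M N\<close> really is \<open>Hom\<^sub>R(M,N)\<close>.\<close>

definition homs ::
  "('a, 'b) ring_scheme \<Rightarrow> ('a, 'm, 'c) module_scheme \<Rightarrow> ('a, 'n, 'd) module_scheme \<Rightarrow> ('m \<Rightarrow> 'n) set"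
where
  "homs R M N = {f \<in> carrier M \<rightarrow>\<^sub>E carrier N.
     (\<forall>x\<in>carrier M. \<forall>y\<in>carrier M. f (x \<oplus>\<^bsub>M\<^esub> y) = f x \<oplus>\<^bsub>N\<^esub> f y) \<and>
     (\<forall>a\<in>carrier R. \<forall>x\<in>carrier M. f (a \<odot>\<^bsub>M\<^esub> x) = a \<odot>\<^bsub>N\<^esub> f x)}"

definition isomorphic ::
  "('a, 'b) ring_scheme \<Rightarrow> ('a, 'm, 'c) module_scheme \<Rightarrow> ('a, 'n, 'd) module_scheme \<Rightarrow> bool" where
  "isomorphic R M N \<longleftrightarrow> (\<exists>f\<in>homs R M N. bij_betw f (carrier M) (carrier N))"

definition complementary ::
  "('a, 'b) ring_scheme \<Rightarrow> ('a, 'm, 'c) module_scheme \<Rightarrow> 'm set \<Rightarrow> 'm set \<Rightarrow> bool" where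
  "complementary R M U V \<longleftrightarrow>
     submodule U R M \<and> submodule V R M \<and> U <+>\<^bsub>M\<^esub> V = carrier M \<and> U \<inter> V = {\<zero>\<^bsub>M\<^esub>}"

definition direct_summand ::
  "('a, 'b) ring_scheme \<Rightarrow> ('a, 'm, 'c) module_scheme \<Rightarrow> 'm set \<Rightarrow> bool" where
  "direct_summand R M U \<longleftrightarrow> (\<exists>V. complementary R M U V)"

definition indecomposable :: "('a, 'b) ring_scheme \<Rightarrow> ('a, 'm, 'c) module_scheme \<Rightarrow> bool" where
  "indecomposable R M \<longleftrightarrow>
     carrier M \<noteq> {\<zero>\<^bsub>M\<^esub>} \<and>
     (\<forall>U V. complementary R M U V \<longrightarrow> U = {\<zero>\<^bsub>M\<^esub>} \<or> V = {\<zero>\<^bsub>M\<^esub>})"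

definition indec_summands ::
  "('a, 'b) ring_scheme \<Rightarrow> ('a, 'm, 'c) module_scheme \<Rightarrow> 'm set set" where
  "indec_summands R M = {U. direct_summand R M U \<and> indecomposable R (M\<lparr>carrier := U\<rparr>)}"

text \<open>The number \<open>|M|\<close>; for the modules of interest the quotient set is finite by Krull-Schmidt.\<close>

definition num_indec :: "('a, 'b) ring_scheme \<Rightarrow> ('a, 'm, 'c) module_scheme \<Rightarrow> nat" where
  "num_indec R M =
     card (indec_summands R M //
       {(U, V). U \<in> indec_summands R M \<and> V \<in> indec_summands R M \<and>
          isomorphic R (M\<lparr>carrier := U\<rparr>) (M\<lparr>carrier := V\<rparr>)})"

definition regular :: "('a, 'b) ring_scheme \<Rightarrow> ('a, 'a) module" where
  "regular R = \<lparr>carrier = carrier R, monoid.mult = monoid.mult R, one = one R,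
     zero = zero R, add = add R, smult = (\<lambda>a x. x \<otimes>\<^bsub>R\<^esub> a)\<rparr>"

definition quotient_module ::
  "('a, 'm, 'c) module_scheme \<Rightarrow> 'm set \<Rightarrow> ('a, 'm set) module" where
  "quotient_module M U = \<lparr>carrier = a_rcosets\<^bsub>M\<^esub> U, monoid.mult = undefined, one = undefined,
     zero = U, add = set_add M, smult = (\<lambda>a Z. \<Union>x\<in>Z. U +>\<^bsub>M\<^esub> (a \<odot>\<^bsub>M\<^esub> x))\<rparr>"

section \<open>Projective modules, finitistic dimension, representation type\<close>

text \<open>
  Every finitely generated right module over a ring with elements of type \<open>'a\<close> is a quotient of a
  finite power of the ring, hence isomorphic to one whose elements have type \<open>nat \<Rightarrow> 'a\<close>.
  Quantification over \<open>mod R\<close> inside a definition is therefore quantification over the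
  finitely generated right modules of the following type.
\<close>

type_synonym 'a umod = "('a, nat \<Rightarrow> 'a) module"

definition projective :: "('a, 'b) ring_scheme \<Rightarrow> ('a, 'm, 'c) module_scheme \<Rightarrow> bool" where
  "projective R P \<longleftrightarrow> fg_module R P \<and>
     (\<forall>(Z :: 'a umod) (Y :: 'a umod). fg_module R Z \<longrightarrow> fg_module R Y \<longrightarrow>
        (\<forall>g\<in>homs R Z Y. g ` carrier Z = carrier Y \<longrightarrow>
           (\<forall>f\<in>homs R P Y. \<exists>h\<in>homs R P Z. \<forall>p\<in>carrier P. g (h p) = f p)))"

text \<open>
  An exact sequence \<open>0 \<rightarrow> C (n+1) \<rightarrow> \<dots> \<rightarrow> C 1 \<rightarrow> C 0 \<rightarrow> 0\<close> with \<open>C 0 = M\<close>,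
  \<open>C (i+1)\<close> the \<open>i\<close>-th projective and \<open>d i\<close> mapping \<open>C (i+1)\<close> to \<open>C i\<close>.
\<close>

definition proj_resolution ::
  "('a, 'b) ring_scheme \<Rightarrow> 'a umod \<Rightarrow> nat \<Rightarrow> (nat \<Rightarrow> 'a umod) \<Rightarrow>
     (nat \<Rightarrow> (nat \<Rightarrow> 'a) \<Rightarrow> nat \<Rightarrow> 'a) \<Rightarrow> bool" where
  "proj_resolution R M n C d \<longleftrightarrow>
     C 0 = M \<and>
     (\<forall>i\<le>n. projective R (C (Suc i)) \<and> d i \<in> homs R (C (Suc i)) (C i)) \<and>
     d 0 ` carrier (C 1) = carrier M \<and>
     (\<forall>i<n. d (Suc i) ` carrier (C (Suc (Suc i))) = a_kernel (C (Suc i)) (C i) (d i)) \<and>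
     inj_on (d n) (carrier (C (Suc n)))"

definition pd :: "('a, 'b) ring_scheme \<Rightarrow> 'a umod \<Rightarrow> enat" where
  "pd R M = (INF n\<in>{n. \<exists>C d. proj_resolution R M n C d}. enat n)"

text \<open>\<open>findim R\<close> is formed with right \<open>R\<close>-modules.\<close>

definition findim :: "('a, 'b) ring_scheme \<Rightarrow> enat" where
  "findim R = (SUP M\<in>{M :: 'a umod. fg_module R M \<and> pd R M < \<infinity>}. pd R M)"

definition finite_rep_type :: "('a, 'b) ring_scheme \<Rightarrow> bool" where
  "finite_rep_type R \<longleftrightarrow>
     (\<exists>S :: 'a umod set. finite S \<and>
        (\<forall>M :: 'a umod. fg_module R M \<longrightarrow> indecomposable R M \<longrightarrow> (\<exists>N\<in>S. isomorphic R M N)))"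

section \<open>Finite-dimensional basic algebras\<close>

text \<open>HOL-Algebra's \<open>algebra\<close> locale is for commutative algebras.  The zero algebra is allowed.\<close>

locale fd_algebra = field K + K: module K A + A: ring A
  for K :: "('k, 'c) ring_scheme" (structure) and A :: "('k, 'a, 'd) module_scheme" (structure) +
  assumes smult_mult_left:
      "\<lbrakk>c \<in> carrier K; x \<in> carrier A; y \<in> carrier A\<rbrakk>
        \<Longrightarrow> (c \<odot>\<^bsub>A\<^esub> x) \<otimes>\<^bsub>A\<^esub> y = c \<odot>\<^bsub>A\<^esub> (x \<otimes>\<^bsub>A\<^esub> y)"
    and smult_mult_right:
      "\<lbrakk>c \<in> carrier K; x \<in> carrier A; y \<in> carrier A\<rbrakk>
        \<Longrightarrow> x \<otimes>\<^bsub>A\<^esub> (c \<odot>\<^bsub>A\<^esub> y) = c \<odot>\<^bsub>A\<^esub> (x \<otimes>\<^bsub>A\<^esub> y)"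
    and finite_dim: "finitely_generated K A"

definition idempotent_in :: "('a, 'b) ring_scheme \<Rightarrow> 'a \<Rightarrow> bool" where
  "idempotent_in R e \<longleftrightarrow> e \<in> carrier R \<and> e \<otimes>\<^bsub>R\<^esub> e = e"

definition primitive_idempotent :: "('a, 'b) ring_scheme \<Rightarrow> 'a \<Rightarrow> bool" where
  "primitive_idempotent R e \<longleftrightarrow> idempotent_in R e \<and> e \<noteq> \<zero>\<^bsub>R\<^esub> \<and>
     (\<forall>f g. idempotent_in R f \<longrightarrow> idempotent_in R g \<longrightarrow>
        f \<otimes>\<^bsub>R\<^esub> g = \<zero>\<^bsub>R\<^esub> \<longrightarrow> g \<otimes>\<^bsub>R\<^esub> f = \<zero>\<^bsub>R\<^esub> \<longrightarrow> e = f \<oplus>\<^bsub>R\<^esub> g \<longrightarrow>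
        f = \<zero>\<^bsub>R\<^esub> \<or> g = \<zero>\<^bsub>R\<^esub>)"

definition idempotent_module :: "('a, 'b) ring_scheme \<Rightarrow> 'a \<Rightarrow> ('a, 'a) module" where
  "idempotent_module R e = (regular R)\<lparr>carrier := (\<lambda>a. e \<otimes>\<^bsub>R\<^esub> a) ` carrier R\<rparr>"

text \<open>
  There is a complete set \<open>E\<close> of primitive orthogonal idempotents such that the right modules \<open>e R\<close>
  with \<open>e \<in> E\<close> are pairwise non-isomorphic.
\<close>

definition basic :: "('a, 'b) ring_scheme \<Rightarrow> bool" where
  "basic R \<longleftrightarrow>
     (\<exists>E. finite E \<and> (\<forall>e\<in>E. primitive_idempotent R e) \<and>
        (\<forall>e\<in>E. \<forall>f\<in>E. e \<noteq> f \<longrightarrow> e \<otimes>\<^bsub>R\<^esub> f = \<zero>\<^bsub>R\<^esub>) \<and>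
        (\<Oplus>\<^bsub>R\<^esub>e\<in>E. e) = \<one>\<^bsub>R\<^esub> \<and>
        (\<forall>e\<in>E. \<forall>f\<in>E. e \<noteq> f \<longrightarrow>
           \<not> isomorphic R (idempotent_module R e) (idempotent_module R f)))"

text \<open>
  Endomorphisms act on the left of a right module \<open>T\<close>: the product \<open>f \<otimes> g\<close> is \<open>f\<close> after \<open>g\<close>.  The
  scalars act on \<open>T\<close> through \<open>A\<close>.
\<close>

definition End_algebra ::
  "('k, 'a, 'd) module_scheme \<Rightarrow> ('a, 'm, 'c) module_scheme \<Rightarrow> ('k, 'm \<Rightarrow> 'm) module" where
  "End_algebra A T = \<lparr>carrier = homs A T T,
     monoid.mult = (\<lambda>f g. compose (carrier T) f g),
     one = (\<lambda>x\<in>carrier T. x),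
     zero = (\<lambda>x\<in>carrier T. \<zero>\<^bsub>T\<^esub>),
     add = (\<lambda>f g. \<lambda>x\<in>carrier T. f x \<oplus>\<^bsub>T\<^esub> g x),
     smult = (\<lambda>c f. \<lambda>x\<in>carrier T. (c \<odot>\<^bsub>A\<^esub> \<one>\<^bsub>A\<^esub>) \<odot>\<^bsub>T\<^esub> f x)\<rparr>"

definition quotient_algebra :: "('k, 'a, 'd) module_scheme \<Rightarrow> 'a set \<Rightarrow> ('k, 'a set) module" where
  "quotient_algebra A I = \<lparr>carrier = carrier (A Quot I), monoid.mult = monoid.mult (A Quot I),
     one = one (A Quot I), zero = zero (A Quot I), add = add (A Quot I),
     smult = (\<lambda>c Z. \<Union>x\<in>Z. I +>\<^bsub>A\<^esub> (c \<odot>\<^bsub>A\<^esub> x))\<rparr>"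

section \<open>The Auslander-Reiten translation\<close>

definition superfluous ::
  "('a, 'b) ring_scheme \<Rightarrow> ('a, 'm, 'c) module_scheme \<Rightarrow> 'm set \<Rightarrow> bool" where
  "superfluous R M U \<longleftrightarrow> submodule U R M \<and>
     (\<forall>V. submodule V R M \<longrightarrow> U <+>\<^bsub>M\<^esub> V = carrier M \<longrightarrow> V = carrier M)"

definition projective_cover ::
  "('a, 'b) ring_scheme \<Rightarrow> ('a, 'p, 'c) module_scheme \<Rightarrow> ('a, 'm, 'd) module_scheme \<Rightarrow>
     ('p \<Rightarrow> 'm) \<Rightarrow> bool" where
  "projective_cover R P M g \<longleftrightarrow> projective R P \<and> g \<in> homs R P M \<and>
     g ` carrier P = carrier M \<and> superfluous R P (a_kernel P M g)"

text \<open>\<open>P1 \<rightarrow> P0 \<rightarrow> M \<rightarrow> 0\<close>, with maps \<open>f\<close> and \<open>g\<close>.\<close>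

definition min_proj_presentation ::
  "('a, 'b) ring_scheme \<Rightarrow> ('a, 'm, 'c) module_scheme \<Rightarrow> 'a umod \<Rightarrow> 'a umod \<Rightarrow>
     ((nat \<Rightarrow> 'a) \<Rightarrow> (nat \<Rightarrow> 'a)) \<Rightarrow> ((nat \<Rightarrow> 'a) \<Rightarrow> 'm) \<Rightarrow> bool" where
  "min_proj_presentation R M P1 P0 f g \<longleftrightarrow>
     projective_cover R P0 M g \<and> projective_cover R P1 (P0\<lparr>carrier := a_kernel P0 M g\<rparr>) f"

text \<open>The left module \<open>Hom\<^sub>R(P,R)\<close>, with \<open>(a \<phi>)(p) = a \<phi>(p)\<close>.\<close>

definition hom_to_ring ::
  "('a, 'b) ring_scheme \<Rightarrow> ('a, 'p, 'c) module_scheme \<Rightarrow> ('a, 'p \<Rightarrow> 'a) module" where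
  "hom_to_ring R P = \<lparr>carrier = homs R P (regular R), monoid.mult = undefined, one = undefined,
     zero = (\<lambda>p\<in>carrier P. \<zero>\<^bsub>R\<^esub>),
     add = (\<lambda>\<phi> \<psi>. \<lambda>p\<in>carrier P. \<phi> p \<oplus>\<^bsub>R\<^esub> \<psi> p),
     smult = (\<lambda>a \<phi>. \<lambda>p\<in>carrier P. a \<otimes>\<^bsub>R\<^esub> \<phi> p)\<rparr>"

text \<open>The left module \<open>Tr M\<close>: the cokernel of \<open>Hom(f,R) : Hom(P0,R) \<rightarrow> Hom(P1,R)\<close>.\<close>

definition transpose_of ::
  "('a, 'b) ring_scheme \<Rightarrow> ('a, 'p, 'c) module_scheme \<Rightarrow> ('a, 'q, 'd) module_scheme \<Rightarrow> ('p \<Rightarrow> 'q) \<Rightarrow>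
     ('a, ('p \<Rightarrow> 'a) set) module" where
  "transpose_of R P1 P0 f =
     quotient_module (hom_to_ring R P1)
       ((\<lambda>\<phi>. compose (carrier P1) \<phi> f) ` carrier (hom_to_ring R P0))"

text \<open>
  The right \<open>A\<close>-module \<open>D Z = Hom\<^sub>K(Z,K)\<close> of a left \<open>A\<close>-module \<open>Z\<close>, with
  \<open>(\<phi> \<cdot> a)(x) = \<phi>(a x)\<close>; the field acts on \<open>Z\<close> through \<open>A\<close>.
\<close>

definition dual_module ::
  "('k, 'c) ring_scheme \<Rightarrow> ('k, 'a, 'd) module_scheme \<Rightarrow> ('a, 'x, 'e) module_scheme \<Rightarrow>
     ('a, 'x \<Rightarrow> 'k) module" where
  "dual_module K A Z = \<lparr>
     carrier = {\<phi> \<in> carrier Z \<rightarrow>\<^sub>E carrier K.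
       (\<forall>x\<in>carrier Z. \<forall>y\<in>carrier Z. \<phi> (x \<oplus>\<^bsub>Z\<^esub> y) = \<phi> x \<oplus>\<^bsub>K\<^esub> \<phi> y) \<and>
       (\<forall>c\<in>carrier K. \<forall>x\<in>carrier Z. \<phi> ((c \<odot>\<^bsub>A\<^esub> \<one>\<^bsub>A\<^esub>) \<odot>\<^bsub>Z\<^esub> x) = c \<otimes>\<^bsub>K\<^esub> \<phi> x)},
     monoid.mult = undefined, one = undefined,
     zero = (\<lambda>x\<in>carrier Z. \<zero>\<^bsub>K\<^esub>),
     add = (\<lambda>\<phi> \<psi>. \<lambda>x\<in>carrier Z. \<phi> x \<oplus>\<^bsub>K\<^esub> \<psi> x),
     smult = (\<lambda>a \<phi>. \<lambda>x\<in>carrier Z. \<phi> (a \<odot>\<^bsub>Z\<^esub> x))\<rparr>"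

text \<open>
  \<open>\<tau> M = D Tr M\<close>, computed from some minimal projective presentation.  These exist for finitely
  generated modules over finite-dimensional algebras and are unique up to isomorphism, hence so
  is \<open>\<tau> M\<close>.
\<close>

definition AR_translate ::
  "('k, 'c) ring_scheme \<Rightarrow> ('k, 'a, 'd) module_scheme \<Rightarrow> ('a, 'm, 'e) module_scheme \<Rightarrow>
     ('a, ((nat \<Rightarrow> 'a) \<Rightarrow> 'a) set \<Rightarrow> 'k) module" where
  "AR_translate K A M =
     (case (SOME (P1, P0, f). \<exists>g. min_proj_presentation A M P1 P0 f g) of
        (P1, P0, f) \<Rightarrow> dual_module K A (transpose_of A P1 P0 f))"

section \<open>Support tau-tilting modules\<close>

definition tau_rigid ::
  "('k, 'c) ring_scheme \<Rightarrow> ('k, 'a, 'd) module_scheme \<Rightarrow> ('a, 'm, 'e) module_scheme \<Rightarrow> bool" where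
  "tau_rigid K A M \<longleftrightarrow> fg_module A M \<and>
     homs A M (AR_translate K A M) = {\<lambda>x\<in>carrier M. \<zero>\<^bsub>AR_translate K A M\<^esub>}"

definition tau_tilting ::
  "('k, 'c) ring_scheme \<Rightarrow> ('k, 'a, 'd) module_scheme \<Rightarrow> ('a, 'm, 'e) module_scheme \<Rightarrow> bool" where
  "tau_tilting K A M \<longleftrightarrow> tau_rigid K A M \<and> num_indec A M = num_indec A (regular A)"

text \<open>
  A right \<open>A\<close>-module annihilated by the ideal \<open>I\<close>, as a right \<open>A/I\<close>-module; the choice of the
  representative of the coset \<open>Z\<close> does not matter.
\<close>

definition over_quotient :: "('a, 'm, 'c) module_scheme \<Rightarrow> ('a set, 'm) module" where
  "over_quotient M = \<lparr>carrier = carrier M, monoid.mult = undefined, one = undefined,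
     zero = zero M, add = add M, smult = (\<lambda>Z x. (SOME a. a \<in> Z) \<odot>\<^bsub>M\<^esub> x)\<rparr>"

definition support_tau_tilting ::
  "('k, 'c) ring_scheme \<Rightarrow> ('k, 'a, 'd) module_scheme \<Rightarrow> ('a, 'm, 'e) module_scheme \<Rightarrow> bool" where
  "support_tau_tilting K A M \<longleftrightarrow> fg_module A M \<and>
     (\<exists>e. idempotent_in A e \<and>
        (\<forall>a\<in>Idl\<^bsub>A\<^esub> {e}. \<forall>x\<in>carrier M. a \<odot>\<^bsub>M\<^esub> x = \<zero>\<^bsub>M\<^esub>) \<and>
        tau_tilting K (quotient_algebra A (Idl\<^bsub>A\<^esub> {e})) (over_quotient M))"

end

theory Submission
  imports Defs
begin

text \<open>
  Let \<open>B = End T\<close>.  A linear map between free left \<open>B\<close>-modules is a matrix of endomorphisms of \<open>T\<close>.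
  For source \<open>B\<^sup>m\<close> and target \<open>B\<^sup>n\<close> the matrix is also a map \<open>T\<^sup>n \<rightarrow> T\<^sup>m\<close>.  The elements of \<open>B\<^sup>m\<close> are
  the linear maps \<open>T\<^sup>m \<rightarrow> T\<close>, and those in the kernel are the ones that vanish on the image of
  \<open>T\<^sup>n\<close>, hence the ones that factor through a quotient \<open>C\<close> of \<open>T\<^sup>m\<close> (\<open>kernel_is_hom_module\<close>).
  So if two free covers are taken in turn, the second syzygy of a left \<open>B\<close>-module is \<open>Hom\<^sub>A(C,T)\<close> for a finitely generated \<open>A\<close>-module \<open>C\<close>.

  As \<open>A\<close> has finite representation type, \<open>C\<close> is a direct sum of copies of finitely many indecomposable
  modules \<open>C\<^sub>j\<close>, and \<open>Hom\<^sub>A(C,T)\<close> is a direct sum of copies of the \<open>Hom\<^sub>A(C\<^sub>j,T)\<close>.  Let \<open>N\<close> be the largest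
  of the finite numbers among the projective dimensions of the \<open>Hom\<^sub>A(C\<^sub>j,T)\<close>
  (\<open>finite_rep_type_hom_pd_bound\<close>).  If a \<open>B\<close>-module has finite projective dimension, so do its second
  syzygy and the summands of that syzygy; these summands then have projective dimension at most \<open>N\<close>, so the
  syzygy does (\<open>hom_pd_le_if_indecomposable\<close>), and the module itself at most \<open>N + 2\<close>
  (\<open>findim_End_op_le\<close>).

  The argument needs two general tools.  Projective dimension has to be independent of the covers and
  compatible with direct sums and summands; all of this comes from one form of Schanuel's lemma
  (\<open>kernel_retract_of_sum\<close>).  And modules that occur as quotients or as modules of maps have to be
  replaced by copies with elements of type \<open>nat \<Rightarrow> 'a\<close> (\<open>fg_module_quotient_umod\<close>), because
  projective dimension and representation type speak about those.
\<close>

section \<open>Linear maps, submodules and finite generation\<close>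

text \<open>
  Unlike the members of \<open>homs\<close>, these maps may take any values off the carrier, so composites and
  sums of linear maps are again linear as they stand.
\<close>

definition lin ::
  "('a, 'b) ring_scheme \<Rightarrow> ('a, 'm, 'c) module_scheme \<Rightarrow> ('a, 'n, 'd) module_scheme \<Rightarrow> ('m \<Rightarrow> 'n) \<Rightarrow> bool"
where
  "lin R M N f \<longleftrightarrow> f \<in> carrier M \<rightarrow> carrier N \<and>
     (\<forall>x\<in>carrier M. \<forall>y\<in>carrier M. f (x \<oplus>\<^bsub>M\<^esub> y) = f x \<oplus>\<^bsub>N\<^esub> f y) \<and>
     (\<forall>a\<in>carrier R. \<forall>x\<in>carrier M. f (a \<odot>\<^bsub>M\<^esub> x) = a \<odot>\<^bsub>N\<^esub> f x)"

lemma linI: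
  assumes "\<And>x. x \<in> carrier M \<Longrightarrow> f x \<in> carrier N"
    and "\<And>x y. x \<in> carrier M \<Longrightarrow> y \<in> carrier M \<Longrightarrow> f (x \<oplus>\<^bsub>M\<^esub> y) = f x \<oplus>\<^bsub>N\<^esub> f y"
    and "\<And>a x. a \<in> carrier R \<Longrightarrow> x \<in> carrier M \<Longrightarrow> f (a \<odot>\<^bsub>M\<^esub> x) = a \<odot>\<^bsub>N\<^esub> f x"
  shows "lin R M N f"
  using assms by (auto simp: lin_def)

lemma linD:
  assumes "lin R M N f"
  shows "x \<in> carrier M \<Longrightarrow> f x \<in> carrier N"
    and "x \<in> carrier M \<Longrightarrow> y \<in> carrier M \<Longrightarrow> f (x \<oplus>\<^bsub>M\<^esub> y) = f x \<oplus>\<^bsub>N\<^esub> f y"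
    and "a \<in> carrier R \<Longrightarrow> x \<in> carrier M \<Longrightarrow> f (a \<odot>\<^bsub>M\<^esub> x) = a \<odot>\<^bsub>N\<^esub> f x"
  using assms by (auto simp: lin_def)

lemma homs_lin: "f \<in> homs R M N \<Longrightarrow> lin R M N f"
  by (auto simp: homs_def lin_def)

lemma restrict_in_homs:
  assumes "right_module R M" "lin R M N f"
  shows "restrict f (carrier M) \<in> homs R M N"
proof -
  interpret right_module R M by fact
  show ?thesis
    using assms(2) by (auto simp: lin_def homs_def smult_closed)
qed

lemma right_moduleD:
  assumes "right_module R M"
  shows "ring R" "abelian_group M"
  using assms by (simp_all add: right_module_def)

lemma lin_comp: "lin R M N f \<Longrightarrow> lin R N L g \<Longrightarrow> lin R M L (\<lambda>x. g (f x))"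
  by (auto simp: lin_def Pi_iff)

lemma lin_id: "lin R M M (\<lambda>x. x)"
  by (auto simp: lin_def)

context
  fixes R :: "('a, 'b) ring_scheme" and M :: "('a, 'm, 'c) module_scheme"
  assumes rm: "right_module R M"
begin

interpretation right_module R M by (rule rm)

lemma rm_smult_zero:
  assumes "a \<in> carrier R" shows "a \<odot>\<^bsub>M\<^esub> \<zero>\<^bsub>M\<^esub> = \<zero>\<^bsub>M\<^esub>"
proof -
  have "a \<odot>\<^bsub>M\<^esub> \<zero>\<^bsub>M\<^esub> \<oplus>\<^bsub>M\<^esub> a \<odot>\<^bsub>M\<^esub> \<zero>\<^bsub>M\<^esub> = a \<odot>\<^bsub>M\<^esub> \<zero>\<^bsub>M\<^esub>"
    using smult_r_distr[OF assms M.zero_closed M.zero_closed] by simp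
  then show ?thesis
    using M.add.r_cancel_one' smult_closed[OF assms M.zero_closed] by metis
qed

lemma rm_zero_smult:
  assumes "x \<in> carrier M" shows "\<zero>\<^bsub>R\<^esub> \<odot>\<^bsub>M\<^esub> x = \<zero>\<^bsub>M\<^esub>"
proof -
  have "\<zero>\<^bsub>R\<^esub> \<odot>\<^bsub>M\<^esub> x \<oplus>\<^bsub>M\<^esub> \<zero>\<^bsub>R\<^esub> \<odot>\<^bsub>M\<^esub> x = \<zero>\<^bsub>R\<^esub> \<odot>\<^bsub>M\<^esub> x"
    using smult_l_distr[OF R.zero_closed R.zero_closed assms] by simp
  then show ?thesis
    using M.add.r_cancel_one' smult_closed[OF R.zero_closed assms] by metis
qed

lemma rm_minus_one_smult:
  assumes "x \<in> carrier M" shows "(\<ominus>\<^bsub>R\<^esub> \<one>\<^bsub>R\<^esub>) \<odot>\<^bsub>M\<^esub> x = \<ominus>\<^bsub>M\<^esub> x"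
proof -
  have "(\<ominus>\<^bsub>R\<^esub> \<one>\<^bsub>R\<^esub>) \<odot>\<^bsub>M\<^esub> x \<oplus>\<^bsub>M\<^esub> x = \<zero>\<^bsub>M\<^esub>"
    using smult_l_distr[of "\<ominus>\<^bsub>R\<^esub> \<one>\<^bsub>R\<^esub>" "\<one>\<^bsub>R\<^esub>" x] assms by (simp add: R.l_neg rm_zero_smult smult_one)
  then show ?thesis
    using assms by (metis M.minus_equality R.a_inv_closed R.one_closed smult_closed)
qed

lemma rm_smult_minus:
  assumes "a \<in> carrier R" "x \<in> carrier M" shows "a \<odot>\<^bsub>M\<^esub> (\<ominus>\<^bsub>M\<^esub> x) = \<ominus>\<^bsub>M\<^esub> (a \<odot>\<^bsub>M\<^esub> x)"
proof -
  have "a \<odot>\<^bsub>M\<^esub> (\<ominus>\<^bsub>M\<^esub> x) \<oplus>\<^bsub>M\<^esub> a \<odot>\<^bsub>M\<^esub> x = \<zero>\<^bsub>M\<^esub>"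
    using smult_r_distr[of a "\<ominus>\<^bsub>M\<^esub> x" x] assms by (simp add: M.l_neg rm_smult_zero)
  then show ?thesis
    using assms by (metis M.minus_equality M.a_inv_closed smult_closed)
qed

lemma rm_submoduleI:
  assumes "U \<subseteq> carrier M" "\<zero>\<^bsub>M\<^esub> \<in> U"
    and "\<And>x y. x \<in> U \<Longrightarrow> y \<in> U \<Longrightarrow> x \<oplus>\<^bsub>M\<^esub> y \<in> U"
    and s: "\<And>a x. a \<in> carrier R \<Longrightarrow> x \<in> U \<Longrightarrow> a \<odot>\<^bsub>M\<^esub> x \<in> U"
  shows "submodule U R M"
proof -
  have "\<ominus>\<^bsub>M\<^esub> x \<in> U" if "x \<in> U" for x
    using s[of "\<ominus>\<^bsub>R\<^esub> \<one>\<^bsub>R\<^esub>" x] rm_minus_one_smult[of x] that assms(1) by auto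
  then show ?thesis
    using assms by (intro submodule.intro subgroup.intro submodule_axioms.intro) (auto simp: a_inv_def)
qed

lemma rm_submoduleD:
  assumes "submodule U R M"
  shows "U \<subseteq> carrier M" "\<zero>\<^bsub>M\<^esub> \<in> U"
    and "\<And>x y. x \<in> U \<Longrightarrow> y \<in> U \<Longrightarrow> x \<oplus>\<^bsub>M\<^esub> y \<in> U"
    and "\<And>x. x \<in> U \<Longrightarrow> \<ominus>\<^bsub>M\<^esub> x \<in> U"
    and "\<And>a x. a \<in> carrier R \<Longrightarrow> x \<in> U \<Longrightarrow> a \<odot>\<^bsub>M\<^esub> x \<in> U"
proof -
  interpret S: submodule U R M by fact
  show "U \<subseteq> carrier M" "\<zero>\<^bsub>M\<^esub> \<in> U"
    and "\<And>x y. x \<in> U \<Longrightarrow> y \<in> U \<Longrightarrow> x \<oplus>\<^bsub>M\<^esub> y \<in> U"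
    and "\<And>x. x \<in> U \<Longrightarrow> \<ominus>\<^bsub>M\<^esub> x \<in> U"
    and "\<And>a x. a \<in> carrier R \<Longrightarrow> x \<in> U \<Longrightarrow> a \<odot>\<^bsub>M\<^esub> x \<in> U"
    using S.subset S.one_closed S.m_closed S.m_inv_closed S.smult_closed by (auto simp: a_inv_def)
qed

lemma right_module_submodule:
  assumes "submodule U R M"
  shows "right_module R (M\<lparr>carrier := U\<rparr>)"
proof -
  note s = rm_submoduleD[OF assms]
  have c: "x \<in> carrier M" if "x \<in> U" for x using s(1) that by auto
  have "abelian_group (M\<lparr>carrier := U\<rparr>)"
  proof (rule abelian_groupI)
    fix x assume "x \<in> carrier (M\<lparr>carrier := U\<rparr>)"
    then show "\<exists>y\<in>carrier (M\<lparr>carrier := U\<rparr>). y \<oplus>\<^bsub>M\<lparr>carrier := U\<rparr>\<^esub> x = \<zero>\<^bsub>M\<lparr>carrier := U\<rparr>\<^esub>"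
      using s(4)[of x] c[of x] by (intro bexI[of _ "\<ominus>\<^bsub>M\<^esub> x"]) (simp_all add: M.l_neg)
  qed (simp_all add: s c M.a_ac)
  then show ?thesis
    unfolding right_module_def right_module_axioms_def
    using s c R.ring_axioms
    by (simp add: smult_l_distr smult_r_distr smult_assoc smult_one)
qed

end

text \<open>
  Every statement about sums and multiples passes to the image of a module under a surjection that
  respects the operations; this is how module structures are put on quotients and on copies of
  modules.
\<close>

lemma right_module_image:
  assumes "right_module R M" "lin R M C p" "p ` carrier M = carrier C" "p \<zero>\<^bsub>M\<^esub> = \<zero>\<^bsub>C\<^esub>"
  shows "right_module R C"
proof -
  interpret right_module R M by fact
  note l = linD(2,3)[OF assms(2), symmetric]
  note c = assms(3)[symmetric]
  have "abelian_group C"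
  proof (rule abelian_groupI)
    fix x assume "x \<in> carrier C"
    then obtain m where "m \<in> carrier M" "x = p m" by (auto simp: c)
    then show "\<exists>y\<in>carrier C. y \<oplus>\<^bsub>C\<^esub> x = \<zero>\<^bsub>C\<^esub>"
      by (intro bexI[of _ "p (\<ominus>\<^bsub>M\<^esub> m)"]) (auto simp: c l assms(4)[symmetric] M.l_neg)
  qed (auto simp: c l assms(4)[symmetric] M.a_ac)
  then show ?thesis
    unfolding right_module_def right_module_axioms_def
    using R.ring_axioms
    by (auto simp: c l smult_closed smult_l_distr smult_r_distr smult_assoc smult_one)
qed

context
  fixes R :: "('a, 'b) ring_scheme" and M :: "('a, 'm, 'c) module_scheme"
    and N :: "('a, 'n, 'd) module_scheme"
  assumes rmM: "right_module R M" and rmN: "right_module R N"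
begin

interpretation M: right_module R M by (rule rmM)
interpretation N: right_module R N by (rule rmN)

lemma lin_zero:
  assumes "lin R M N f" shows "f \<zero>\<^bsub>M\<^esub> = \<zero>\<^bsub>N\<^esub>"
  using linD(3)[OF assms M.R.zero_closed M.M.zero_closed] linD(1)[OF assms M.M.zero_closed]
  by (simp add: rm_zero_smult[OF rmN] rm_zero_smult[OF rmM])

lemma lin_minus:
  assumes "lin R M N f" "x \<in> carrier M" shows "f (\<ominus>\<^bsub>M\<^esub> x) = \<ominus>\<^bsub>N\<^esub> f x"
  using linD(3)[OF assms(1) _ assms(2), of "\<ominus>\<^bsub>R\<^esub> \<one>\<^bsub>R\<^esub>"] linD(1)[OF assms] assms(2)
  by (simp add: rm_minus_one_smult[OF rmN] rm_minus_one_smult[OF rmM])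

lemma lin_zero_map: "lin R M N (\<lambda>_. \<zero>\<^bsub>N\<^esub>)"
  by (rule linI) (simp_all add: rm_smult_zero[OF rmN])

lemma lin_add_map:
  assumes "lin R M N f" "lin R M N g"
  shows "lin R M N (\<lambda>x. f x \<oplus>\<^bsub>N\<^esub> g x)"
  using linD[OF assms(1)] linD[OF assms(2)]
  by (intro linI) (auto simp: N.smult_r_distr N.M.a_ac)

lemma lin_minus_map:
  assumes "lin R M N f"
  shows "lin R M N (\<lambda>x. \<ominus>\<^bsub>N\<^esub> f x)"
  using linD[OF assms]
  by (intro linI) (auto simp: N.M.minus_add rm_smult_minus[OF rmN])

lemma submodule_vimage:
  assumes "lin R M N f" "submodule U R N"
  shows "submodule {x \<in> carrier M. f x \<in> U} R M"
  using rm_submoduleD[OF rmN assms(2)] linD[OF assms(1)] lin_zero[OF assms(1)]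
  by (intro rm_submoduleI[OF rmM]) (auto simp: M.smult_closed)

lemma submodule_kernel:
  assumes "lin R M N f"
  shows "submodule (a_kernel M N f) R M"
  using linD[OF assms] lin_zero[OF assms]
  by (intro rm_submoduleI[OF rmM]) (auto simp: M.smult_closed a_kernel_def' rm_smult_zero[OF rmN])

end

lemma lin_inverse:
  assumes M: "right_module R M" and f: "lin R M N f"
    and g: "\<And>y. y \<in> carrier N \<Longrightarrow> g y \<in> carrier M" "\<And>y. y \<in> carrier N \<Longrightarrow> f (g y) = y"
    and inj: "inj_on f (carrier M)"
  shows "lin R N M g"
proof -
  interpret M: right_module R M by fact
  show ?thesis
  proof (rule linI)
    fix x assume x: "x \<in> carrier N"
    show "g x \<in> carrier M" by (rule g(1)[OF x])
    { fix y assume y: "y \<in> carrier N"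
      have s: "g x \<oplus>\<^bsub>M\<^esub> g y \<in> carrier M" using g(1) x y by simp
      have e: "f (g x \<oplus>\<^bsub>M\<^esub> g y) = x \<oplus>\<^bsub>N\<^esub> y" by (simp only: linD(2)[OF f] g x y)
      then have "x \<oplus>\<^bsub>N\<^esub> y \<in> carrier N" using linD(1)[OF f s] by simp
      then show "g (x \<oplus>\<^bsub>N\<^esub> y) = g x \<oplus>\<^bsub>M\<^esub> g y"
        using s e g by (intro inj_onD[OF inj]) simp_all
    }
    fix a assume a: "a \<in> carrier R"
    have s: "a \<odot>\<^bsub>M\<^esub> g x \<in> carrier M" using g(1) x a by (simp add: M.smult_closed)
    have e: "f (a \<odot>\<^bsub>M\<^esub> g x) = a \<odot>\<^bsub>N\<^esub> x" by (simp only: linD(3)[OF f] g x a)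
    then have "a \<odot>\<^bsub>N\<^esub> x \<in> carrier N" using linD(1)[OF f s] by simp
    then show "g (a \<odot>\<^bsub>N\<^esub> x) = a \<odot>\<^bsub>M\<^esub> g x"
      using s e g by (intro inj_onD[OF inj]) simp_all
  qed
qed

text \<open>
  Generation phrased by submodules: to see that linear maps carry generators to generators it is
  then enough to pull submodules back, without rewriting sums.
\<close>

lemma finitely_generated_iff:
  fixes R :: "('a, 'b) ring_scheme" and M :: "('a, 'm, 'c) module_scheme"
  assumes rm: "right_module R M"
  shows "finitely_generated R M \<longleftrightarrow>
    (\<exists>S. finite S \<and> S \<subseteq> carrier M \<and> (\<forall>U. submodule U R M \<longrightarrow> S \<subseteq> U \<longrightarrow> U = carrier M))"
    (is "?L = ?Rr")
proof
  interpret right_module R M by fact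
  assume ?L
  then obtain S where S: "finite S" "S \<subseteq> carrier M"
    and c: "\<And>x. x \<in> carrier M \<Longrightarrow> \<exists>c\<in>S \<rightarrow> carrier R. x = (\<Oplus>\<^bsub>M\<^esub>s\<in>S. c s \<odot>\<^bsub>M\<^esub> s)"
    unfolding finitely_generated_def by metis
  have "U = carrier M" if U: "submodule U R M" "S \<subseteq> U" for U
  proof -
    note u = rm_submoduleD[OF rm U(1)]
    have "(\<Oplus>\<^bsub>M\<^esub>s\<in>F. c s \<odot>\<^bsub>M\<^esub> s) \<in> U" if "finite F" "F \<subseteq> S" "c \<in> F \<rightarrow> carrier R" for c F
      using that
    proof (induction F)
      case empty then show ?case using u(2) by simp
    next
      case (insert s F)
      have "(\<lambda>s. c s \<odot>\<^bsub>M\<^esub> s) \<in> F \<rightarrow> carrier M" "c s \<odot>\<^bsub>M\<^esub> s \<in> carrier M"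
        using insert.prems S(2) by (auto intro!: smult_closed)
      moreover have "c s \<odot>\<^bsub>M\<^esub> s \<in> U" using insert.prems U(2) u(5) by auto
      ultimately show ?case using insert u(3) by simp
    qed
    then have "carrier M \<subseteq> U" using c S(1) by (metis subsetI subset_refl)
    then show ?thesis using u(1) by auto
  qed
  then show ?Rr using S by blast
next
  interpret right_module R M by fact
  assume ?Rr
  then obtain S where S: "finite S" "S \<subseteq> carrier M"
    and gen: "\<And>U. submodule U R M \<Longrightarrow> S \<subseteq> U \<Longrightarrow> U = carrier M"
    by metis
  define U where "U = {x. \<exists>c\<in>S \<rightarrow> carrier R. x = (\<Oplus>\<^bsub>M\<^esub>s\<in>S. c s \<odot>\<^bsub>M\<^esub> s)}"
  have cl: "(\<lambda>s. c s \<odot>\<^bsub>M\<^esub> s) \<in> S \<rightarrow> carrier M" if "c \<in> S \<rightarrow> carrier R" for c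
    using that S(2) by (auto intro!: smult_closed)
  have cong: "(\<Oplus>\<^bsub>M\<^esub>s\<in>S. f s) = (\<Oplus>\<^bsub>M\<^esub>s\<in>S. g s)"
    if "g \<in> S \<rightarrow> carrier M" "\<And>s. s \<in> S \<Longrightarrow> f s = g s" for f g
    using that by (intro M.finsum_cong) (auto simp: simp_implies_def)
  have "submodule U R M"
  proof (rule rm_submoduleI[OF rm])
    show "U \<subseteq> carrier M" using cl by (auto simp: U_def intro!: M.finsum_closed)
    have "(\<Oplus>\<^bsub>M\<^esub>s\<in>S. \<zero>\<^bsub>R\<^esub> \<odot>\<^bsub>M\<^esub> s) = (\<Oplus>\<^bsub>M\<^esub>s\<in>S. \<zero>\<^bsub>M\<^esub>)"
      using S(2) by (intro cong) (auto simp: rm_zero_smult[OF rm])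
    then show "\<zero>\<^bsub>M\<^esub> \<in> U" unfolding U_def by (auto intro!: bexI[of _ "\<lambda>_. \<zero>\<^bsub>R\<^esub>"])
    fix x y assume "x \<in> U" "y \<in> U"
    then obtain c d where cd: "c \<in> S \<rightarrow> carrier R" "x = (\<Oplus>\<^bsub>M\<^esub>s\<in>S. c s \<odot>\<^bsub>M\<^esub> s)"
      "d \<in> S \<rightarrow> carrier R" "y = (\<Oplus>\<^bsub>M\<^esub>s\<in>S. d s \<odot>\<^bsub>M\<^esub> s)" unfolding U_def by auto
    have "x \<oplus>\<^bsub>M\<^esub> y = (\<Oplus>\<^bsub>M\<^esub>s\<in>S. c s \<odot>\<^bsub>M\<^esub> s \<oplus>\<^bsub>M\<^esub> d s \<odot>\<^bsub>M\<^esub> s)"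
      using cl cd by (simp add: M.finsum_addf)
    also have "\<dots> = (\<Oplus>\<^bsub>M\<^esub>s\<in>S. (c s \<oplus>\<^bsub>R\<^esub> d s) \<odot>\<^bsub>M\<^esub> s)"
      using S(2) cd by (intro cong) (auto intro!: smult_closed smult_l_distr[symmetric])
    finally show "x \<oplus>\<^bsub>M\<^esub> y \<in> U" unfolding U_def
      using cd by (auto intro!: bexI[of _ "\<lambda>s. c s \<oplus>\<^bsub>R\<^esub> d s"])
  next
    fix a x assume a: "a \<in> carrier R" and "x \<in> U"
    then obtain c where cd: "c \<in> S \<rightarrow> carrier R" "x = (\<Oplus>\<^bsub>M\<^esub>s\<in>S. c s \<odot>\<^bsub>M\<^esub> s)" unfolding U_def by auto
    have l: "a \<odot>\<^bsub>M\<^esub> (\<Oplus>\<^bsub>M\<^esub>s\<in>F. c s \<odot>\<^bsub>M\<^esub> s) = (\<Oplus>\<^bsub>M\<^esub>s\<in>F. (c s \<otimes>\<^bsub>R\<^esub> a) \<odot>\<^bsub>M\<^esub> s)"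
      if "finite F" "F \<subseteq> S" for F
      using that
    proof (induction F)
      case empty then show ?case by (simp add: rm_smult_zero[OF rm a])
    next
      case (insert s F)
      have *: "c t \<in> carrier R" "t \<in> carrier M" if "t \<in> insert s F" for t
        using that cd(1) insert.prems S(2) by auto
      have "(\<lambda>s. c s \<odot>\<^bsub>M\<^esub> s) \<in> F \<rightarrow> carrier M" "c s \<odot>\<^bsub>M\<^esub> s \<in> carrier M"
        "(\<lambda>s. (c s \<otimes>\<^bsub>R\<^esub> a) \<odot>\<^bsub>M\<^esub> s) \<in> F \<rightarrow> carrier M" "(c s \<otimes>\<^bsub>R\<^esub> a) \<odot>\<^bsub>M\<^esub> s \<in> carrier M"
        using * a by (auto intro!: smult_closed)
      then show ?case using insert a * by (simp add: smult_r_distr smult_assoc)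
    qed
    show "a \<odot>\<^bsub>M\<^esub> x \<in> U" unfolding U_def cd l[OF S(1) subset_refl]
      using cd(1) a by (auto intro!: bexI[of _ "\<lambda>s. c s \<otimes>\<^bsub>R\<^esub> a"])
  qed
  moreover have "S \<subseteq> U"
  proof
    fix t assume t: "t \<in> S"
    define c where "c = (\<lambda>s. if s = t then \<one>\<^bsub>R\<^esub> else \<zero>\<^bsub>R\<^esub>)"
    have "(\<Oplus>\<^bsub>M\<^esub>s\<in>S. c s \<odot>\<^bsub>M\<^esub> s) = (\<Oplus>\<^bsub>M\<^esub>s\<in>S. if t = s then s else \<zero>\<^bsub>M\<^esub>)"
      using S(2) by (intro cong) (auto simp: c_def smult_one rm_zero_smult[OF rm])
    also have "\<dots> = t" using M.finsum_singleton[OF t S(1), of "\<lambda>s. s"] S(2) by auto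
    finally show "t \<in> U" unfolding U_def by (auto intro!: bexI[of _ c] simp: c_def)
  qed
  ultimately have "U = carrier M" by (rule gen)
  then show ?L unfolding finitely_generated_def using S unfolding U_def by blast
qed

lemma fg_moduleD:
  assumes "fg_module R M" shows "right_module R M" "finitely_generated R M"
  using assms by (simp_all add: fg_module_def)

text \<open>
  Three summands are what the comparison of kernels below produces: two for the modules that are
  compared and one for a projective module.
\<close>

lemma fg_module_three_images:
  assumes M: "right_module R M"
    and fg: "fg_module R M1" "fg_module R M2" "fg_module R M3"
    and l: "lin R M1 M f" "lin R M2 M g" "lin R M3 M h"
    and surj: "\<And>m. m \<in> carrier M \<Longrightarrow>
      \<exists>x\<in>carrier M1. \<exists>y\<in>carrier M2. \<exists>z\<in>carrier M3. m = f x \<oplus>\<^bsub>M\<^esub> g y \<oplus>\<^bsub>M\<^esub> h z"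
  shows "fg_module R M"
proof -
  note rm = fg[THEN fg_moduleD(1)]
  obtain SX where SX: "finite SX" "SX \<subseteq> carrier M1" "\<And>U. submodule U R M1 \<Longrightarrow> SX \<subseteq> U \<Longrightarrow> U = carrier M1"
    using fg(1) unfolding fg_module_def by (metis finitely_generated_iff)
  obtain SY where SY: "finite SY" "SY \<subseteq> carrier M2" "\<And>U. submodule U R M2 \<Longrightarrow> SY \<subseteq> U \<Longrightarrow> U = carrier M2"
    using fg(2) unfolding fg_module_def by (metis finitely_generated_iff)
  obtain SZ where SZ: "finite SZ" "SZ \<subseteq> carrier M3" "\<And>U. submodule U R M3 \<Longrightarrow> SZ \<subseteq> U \<Longrightarrow> U = carrier M3"
    using fg(3) unfolding fg_module_def by (metis finitely_generated_iff)
  have gen: "U = carrier M" if U: "submodule U R M" and sub: "f ` SX \<union> g ` SY \<union> h ` SZ \<subseteq> U" for U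
  proof -
    have "{x \<in> carrier M1. f x \<in> U} = carrier M1"
      using SX sub by (intro SX(3) submodule_vimage[OF rm(1) M l(1) U]) auto
    then have 1: "f x \<in> U" if "x \<in> carrier M1" for x using that by auto
    have "{x \<in> carrier M2. g x \<in> U} = carrier M2"
      using SY sub by (intro SY(3) submodule_vimage[OF rm(2) M l(2) U]) auto
    then have 2: "g x \<in> U" if "x \<in> carrier M2" for x using that by auto
    have "{x \<in> carrier M3. h x \<in> U} = carrier M3"
      using SZ sub by (intro SZ(3) submodule_vimage[OF rm(3) M l(3) U]) auto
    then have 3: "h x \<in> U" if "x \<in> carrier M3" for x using that by auto
    have "carrier M \<subseteq> U"
    proof
      fix m assume "m \<in> carrier M"
      then obtain x y z where "x \<in> carrier M1" "y \<in> carrier M2" "z \<in> carrier M3"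
        "m = f x \<oplus>\<^bsub>M\<^esub> g y \<oplus>\<^bsub>M\<^esub> h z" using surj by metis
      then show "m \<in> U" using 1 2 3 by (simp add: rm_submoduleD(3)[OF M U])
    qed
    then show ?thesis using rm_submoduleD(1)[OF M U] by auto
  qed
  have fin: "finite (f ` SX \<union> g ` SY \<union> h ` SZ)" "f ` SX \<union> g ` SY \<union> h ` SZ \<subseteq> carrier M"
    using SX SY SZ linD(1)[OF l(1)] linD(1)[OF l(2)] linD(1)[OF l(3)] by auto
  show ?thesis
    unfolding fg_module_def finitely_generated_iff[OF M]
    by (rule conjI[OF M], rule exI[of _ "f ` SX \<union> g ` SY \<union> h ` SZ"]) (use fin gen in simp)
qed

lemma fg_module_image:
  assumes fg: "fg_module R M1" and M: "right_module R M" and l: "lin R M1 M f"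
    and surj: "f ` carrier M1 = carrier M"
  shows "fg_module R M"
proof (rule fg_module_three_images[OF M fg fg fg l])
  note M1 = fg_moduleD(1)[OF fg]
  interpret M: abelian_group M using M by (simp add: right_module_def)
  interpret M1: abelian_group M1 using M1 by (simp add: right_module_def)
  show "lin R M1 M (\<lambda>_. \<zero>\<^bsub>M\<^esub>)" "lin R M1 M (\<lambda>_. \<zero>\<^bsub>M\<^esub>)"
    by (rule lin_zero_map[OF M1 M])+
  fix m assume "m \<in> carrier M"
  moreover then obtain x where "x \<in> carrier M1" "m = f x" using surj by (metis imageE)
  ultimately show "\<exists>x\<in>carrier M1. \<exists>y\<in>carrier M1. \<exists>z\<in>carrier M1. m = f x \<oplus>\<^bsub>M\<^esub> \<zero>\<^bsub>M\<^esub> \<oplus>\<^bsub>M\<^esub> \<zero>\<^bsub>M\<^esub>"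
    by (intro bexI[of _ x]) auto
qed

lemma submodule_image:
  assumes M: "right_module R M" and N: "right_module R N" and f: "lin R M N f"
  shows "submodule (f ` carrier M) R N"
proof (rule rm_submoduleI[OF N])
  interpret M: right_module R M by fact
  note l = linD[OF f]
  show "f ` carrier M \<subseteq> carrier N" using l(1) by auto
  show "\<zero>\<^bsub>N\<^esub> \<in> f ` carrier M" using lin_zero[OF M N f] M.M.zero_closed by (metis imageI)
  show "x \<oplus>\<^bsub>N\<^esub> y \<in> f ` carrier M" if "x \<in> f ` carrier M" "y \<in> f ` carrier M" for x y
    using that by (auto simp: l(2)[symmetric])
  show "a \<odot>\<^bsub>N\<^esub> x \<in> f ` carrier M" if "a \<in> carrier R" "x \<in> f ` carrier M" for a x
    using that by (auto simp: l(3)[symmetric] M.smult_closed)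
qed

lemma submodule_equalizer:
  assumes M: "right_module R M" and N: "right_module R N" and f: "lin R M N f" and g: "lin R M N g"
  shows "submodule {x \<in> carrier M. f x = g x} R M"
  using right_module.smult_closed[OF M] lin_zero[OF M N f] lin_zero[OF M N g] linD[OF f] linD[OF g]
    right_moduleD(2)[OF M]
  by (intro rm_submoduleI[OF M]) (auto simp: abelian_groupE)

section \<open>Finite powers, and modules on a given type\<close>

definition power_module :: "nat \<Rightarrow> ('a, 'm, 'c) module_scheme \<Rightarrow> ('a, nat \<Rightarrow> 'm) module" where
  "power_module n M = \<lparr>carrier = {..<n} \<rightarrow>\<^sub>E carrier M, monoid.mult = undefined, one = undefined,
     zero = (\<lambda>i\<in>{..<n}. \<zero>\<^bsub>M\<^esub>), add = (\<lambda>x y. \<lambda>i\<in>{..<n}. x i \<oplus>\<^bsub>M\<^esub> y i),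
     smult = (\<lambda>a x. \<lambda>i\<in>{..<n}. a \<odot>\<^bsub>M\<^esub> x i)\<rparr>"

definition inj_at :: "nat \<Rightarrow> ('a, 'm, 'c) module_scheme \<Rightarrow> nat \<Rightarrow> 'm \<Rightarrow> nat \<Rightarrow> 'm" where
  "inj_at n M i m = (\<lambda>j\<in>{..<n}. if j = i then m else \<zero>\<^bsub>M\<^esub>)"

definition copair ::
  "nat \<Rightarrow> ('a, 'n, 'c) module_scheme \<Rightarrow> (nat \<Rightarrow> 'm \<Rightarrow> 'n) \<Rightarrow> (nat \<Rightarrow> 'm) \<Rightarrow> 'n" where
  "copair n N g x = (\<Oplus>\<^bsub>N\<^esub>i\<in>{..<n}. g i (x i))"

lemma power_module_simps [simp]:
  "carrier (power_module n M) = {..<n} \<rightarrow>\<^sub>E carrier M"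
  "\<zero>\<^bsub>power_module n M\<^esub> = (\<lambda>i\<in>{..<n}. \<zero>\<^bsub>M\<^esub>)"
  "x \<oplus>\<^bsub>power_module n M\<^esub> y = (\<lambda>i\<in>{..<n}. x i \<oplus>\<^bsub>M\<^esub> y i)"
  "a \<odot>\<^bsub>power_module n M\<^esub> x = (\<lambda>i\<in>{..<n}. a \<odot>\<^bsub>M\<^esub> x i)"
  by (simp_all add: power_module_def)

lemma pmem: "x \<in> {..<n} \<rightarrow>\<^sub>E carrier M \<Longrightarrow> i < n \<Longrightarrow> x i \<in> carrier M"
  by auto

lemma power_ext: "(\<And>i. i < n \<Longrightarrow> f i = g i) \<Longrightarrow> (\<lambda>i\<in>{..<n}. f i) = (\<lambda>i\<in>{..<n}. g i)"
  by (rule restrict_ext) simp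

lemma restrict_eq: "x \<in> {..<n} \<rightarrow>\<^sub>E carrier M \<Longrightarrow> (\<And>i. i < n \<Longrightarrow> f i = x i) \<Longrightarrow> (\<lambda>i\<in>{..<n}. f i) = x"
  by (rule extensionalityI[of _ "{..<n}"]) (auto simp: PiE_def)

context
  fixes R :: "('a, 'b) ring_scheme" and M :: "('a, 'm, 'c) module_scheme" and n :: nat
  assumes rm: "right_module R M"
begin

interpretation right_module R M by (rule rm)

lemma right_module_power: "right_module R (power_module n M)"
proof -
  have "abelian_group (power_module n M)"
  proof (rule abelian_groupI)
    fix x assume x: "x \<in> carrier (power_module n M)"
    show "\<exists>y\<in>carrier (power_module n M). y \<oplus>\<^bsub>power_module n M\<^esub> x = \<zero>\<^bsub>power_module n M\<^esub>"
    proof (rule bexI[of _ "\<lambda>i\<in>{..<n}. \<ominus>\<^bsub>M\<^esub> x i"])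
      show "(\<lambda>i\<in>{..<n}. \<ominus>\<^bsub>M\<^esub> x i) \<oplus>\<^bsub>power_module n M\<^esub> x = \<zero>\<^bsub>power_module n M\<^esub>"
        using x by (simp add: M.l_neg pmem cong: restrict_cong)
      show "(\<lambda>i\<in>{..<n}. \<ominus>\<^bsub>M\<^esub> x i) \<in> carrier (power_module n M)"
        using x by (simp add: restrict_PiE_iff pmem)
    qed
    show "\<zero>\<^bsub>power_module n M\<^esub> \<oplus>\<^bsub>power_module n M\<^esub> x = x"
      using x by (simp add: restrict_eq pmem)
  next
    fix x y z
    assume xyz: "x \<in> carrier (power_module n M)" "y \<in> carrier (power_module n M)"
      "z \<in> carrier (power_module n M)"
    show "x \<oplus>\<^bsub>power_module n M\<^esub> y \<oplus>\<^bsub>power_module n M\<^esub> z =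
      x \<oplus>\<^bsub>power_module n M\<^esub> (y \<oplus>\<^bsub>power_module n M\<^esub> z)"
      using xyz by (simp add: M.a_assoc pmem cong: restrict_cong)
  next
    fix x y
    assume xy: "x \<in> carrier (power_module n M)" "y \<in> carrier (power_module n M)"
    show "x \<oplus>\<^bsub>power_module n M\<^esub> y \<in> carrier (power_module n M)"
      using xy by (simp add: restrict_PiE_iff pmem)
    show "x \<oplus>\<^bsub>power_module n M\<^esub> y = y \<oplus>\<^bsub>power_module n M\<^esub> x"
      using xy by (simp add: M.a_comm pmem cong: restrict_cong)
  qed (simp add: restrict_PiE_iff)
  then show ?thesis
    using R.ring_axioms
    by (intro right_module.intro right_module_axioms.intro)
      (simp_all add: restrict_PiE_iff pmem smult_closed smult_l_distr smult_r_distr smult_assoc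
        smult_one restrict_eq cong: restrict_cong)
qed

lemma lin_component: "i < n \<Longrightarrow> lin R (power_module n M) M (\<lambda>x. x i)"
  by (rule linI) auto

lemma lin_inj_at: "lin R M (power_module n M) (inj_at n M i)"
  by (rule linI) (simp_all add: inj_at_def restrict_PiE_iff, auto simp: rm_smult_zero[OF rm] intro!: power_ext)

text \<open>The partial truncations of an element are reached one component after the other.\<close>

lemma power_submodule_eq:
  assumes U: "submodule U R (power_module n M)"
    and inj: "\<And>i m. i < n \<Longrightarrow> m \<in> carrier M \<Longrightarrow> inj_at n M i m \<in> U"
  shows "U = carrier (power_module n M)"
proof
  note u = rm_submoduleD[OF right_module_power U]
  show "U \<subseteq> carrier (power_module n M)" by (rule u(1))
  show "carrier (power_module n M) \<subseteq> U"
  proof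
    fix x assume x: "x \<in> carrier (power_module n M)"
    have xc: "x i \<in> carrier M" if "i < n" for i using x that by auto
    have "(\<lambda>j\<in>{..<n}. if j < k then x j else \<zero>\<^bsub>M\<^esub>) \<in> U" if "k \<le> n" for k
      using that
    proof (induction k)
      case 0
      then show ?case using u(2) by (simp only: power_module_simps not_less0 if_False)
    next
      case (Suc k)
      have "(\<lambda>j\<in>{..<n}. if j < Suc k then x j else \<zero>\<^bsub>M\<^esub>) =
        (\<lambda>j\<in>{..<n}. if j < k then x j else \<zero>\<^bsub>M\<^esub>) \<oplus>\<^bsub>power_module n M\<^esub> inj_at n M k (x k)"
        unfolding power_module_simps
        by (rule power_ext) (use Suc.prems in \<open>auto simp: inj_at_def less_Suc_eq xc\<close>)
      also have "\<dots> \<in> U"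
      proof (intro u(3) inj)
        show "(\<lambda>j\<in>{..<n}. if j < k then x j else \<zero>\<^bsub>M\<^esub>) \<in> U"
          by (rule Suc.IH) (use Suc.prems in simp)
      qed (use Suc.prems xc in auto)
      finally show ?case .
    qed
    from this[of n] have "(\<lambda>j\<in>{..<n}. if j < n then x j else \<zero>\<^bsub>M\<^esub>) \<in> U" by simp
    also have "(\<lambda>j\<in>{..<n}. if j < n then x j else \<zero>\<^bsub>M\<^esub>) = x"
      using x by (simp add: restrict_eq)
    finally show "x \<in> U" .
  qed
qed

lemma lin_power_eq:
  assumes N: "right_module R N" and f: "lin R (power_module n M) N f" and g: "lin R (power_module n M) N g"
    and eq: "\<And>i m. i < n \<Longrightarrow> m \<in> carrier M \<Longrightarrow> f (inj_at n M i m) = g (inj_at n M i m)"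
    and x: "x \<in> carrier (power_module n M)"
  shows "f x = g x"
proof -
  have "{x \<in> carrier (power_module n M). f x = g x} = carrier (power_module n M)"
    using eq linD(1)[OF lin_inj_at]
    by (intro power_submodule_eq submodule_equalizer[OF right_module_power N f g]) auto
  then show ?thesis using x by auto
qed

lemma lin_copair:
  assumes N: "right_module R N" and g: "\<And>i. i < n \<Longrightarrow> lin R M N (g i)"
  shows "lin R (power_module n M) N (copair n N g)"
proof -
  interpret N: right_module R N by fact
  have mem: "g i (x i) \<in> carrier N" if "x \<in> carrier (power_module n M)" "i < n" for x i
    using that linD(1)[OF g] by auto
  have cl: "(\<lambda>i. g i (x i)) \<in> {..<n} \<rightarrow> carrier N" if "x \<in> carrier (power_module n M)" for x
    using mem[OF that] by auto
  show ?thesis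
  proof (rule linI)
    fix x assume x: "x \<in> carrier (power_module n M)"
    show "copair n N g x \<in> carrier N"
      unfolding copair_def using cl[OF x] by (rule N.M.finsum_closed)
    { fix y assume y: "y \<in> carrier (power_module n M)"
      have "(\<Oplus>\<^bsub>N\<^esub>i\<in>{..<n}. g i ((x \<oplus>\<^bsub>power_module n M\<^esub> y) i)) =
        (\<Oplus>\<^bsub>N\<^esub>i\<in>{..<n}. g i (x i) \<oplus>\<^bsub>N\<^esub> g i (y i))"
        using x y mem[OF x] mem[OF y]
        by (intro N.M.finsum_cong) (auto simp: linD(2)[OF g] simp_implies_def pmem)
      also have "\<dots> = copair n N g x \<oplus>\<^bsub>N\<^esub> copair n N g y"
        unfolding copair_def using cl[OF x] cl[OF y] by (simp add: N.M.finsum_addf)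
      finally show "copair n N g (x \<oplus>\<^bsub>power_module n M\<^esub> y) = copair n N g x \<oplus>\<^bsub>N\<^esub> copair n N g y"
        unfolding copair_def .
    }
    fix a assume a: "a \<in> carrier R"
    have la: "a \<odot>\<^bsub>N\<^esub> (\<Oplus>\<^bsub>N\<^esub>i\<in>F. h i) = (\<Oplus>\<^bsub>N\<^esub>i\<in>F. a \<odot>\<^bsub>N\<^esub> h i)"
      if "finite F" "h \<in> F \<rightarrow> carrier N" for F :: "nat set" and h
      using that
    proof (induction F)
      case empty
      then show ?case by (simp add: rm_smult_zero[OF N a])
    next
      case (insert i F)
      then have "h i \<in> carrier N" "h \<in> F \<rightarrow> carrier N" "a \<odot>\<^bsub>N\<^esub> h i \<in> carrier N"
        "(\<lambda>i. a \<odot>\<^bsub>N\<^esub> h i) \<in> F \<rightarrow> carrier N"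
        using a by (auto intro!: N.smult_closed)
      then show ?case using insert a by (simp add: N.smult_r_distr)
    qed
    have "copair n N g (a \<odot>\<^bsub>power_module n M\<^esub> x) = (\<Oplus>\<^bsub>N\<^esub>i\<in>{..<n}. a \<odot>\<^bsub>N\<^esub> g i (x i))"
      unfolding copair_def using a x mem[OF x]
      by (intro N.M.finsum_cong) (auto simp: linD(3)[OF g] simp_implies_def pmem N.smult_closed)
    then show "copair n N g (a \<odot>\<^bsub>power_module n M\<^esub> x) = a \<odot>\<^bsub>N\<^esub> copair n N g x"
      using la[OF _ cl[OF x]] by (simp add: copair_def)
  qed
qed

lemma copair_inj_at:
  assumes N: "right_module R N" and g: "\<And>i. i < n \<Longrightarrow> lin R M N (g i)" and i: "i < n"
    and m: "m \<in> carrier M"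
  shows "copair n N g (inj_at n M i m) = g i m"
proof -
  interpret N: right_module R N by fact
  have *: "g j m \<in> carrier N" if "j < n" for j using linD(1)[OF g[OF that] m] .
  have "copair n N g (inj_at n M i m) = (\<Oplus>\<^bsub>N\<^esub>j\<in>{..<n}. if i = j then g j m else \<zero>\<^bsub>N\<^esub>)"
    unfolding copair_def inj_at_def using m
    by (intro N.M.finsum_cong) (auto simp: * lin_zero[OF rm N g] simp_implies_def)
  also have "\<dots> = g i m"
    using N.M.finsum_singleton[of i "{..<n}" "\<lambda>j. g j m"] i * by auto
  finally show ?thesis .
qed

lemma fg_module_power:
  assumes "finitely_generated R M"
  shows "fg_module R (power_module n M)"
proof -
  obtain S where S: "finite S" "S \<subseteq> carrier M" "\<And>U. submodule U R M \<Longrightarrow> S \<subseteq> U \<Longrightarrow> U = carrier M"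
    using assms finitely_generated_iff[OF rm] by metis
  let ?G = "(\<lambda>(i, s). inj_at n M i s) ` ({..<n} \<times> S)"
  have gen: "U = carrier (power_module n M)" if U: "submodule U R (power_module n M)" "?G \<subseteq> U" for U
  proof (rule power_submodule_eq[OF U(1)])
    fix i m assume i: "i < n" and m: "m \<in> carrier M"
    have "{x \<in> carrier M. inj_at n M i x \<in> U} = carrier M"
      using S(2) U(2) i by (intro S(3) submodule_vimage[OF rm right_module_power lin_inj_at U(1)]) auto
    then show "inj_at n M i m \<in> U" using m by auto
  qed
  have fin: "finite ?G" "?G \<subseteq> carrier (power_module n M)"
    using S linD(1)[OF lin_inj_at] by (auto simp del: power_module_simps)
  show ?thesis
    unfolding fg_module_def finitely_generated_iff[OF right_module_power]
    by (rule conjI[OF right_module_power], rule exI[of _ ?G]) (use fin gen in simp)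
qed

end

text \<open>
  Listing coefficients with respect to finitely many generators embeds a finitely generated module
  into \<open>nat \<Rightarrow> 'a\<close>.  A quotient of it is thus realised on this type by choosing
  a representative in each class and listing its coefficients.
\<close>

lemma fg_module_quotient_umod:
  fixes R :: "('a, 'b) ring_scheme" and M :: "('a, 'm, 'c) module_scheme"
  assumes fg: "fg_module R M" and W: "submodule W R M"
  obtains C :: "'a umod" and p where "fg_module R C" "lin R M C p" "p ` carrier M = carrier C"
    "\<And>x. x \<in> carrier M \<Longrightarrow> p x = \<zero>\<^bsub>C\<^esub> \<longleftrightarrow> x \<in> W"
proof -
  note rm = fg_moduleD(1)[OF fg]
  interpret right_module R M by (rule rm)
  note w = rm_submoduleD[OF rm W]
  obtain S where S: "finite S" "S \<subseteq> carrier M"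
    and ex: "\<forall>x\<in>carrier M. \<exists>c\<in>S \<rightarrow> carrier R. x = (\<Oplus>\<^bsub>M\<^esub>s\<in>S. c s \<odot>\<^bsub>M\<^esub> s)"
    using fg_moduleD(2)[OF fg] unfolding finitely_generated_def by blast
  obtain c where c: "\<And>x. x \<in> carrier M \<Longrightarrow> c x \<in> S \<rightarrow> carrier R"
    "\<And>x. x \<in> carrier M \<Longrightarrow> x = (\<Oplus>\<^bsub>M\<^esub>s\<in>S. c x s \<odot>\<^bsub>M\<^esub> s)"
    using ex by metis
  obtain e :: "nat \<Rightarrow> 'm" and n where e: "S = e ` {..<n}"
    using finite_imp_nat_seg_image_inj_on[OF S(1)] by (metis lessThan_def)
  \<comment> \<open>\<open>r\<close> picks a representative of each class modulo \<open>W\<close>, \<open>c\<close> coefficients of each element.\<close>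
  define r where "r x = (SOME y. y \<in> carrier M \<and> y \<ominus>\<^bsub>M\<^esub> x \<in> W)" for x
  have r: "r x \<in> carrier M" "r x \<ominus>\<^bsub>M\<^esub> x \<in> W" if "x \<in> carrier M" for x
  proof -
    have "x \<in> carrier M \<and> x \<ominus>\<^bsub>M\<^esub> x \<in> W" using that w(2) by (simp add: M.minus_eq M.r_neg)
    from someI[of "\<lambda>y. y \<in> carrier M \<and> y \<ominus>\<^bsub>M\<^esub> x \<in> W", OF this]
    show "r x \<in> carrier M" "r x \<ominus>\<^bsub>M\<^esub> x \<in> W" unfolding r_def by auto
  qed
  have req: "r x = r y" if "x \<in> carrier M" "y \<in> carrier M" "x \<ominus>\<^bsub>M\<^esub> y \<in> W" for x y
  proof -
    have yx: "y \<ominus>\<^bsub>M\<^esub> x \<in> W"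
      using w(4)[OF that(3)] that by (simp add: M.minus_eq M.minus_add M.a_comm)
    have "z \<ominus>\<^bsub>M\<^esub> y \<in> W \<longleftrightarrow> z \<ominus>\<^bsub>M\<^esub> x \<in> W" if z: "z \<in> carrier M" for z
    proof -
      have "z \<ominus>\<^bsub>M\<^esub> y \<oplus>\<^bsub>M\<^esub> (y \<ominus>\<^bsub>M\<^esub> x) = z \<ominus>\<^bsub>M\<^esub> x" "z \<ominus>\<^bsub>M\<^esub> x \<oplus>\<^bsub>M\<^esub> (x \<ominus>\<^bsub>M\<^esub> y) = z \<ominus>\<^bsub>M\<^esub> y"
        using that z \<open>x \<in> carrier M\<close> \<open>y \<in> carrier M\<close>
        by (simp_all add: M.minus_eq M.a_assoc M.r_neg2 M.r_neg1)
      then show ?thesis using w(3) yx \<open>x \<ominus>\<^bsub>M\<^esub> y \<in> W\<close> by metis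
    qed
    then have "(\<lambda>z. z \<in> carrier M \<and> z \<ominus>\<^bsub>M\<^esub> x \<in> W) = (\<lambda>z. z \<in> carrier M \<and> z \<ominus>\<^bsub>M\<^esub> y \<in> W)" by auto
    then show ?thesis unfolding r_def by (rule arg_cong)
  qed
  \<comment> \<open>The default value off the index set is irrelevant, but it has to be the same for all \<open>x\<close>.\<close>
  define p where "p x = (\<lambda>i. if i < n then c (r x) (e i) else undefined)" for x
  have pr: "r x = r y" if "p x = p y" "x \<in> carrier M" "y \<in> carrier M" for x y
  proof -
    have "c (r x) s = c (r y) s" if "s \<in> S" for s
    proof -
      obtain i where "i < n" "s = e i" using \<open>s \<in> S\<close> e by auto
      then show ?thesis using fun_cong[OF \<open>p x = p y\<close>, of i] by (simp add: p_def)
    qed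
    then have "(\<Oplus>\<^bsub>M\<^esub>s\<in>S. c (r x) s \<odot>\<^bsub>M\<^esub> s) = (\<Oplus>\<^bsub>M\<^esub>s\<in>S. c (r y) s \<odot>\<^bsub>M\<^esub> s)"
      using c(1)[OF r(1)[OF \<open>y \<in> carrier M\<close>]] S(2)
      by (intro M.finsum_cong) (auto simp: simp_implies_def intro!: smult_closed)
    then show ?thesis using c(2) r(1) that by metis
  qed
  have pe: "p x = p y \<longleftrightarrow> x \<ominus>\<^bsub>M\<^esub> y \<in> W" if "x \<in> carrier M" "y \<in> carrier M" for x y
  proof
    assume "x \<ominus>\<^bsub>M\<^esub> y \<in> W"
    then have "r x = r y" by (rule req[OF that])
    then show "p x = p y" unfolding p_def by (rule arg_cong)
  next
    assume "p x = p y"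
    then have eq: "r x = r y" by (rule pr[OF _ that])
    note cl = that r(1)[OF that(1)]
    have "x \<ominus>\<^bsub>M\<^esub> y = (x \<ominus>\<^bsub>M\<^esub> r x) \<oplus>\<^bsub>M\<^esub> (r x \<ominus>\<^bsub>M\<^esub> y)"
      using cl by (simp add: M.minus_eq M.a_assoc M.r_neg1)
    moreover have "x \<ominus>\<^bsub>M\<^esub> r x = \<ominus>\<^bsub>M\<^esub> (r x \<ominus>\<^bsub>M\<^esub> x)"
      using cl by (simp add: M.minus_eq M.minus_add M.a_comm)
    ultimately have "x \<ominus>\<^bsub>M\<^esub> y = \<ominus>\<^bsub>M\<^esub> (r x \<ominus>\<^bsub>M\<^esub> x) \<oplus>\<^bsub>M\<^esub> (r y \<ominus>\<^bsub>M\<^esub> y)"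
      using eq by simp
    then show "x \<ominus>\<^bsub>M\<^esub> y \<in> W" using w(3,4) r(2) that by simp
  qed
  define s where "s z = (SOME x. x \<in> carrier M \<and> p x = z)" for z
  have s: "s (p x) \<in> carrier M" "s (p x) \<ominus>\<^bsub>M\<^esub> x \<in> W" if "x \<in> carrier M" for x
  proof -
    have "x \<in> carrier M \<and> p x = p x" using that by simp
    from someI[of "\<lambda>y. y \<in> carrier M \<and> p y = p x", OF this]
    have "s (p x) \<in> carrier M \<and> p (s (p x)) = p x" unfolding s_def .
    then show "s (p x) \<in> carrier M" "s (p x) \<ominus>\<^bsub>M\<^esub> x \<in> W" using pe that by auto
  qed
  define C :: "'a umod" where "C = \<lparr>carrier = p ` carrier M, monoid.mult = undefined, one = undefined,
    zero = p \<zero>\<^bsub>M\<^esub>, add = (\<lambda>y z. p (s y \<oplus>\<^bsub>M\<^esub> s z)), smult = (\<lambda>a z. p (a \<odot>\<^bsub>M\<^esub> s z))\<rparr>"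
  have l: "lin R M C p"
  proof (rule linI)
    fix x assume x: "x \<in> carrier M"
    show "p x \<in> carrier C" using x by (simp add: C_def)
    { fix y assume y: "y \<in> carrier M"
      have "s (p x) \<oplus>\<^bsub>M\<^esub> s (p y) \<ominus>\<^bsub>M\<^esub> (x \<oplus>\<^bsub>M\<^esub> y) = (s (p x) \<ominus>\<^bsub>M\<^esub> x) \<oplus>\<^bsub>M\<^esub> (s (p y) \<ominus>\<^bsub>M\<^esub> y)"
        using x y s(1) by (simp add: M.minus_eq M.minus_add M.a_ac)
      then have "p (s (p x) \<oplus>\<^bsub>M\<^esub> s (p y)) = p (x \<oplus>\<^bsub>M\<^esub> y)"
        using w(3)[OF s(2)[OF x] s(2)[OF y]] s(1) x y by (subst pe) simp_all
      then show "p (x \<oplus>\<^bsub>M\<^esub> y) = p x \<oplus>\<^bsub>C\<^esub> p y" by (simp add: C_def)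
    }
    fix a assume a: "a \<in> carrier R"
    have "a \<odot>\<^bsub>M\<^esub> s (p x) \<ominus>\<^bsub>M\<^esub> (a \<odot>\<^bsub>M\<^esub> x) = a \<odot>\<^bsub>M\<^esub> (s (p x) \<ominus>\<^bsub>M\<^esub> x)"
      using x a s(1) by (simp add: M.minus_eq smult_r_distr rm_smult_minus[OF rm])
    then have "p (a \<odot>\<^bsub>M\<^esub> s (p x)) = p (a \<odot>\<^bsub>M\<^esub> x)"
      using w(5)[OF a s(2)[OF x]] s(1) x a by (subst pe) (simp_all add: smult_closed)
    then show "p (a \<odot>\<^bsub>M\<^esub> x) = a \<odot>\<^bsub>C\<^esub> p x" by (simp add: C_def)
  qed
  have surj: "p ` carrier M = carrier C" and z: "p \<zero>\<^bsub>M\<^esub> = \<zero>\<^bsub>C\<^esub>" by (simp_all add: C_def)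
  have "right_module R C" by (rule right_module_image[OF rm l surj z])
  then have "fg_module R C" by (rule fg_module_image[OF fg _ l surj])
  moreover have "p x = \<zero>\<^bsub>C\<^esub> \<longleftrightarrow> x \<in> W" if "x \<in> carrier M" for x
  proof -
    have "\<ominus>\<^bsub>M\<^esub> \<zero>\<^bsub>M\<^esub> = \<zero>\<^bsub>M\<^esub>"
      by (rule M.minus_equality) simp_all
    then have "x \<ominus>\<^bsub>M\<^esub> \<zero>\<^bsub>M\<^esub> = x" unfolding a_minus_def using that by (simp only: M.r_zero)
    then show ?thesis using pe[OF that M.zero_closed] by (simp only: z)
  qed
  ultimately show ?thesis using that l surj by blast
qed

lemma fg_module_umod_copy:
  fixes R :: "('a, 'b) ring_scheme" and M :: "('a, 'm, 'c) module_scheme"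
  assumes fg: "fg_module R M"
  shows "\<exists>(H :: 'a umod) i r. fg_module R H \<and> lin R M H i \<and> lin R H M r \<and>
    (\<forall>x\<in>carrier M. r (i x) = x) \<and> (\<forall>y\<in>carrier H. i (r y) = y)"
proof -
  note rm = fg_moduleD(1)[OF fg]
  interpret M: right_module R M by (rule rm)
  have W: "submodule {\<zero>\<^bsub>M\<^esub>} R M"
    by (rule rm_submoduleI[OF rm]) (auto simp: rm_smult_zero[OF rm])
  obtain H :: "'a umod" and p where H: "fg_module R H" and p: "lin R M H p" "p ` carrier M = carrier H"
    and z: "\<And>x. x \<in> carrier M \<Longrightarrow> p x = \<zero>\<^bsub>H\<^esub> \<longleftrightarrow> x \<in> {\<zero>\<^bsub>M\<^esub>}"
    by (rule fg_module_quotient_umod[OF fg W]) (rule that)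
  note Hr = fg_moduleD(1)[OF H]
  interpret H: right_module R H by (rule Hr)
  have inj: "inj_on p (carrier M)"
  proof (rule inj_onI)
    fix x y assume xy: "x \<in> carrier M" "y \<in> carrier M" "p x = p y"
    have "p (x \<oplus>\<^bsub>M\<^esub> \<ominus>\<^bsub>M\<^esub> y) = p x \<oplus>\<^bsub>H\<^esub> \<ominus>\<^bsub>H\<^esub> p y"
      using xy(1,2) by (simp add: linD(2)[OF p(1)] lin_minus[OF rm Hr p(1)])
    also have "\<dots> = \<zero>\<^bsub>H\<^esub>" using xy linD(1)[OF p(1)] by (simp add: H.M.r_neg)
    finally have "x \<oplus>\<^bsub>M\<^esub> \<ominus>\<^bsub>M\<^esub> y = \<zero>\<^bsub>M\<^esub>" using z[of "x \<oplus>\<^bsub>M\<^esub> \<ominus>\<^bsub>M\<^esub> y"] xy by simp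
    then show "x = y" using xy(1,2) by (metis M.M.minus_equality M.M.minus_minus M.M.a_inv_closed)
  qed
  let ?r = "inv_into (carrier M) p"
  have r: "lin R H M ?r"
    using p(2) by (intro lin_inverse[OF rm p(1) _ _ inj]) (auto simp: f_inv_into_f inv_into_into)
  show ?thesis
    using H p r by (intro exI[of _ H] exI[of _ p] exI[of _ ?r])
      (auto simp: inv_into_f_f[OF inj] f_inv_into_f simp flip: p(2))
qed

section \<open>Projective modules and retracts\<close>

lemma right_module_regular:
  assumes "ring R" shows "right_module R (regular R)"
proof -
  interpret ring R by fact
  have "abelian_group (regular R)"
    by (rule abelian_groupI) (auto simp: regular_def a_ac intro: l_neg)
  then show ?thesis
    using ring_axioms
    by (intro right_module.intro right_module_axioms.intro)
      (auto simp: regular_def l_distr r_distr m_assoc)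
qed

lemma fg_module_regular:
  assumes "ring R" shows "fg_module R (regular R)"
proof -
  interpret ring R by fact
  note rm = right_module_regular[OF assms]
  have "U = carrier (regular R)" if U: "submodule U R (regular R)" "{\<one>\<^bsub>R\<^esub>} \<subseteq> U" for U
    using rm_submoduleD(1)[OF rm U(1)] rm_submoduleD(5)[OF rm U(1), of _ "\<one>\<^bsub>R\<^esub>"] U(2)
    by (auto simp: regular_def)
  then show ?thesis
    unfolding fg_module_def finitely_generated_iff[OF rm] using rm
    by (auto simp: regular_def intro!: exI[of _ "{\<one>\<^bsub>R\<^esub>}"])
qed

lemma lin_regular:
  assumes "right_module R M" "x \<in> carrier M"
  shows "lin R (regular R) M (\<lambda>a. a \<odot>\<^bsub>M\<^esub> x)"
proof -
  interpret right_module R M by fact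
  show ?thesis
    using assms(2) by (intro linI) (auto simp: regular_def smult_closed smult_l_distr smult_assoc)
qed

lemma projective_fg: "projective R P \<Longrightarrow> fg_module R P"
  by (simp add: projective_def)

lemma projective_lift:
  fixes Z Y :: "'a umod"
  assumes P: "projective R P" and Z: "fg_module R Z" and Y: "fg_module R Y"
    and g: "lin R Z Y g" "g ` carrier Z = carrier Y" and f: "lin R P Y f"
  obtains h where "lin R P Z h" "\<And>p. p \<in> carrier P \<Longrightarrow> g (h p) = f p"
proof -
  have "restrict g (carrier Z) \<in> homs R Z Y"
    by (rule restrict_in_homs[OF fg_moduleD(1)[OF Z] g(1)])
  moreover have "restrict f (carrier P) \<in> homs R P Y"
    by (rule restrict_in_homs[OF fg_moduleD(1)[OF projective_fg[OF P]] f])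
  moreover have "restrict g (carrier Z) ` carrier Z = carrier Y" using g(2) by auto
  ultimately obtain h where h: "h \<in> homs R P Z"
    "\<forall>p\<in>carrier P. restrict g (carrier Z) (h p) = restrict f (carrier P) p"
    using P Z Y unfolding projective_def by metis
  then show ?thesis
    using that[of h] linD(1)[OF homs_lin[OF h(1)]] homs_lin[OF h(1)] by auto
qed

lemma projectiveI:
  fixes R :: "('a, 'b) ring_scheme"
  assumes P: "fg_module R P"
    and lift: "\<And>(Z :: 'a umod) (Y :: 'a umod) g f. fg_module R Z \<Longrightarrow> fg_module R Y \<Longrightarrow> lin R Z Y g \<Longrightarrow>
      g ` carrier Z = carrier Y \<Longrightarrow> lin R P Y f \<Longrightarrow> \<exists>h. lin R P Z h \<and> (\<forall>p\<in>carrier P. g (h p) = f p)"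
  shows "projective R P"
  unfolding projective_def
proof (intro conjI allI impI ballI)
  show "fg_module R P" by fact
  fix Z Y :: "'a umod" and g f
  assume *: "fg_module R Z" "fg_module R Y" "g \<in> homs R Z Y" "g ` carrier Z = carrier Y" "f \<in> homs R P Y"
  obtain h where h: "lin R P Z h" "\<forall>p\<in>carrier P. g (h p) = f p"
    using lift[OF *(1,2) homs_lin[OF *(3)] *(4) homs_lin[OF *(5)]] by auto
  then show "\<exists>h\<in>homs R P Z. \<forall>p\<in>carrier P. g (h p) = f p"
    using restrict_in_homs[OF fg_moduleD(1)[OF P] h(1)] by (intro bexI) auto
qed

lemma projective_free:
  fixes R :: "('a, 'b) ring_scheme"
  assumes R: "ring R"
  shows "projective R (power_module n (regular R))"
proof (rule projectiveI)
  interpret ring R by fact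
  note rm = right_module_regular[OF R]
  show "fg_module R (power_module n (regular R))"
    by (rule fg_module_power[OF rm fg_moduleD(2)[OF fg_module_regular[OF R]]])
  fix Z Y :: "'a umod" and g f
  assume fg: "fg_module R Z" "fg_module R Y" and g: "lin R Z Y g" "g ` carrier Z = carrier Y"
    and f: "lin R (power_module n (regular R)) Y f"
  note Z = fg_moduleD(1)[OF fg(1)] and Y = fg_moduleD(1)[OF fg(2)]
  let ?e = "\<lambda>i. inj_at n (regular R) i \<one>\<^bsub>R\<^esub>"
  have one: "\<one>\<^bsub>R\<^esub> \<in> carrier (regular R)" by (simp add: regular_def)
  have "f (?e i) \<in> carrier Y" for i
    using linD(1)[OF f linD(1)[OF lin_inj_at[OF rm] one]] .
  then have "\<forall>i. \<exists>z. z \<in> carrier Z \<and> g z = f (?e i)" using g(2) by (metis imageE)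
  then obtain z where z: "\<And>i. z i \<in> carrier Z" "\<And>i. g (z i) = f (?e i)" by metis
  let ?h = "copair n Z (\<lambda>i a. a \<odot>\<^bsub>Z\<^esub> z i)"
  have lz: "lin R (regular R) Z (\<lambda>a. a \<odot>\<^bsub>Z\<^esub> z i)" for i
    by (rule lin_regular[OF Z z(1)])
  have h: "lin R (power_module n (regular R)) Z ?h"
    by (rule lin_copair[OF rm Z lz])
  have "g (?h p) = f p" if "p \<in> carrier (power_module n (regular R))" for p
  proof (rule lin_power_eq[OF rm Y lin_comp[OF h g(1)] f _ that])
    fix i a assume i: "i < n" and a: "a \<in> carrier (regular R)"
    then have a': "a \<in> carrier R" and a1: "a \<odot>\<^bsub>regular R\<^esub> \<one>\<^bsub>R\<^esub> = a" by (simp_all add: regular_def)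
    have "g (?h (inj_at n (regular R) i a)) = a \<odot>\<^bsub>Y\<^esub> f (?e i)"
      using copair_inj_at[OF rm Z lz i a] linD(3)[OF g(1) a' z(1)] z(2) by simp
    also have "\<dots> = f (inj_at n (regular R) i a)"
      using linD(3)[OF f a' linD(1)[OF lin_inj_at[OF rm] one]] linD(3)[OF lin_inj_at[OF rm] a' one]
      by (simp add: a1)
    finally show "g (?h (inj_at n (regular R) i a)) = f (inj_at n (regular R) i a)" .
  qed
  then show "\<exists>h. lin R (power_module n (regular R)) Z h \<and>
      (\<forall>p\<in>carrier (power_module n (regular R)). g (h p) = f p)" using h by blast
qed

lemma fg_module_free_cover:
  fixes R :: "('a, 'b) ring_scheme" and M :: "('a, 'm, 'c) module_scheme"
  assumes "fg_module R M"
  obtains n p where "lin R (power_module n (regular R)) M p"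
    "p ` carrier (power_module n (regular R)) = carrier M"
proof -
  note rm = fg_moduleD(1)[OF assms]
  interpret right_module R M by (rule rm)
  note reg = right_module_regular[OF R.ring_axioms]
  obtain S where S: "finite S" "S \<subseteq> carrier M" "\<And>U. submodule U R M \<Longrightarrow> S \<subseteq> U \<Longrightarrow> U = carrier M"
    using fg_moduleD(2)[OF assms] finitely_generated_iff[OF rm] by metis
  obtain e :: "nat \<Rightarrow> 'm" and n where e: "S = e ` {..<n}"
    using finite_imp_nat_seg_image_inj_on[OF S(1)] by (metis lessThan_def)
  have le: "lin R (regular R) M (\<lambda>a. a \<odot>\<^bsub>M\<^esub> e i)" if "i < n" for i
    using that S(2) e by (intro lin_regular[OF rm]) auto
  let ?p = "copair n M (\<lambda>i a. a \<odot>\<^bsub>M\<^esub> e i)"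
  have p: "lin R (power_module n (regular R)) M ?p" by (rule lin_copair[OF reg rm le])
  have "?p ` carrier (power_module n (regular R)) = carrier M"
  proof (rule S(3)[OF submodule_image[OF right_module_power[OF reg] rm p]])
    show "S \<subseteq> ?p ` carrier (power_module n (regular R))"
    proof
      fix s assume s: "s \<in> S"
      then obtain i where i: "i < n" "s = e i" using e by auto
      have one: "\<one>\<^bsub>R\<^esub> \<in> carrier (regular R)" by (simp add: regular_def)
      have "?p (inj_at n (regular R) i \<one>\<^bsub>R\<^esub>) = s"
        using copair_inj_at[OF reg rm le i(1) one] s S(2) i by (simp add: smult_one subset_iff)
      then show "s \<in> ?p ` carrier (power_module n (regular R))"
        using linD(1)[OF lin_inj_at[OF reg] one] by (metis imageI)
    qed
  qed
  then show ?thesis using that p by blast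
qed

text \<open>
  \<open>M\<close> is a direct summand of \<open>M1 \<oplus> M2 \<oplus> M3\<close>, expressed by the components of the inclusion and
  of the projection, which avoids constructing the direct sum.
\<close>

definition retract_of_sum ::
  "('a, 'b) ring_scheme \<Rightarrow> ('a, 'm, 'c) module_scheme \<Rightarrow> ('a, 'x, 'd) module_scheme \<Rightarrow>
    ('a, 'y, 'e) module_scheme \<Rightarrow> ('a, 'z, 'f) module_scheme \<Rightarrow> bool"
where
  "retract_of_sum R M M1 M2 M3 \<longleftrightarrow> (\<exists>i1 r1 i2 r2 i3 r3.
     lin R M M1 i1 \<and> lin R M1 M r1 \<and> lin R M M2 i2 \<and> lin R M2 M r2 \<and> lin R M M3 i3 \<and> lin R M3 M r3 \<and>
     (\<forall>x\<in>carrier M. x = r1 (i1 x) \<oplus>\<^bsub>M\<^esub> r2 (i2 x) \<oplus>\<^bsub>M\<^esub> r3 (i3 x)))"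

lemma retract_of_sumI:
  assumes "lin R M M1 i1" "lin R M1 M r1" "lin R M M2 i2" "lin R M2 M r2" "lin R M M3 i3" "lin R M3 M r3"
    and "\<And>x. x \<in> carrier M \<Longrightarrow> r1 (i1 x) \<oplus>\<^bsub>M\<^esub> r2 (i2 x) \<oplus>\<^bsub>M\<^esub> r3 (i3 x) = x"
  shows "retract_of_sum R M M1 M2 M3"
  unfolding retract_of_sum_def
  by (rule exI[of _ i1], rule exI[of _ r1], rule exI[of _ i2], rule exI[of _ r2],
      rule exI[of _ i3], rule exI[of _ r3]) (use assms in simp)

lemma retract_of_sumE:
  assumes "retract_of_sum R M M1 M2 M3"
  obtains i1 r1 i2 r2 i3 r3 where "lin R M M1 i1" "lin R M1 M r1" "lin R M M2 i2" "lin R M2 M r2"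
    "lin R M M3 i3" "lin R M3 M r3"
    "\<And>x. x \<in> carrier M \<Longrightarrow> r1 (i1 x) \<oplus>\<^bsub>M\<^esub> r2 (i2 x) \<oplus>\<^bsub>M\<^esub> r3 (i3 x) = x"
  using assms unfolding retract_of_sum_def by metis

lemma retract_of_sum_single:
  assumes M: "right_module R M" and M1: "right_module R M1" and Q: "right_module R Q"
    and i: "lin R M M1 i" and r: "lin R M1 M r" and ri: "\<And>x. x \<in> carrier M \<Longrightarrow> r (i x) = x"
  shows "retract_of_sum R M M1 M1 Q"
proof -
  interpret M: abelian_group M by (rule right_moduleD(2)[OF M])
  show ?thesis
    by (rule retract_of_sumI[where ?i1.0 = i and ?r1.0 = r and ?i2.0 = "\<lambda>_. \<zero>\<^bsub>M1\<^esub>" and ?r2.0 = "\<lambda>_. \<zero>\<^bsub>M\<^esub>"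
          and ?i3.0 = "\<lambda>_. \<zero>\<^bsub>Q\<^esub>" and ?r3.0 = "\<lambda>_. \<zero>\<^bsub>M\<^esub>"])
      (use i r ri lin_zero_map[OF M M1] lin_zero_map[OF M1 M] lin_zero_map[OF M Q] lin_zero_map[OF Q M]
       in simp_all)
qed

lemma fg_module_retract_of_sum:
  assumes M: "right_module R M" and fg: "fg_module R M1" "fg_module R M2" "fg_module R M3"
    and ret: "retract_of_sum R M M1 M2 M3"
  shows "fg_module R M"
proof -
  obtain i1 r1 i2 r2 i3 r3 where l: "lin R M M1 i1" "lin R M1 M r1" "lin R M M2 i2" "lin R M2 M r2"
    "lin R M M3 i3" "lin R M3 M r3"
    "\<And>x. x \<in> carrier M \<Longrightarrow> r1 (i1 x) \<oplus>\<^bsub>M\<^esub> r2 (i2 x) \<oplus>\<^bsub>M\<^esub> r3 (i3 x) = x"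
    by (rule retract_of_sumE[OF ret]) (rule that)
  show ?thesis
    by (rule fg_module_three_images[OF M fg l(2,4,6)])
      (metis l(7) linD(1)[OF l(1)] linD(1)[OF l(3)] linD(1)[OF l(5)])
qed

lemma projective_retract_of_sum:
  fixes R :: "('a, 'b) ring_scheme"
  assumes M: "right_module R M" and pr: "projective R M1" "projective R M2" "projective R M3"
    and ret: "retract_of_sum R M M1 M2 M3"
  shows "projective R M"
proof (rule projectiveI)
  show "fg_module R M"
    using fg_module_retract_of_sum[OF M _ _ _ ret] pr[THEN projective_fg] by simp
  fix Z Y :: "'a umod" and g f
  assume fg: "fg_module R Z" "fg_module R Y" and g: "lin R Z Y g" "g ` carrier Z = carrier Y"
    and f: "lin R M Y f"
  obtain i1 r1 i2 r2 i3 r3 where l: "lin R M M1 i1" "lin R M1 M r1" "lin R M M2 i2" "lin R M2 M r2"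
    "lin R M M3 i3" "lin R M3 M r3"
    "\<And>x. x \<in> carrier M \<Longrightarrow> r1 (i1 x) \<oplus>\<^bsub>M\<^esub> r2 (i2 x) \<oplus>\<^bsub>M\<^esub> r3 (i3 x) = x"
    by (rule retract_of_sumE[OF ret]) (rule that)
  interpret M: abelian_group M by (rule right_moduleD(2)[OF M])
  interpret Z: abelian_group Z by (rule right_moduleD(2)[OF fg_moduleD(1)[OF fg(1)]])
  note Zr = fg_moduleD(1)[OF fg(1)]
  obtain h1 where h1: "lin R M1 Z h1" "\<And>p. p \<in> carrier M1 \<Longrightarrow> g (h1 p) = f (r1 p)"
    by (rule projective_lift[OF pr(1) fg g lin_comp[OF l(2) f]]) (rule that)
  obtain h2 where h2: "lin R M2 Z h2" "\<And>p. p \<in> carrier M2 \<Longrightarrow> g (h2 p) = f (r2 p)"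
    by (rule projective_lift[OF pr(2) fg g lin_comp[OF l(4) f]]) (rule that)
  obtain h3 where h3: "lin R M3 Z h3" "\<And>p. p \<in> carrier M3 \<Longrightarrow> g (h3 p) = f (r3 p)"
    by (rule projective_lift[OF pr(3) fg g lin_comp[OF l(6) f]]) (rule that)
  let ?h = "\<lambda>x. h1 (i1 x) \<oplus>\<^bsub>Z\<^esub> h2 (i2 x) \<oplus>\<^bsub>Z\<^esub> h3 (i3 x)"
  have "lin R M Z ?h"
    by (intro lin_add_map[OF M Zr] lin_comp[OF l(1) h1(1)] lin_comp[OF l(3) h2(1)] lin_comp[OF l(5) h3(1)])
  moreover have "g (?h x) = f x" if x: "x \<in> carrier M" for x
  proof -
    note ix = linD(1)[OF l(1) x] linD(1)[OF l(3) x] linD(1)[OF l(5) x]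
    have "g (?h x) = f (r1 (i1 x) \<oplus>\<^bsub>M\<^esub> r2 (i2 x) \<oplus>\<^bsub>M\<^esub> r3 (i3 x))"
      using ix linD(1)[OF h1(1)] linD(1)[OF h2(1)] linD(1)[OF h3(1)] linD(1)[OF l(2)] linD(1)[OF l(4)]
        linD(1)[OF l(6)]
      by (simp add: linD(2)[OF g(1)] linD(2)[OF f] h1(2) h2(2) h3(2))
    then show ?thesis using l(7)[OF x] by simp
  qed
  ultimately show "\<exists>h. lin R M Z h \<and> (\<forall>p\<in>carrier M. g (h p) = f p)" by blast
qed

abbreviation ker_module ::
  "('a, 'm, 'c) module_scheme \<Rightarrow> ('a, 'n, 'd) module_scheme \<Rightarrow> ('m \<Rightarrow> 'n) \<Rightarrow> ('a, 'm, 'c) module_scheme" where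
  "ker_module P M g \<equiv> P\<lparr>carrier := a_kernel P M g\<rparr>"

lemma right_module_ker:
  "right_module R P \<Longrightarrow> right_module R M \<Longrightarrow> lin R P M g \<Longrightarrow> right_module R (ker_module P M g)"
  by (intro right_module_submodule submodule_kernel)

lemma lin_sub_dom: "lin R P M f \<Longrightarrow> U \<subseteq> carrier P \<Longrightarrow> lin R (P\<lparr>carrier := U\<rparr>) M f"
  by (auto simp: lin_def subset_iff)

lemma lin_sub_cod: "lin R P M f \<Longrightarrow> f ` carrier P \<subseteq> U \<Longrightarrow> lin R P (M\<lparr>carrier := U\<rparr>) f"
  by (auto simp: lin_def subset_iff)

text \<open>
  A generalised Schanuel lemma.  Let the three components of the identity of \<open>M\<close> pass through
  \<open>M1\<close>, \<open>M2\<close> and the projective module \<open>Q\<close>.  Lifting the maps \<open>M \<rightarrow> Mk \<rightarrow> M\<close> to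
  the projective modules above them gives endomorphisms of \<open>P\<close>, and so does lifting \<open>Q \<rightarrow> M\<close>.
  The identity of \<open>P\<close> differs from their sum by a map into the kernel, which on the kernel
  itself is the component that passes through \<open>P\<close>.
\<close>

lemma kernel_retract_of_sum:
  fixes M M1 M2 P P1 P2 :: "'a umod"
  assumes fg: "fg_module R M" "fg_module R M1" "fg_module R M2"
    and pr: "projective R P" "projective R P1" "projective R P2" "projective R Q"
    and g: "lin R P M g" "g ` carrier P = carrier M"
    and g1: "lin R P1 M1 g1" "g1 ` carrier P1 = carrier M1"
    and g2: "lin R P2 M2 g2" "g2 ` carrier P2 = carrier M2"
    and ret: "retract_of_sum R M M1 M2 Q"
  shows "retract_of_sum R (ker_module P M g) (ker_module P1 M1 g1) (ker_module P2 M2 g2) P"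
proof -
  note M = fg[THEN fg_moduleD(1)]
  note Pf = pr[THEN projective_fg] note P = Pf[THEN fg_moduleD(1)]
  interpret M: abelian_group M by (rule right_moduleD(2)[OF M(1)])
  interpret P: abelian_group P by (rule right_moduleD(2)[OF P(1)])
  obtain i1 r1 i2 r2 u v where l: "lin R M M1 i1" "lin R M1 M r1" "lin R M M2 i2" "lin R M2 M r2"
    "lin R M Q u" "lin R Q M v"
    and sum: "\<And>x. x \<in> carrier M \<Longrightarrow> r1 (i1 x) \<oplus>\<^bsub>M\<^esub> r2 (i2 x) \<oplus>\<^bsub>M\<^esub> v (u x) = x"
    by (rule retract_of_sumE[OF ret]) (rule that)
  obtain j1 where j1: "lin R P P1 j1" "\<And>p. p \<in> carrier P \<Longrightarrow> g1 (j1 p) = i1 (g p)"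
    by (rule projective_lift[OF pr(1) Pf(2) fg(2) g1 lin_comp[OF g(1) l(1)]]) (rule that)
  obtain j2 where j2: "lin R P P2 j2" "\<And>p. p \<in> carrier P \<Longrightarrow> g2 (j2 p) = i2 (g p)"
    by (rule projective_lift[OF pr(1) Pf(3) fg(3) g2 lin_comp[OF g(1) l(3)]]) (rule that)
  obtain s1 where s1: "lin R P1 P s1" "\<And>p. p \<in> carrier P1 \<Longrightarrow> g (s1 p) = r1 (g1 p)"
    by (rule projective_lift[OF pr(2) Pf(1) fg(1) g lin_comp[OF g1(1) l(2)]]) (rule that)
  obtain s2 where s2: "lin R P2 P s2" "\<And>p. p \<in> carrier P2 \<Longrightarrow> g (s2 p) = r2 (g2 p)"
    by (rule projective_lift[OF pr(3) Pf(1) fg(1) g lin_comp[OF g2(1) l(4)]]) (rule that)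
  obtain w where w: "lin R Q P w" "\<And>q. q \<in> carrier Q \<Longrightarrow> g (w q) = v q"
    by (rule projective_lift[OF pr(4) Pf(1) fg(1) g l(6)]) (rule that)
  define c where "c p = p \<oplus>\<^bsub>P\<^esub> \<ominus>\<^bsub>P\<^esub> (s1 (j1 p) \<oplus>\<^bsub>P\<^esub> s2 (j2 p) \<oplus>\<^bsub>P\<^esub> w (u (g p)))" for p
  note z = lin_zero[OF P(1) M(1) g(1)] lin_zero[OF P(2) M(2) g1(1)] lin_zero[OF P(3) M(3) g2(1)]
    lin_zero[OF M(1,2) l(1)] lin_zero[OF M(2,1) l(2)] lin_zero[OF M(1,3) l(3)] lin_zero[OF M(3,1) l(4)]
    lin_zero[OF M(1) P(4) l(5)] lin_zero[OF P(4,1) w(1)]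
  have c: "lin R P P c"
    unfolding c_def
    by (intro lin_add_map[OF P(1,1)] lin_minus_map[OF P(1,1)] lin_id lin_comp[OF j1(1) s1(1)]
        lin_comp[OF j2(1) s2(1)] lin_comp[OF lin_comp[OF g(1) l(5)] w(1)])
  note cl = linD(1)[OF g(1)] linD(1)[OF j1(1)] linD(1)[OF j2(1)] linD(1)[OF s1(1)] linD(1)[OF s2(1)]
    linD(1)[OF w(1)] linD(1)[OF l(1)] linD(1)[OF l(2)] linD(1)[OF l(3)] linD(1)[OF l(4)]
    linD(1)[OF l(5)] linD(1)[OF l(6)]
  have gc: "g (c p) = \<zero>\<^bsub>M\<^esub>" if "p \<in> carrier P" for p
    using that cl sum[of "g p"]
    by (simp add: c_def linD(2)[OF g(1)] lin_minus[OF P(1) M(1) g(1)] s1(2) s2(2) j1(2) j2(2) w(2) M.r_neg)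
  have sub: "a_kernel P M g \<subseteq> carrier P" "a_kernel P1 M1 g1 \<subseteq> carrier P1" "a_kernel P2 M2 g2 \<subseteq> carrier P2"
    by (auto simp: a_kernel_def')
  have cs: "s1 (j1 x) \<oplus>\<^bsub>P\<^esub> s2 (j2 x) \<oplus>\<^bsub>P\<^esub> c x = x" if x: "x \<in> a_kernel P M g" for x
  proof -
    have "x \<in> carrier P" "g x = \<zero>\<^bsub>M\<^esub>" using x by (auto simp: a_kernel_def')
    moreover from this have "s1 (j1 x) \<in> carrier P" "s2 (j2 x) \<in> carrier P" using cl by auto
    ultimately show ?thesis
      by (simp add: c_def z P.minus_add P.a_ac P.r_neg1 P.r_neg2)
        (metis P.a_ac P.add.inv_closed P.a_closed P.minus_add P.r_neg P.r_zero)
  qed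
  let ?N = "ker_module P M g" and ?N1 = "ker_module P1 M1 g1" and ?N2 = "ker_module P2 M2 g2"
  have "lin R ?N ?N1 j1"
    by (intro lin_sub_cod lin_sub_dom j1(1) sub) (auto simp: a_kernel_def' j1(2) z cl)
  moreover have "lin R ?N1 ?N s1"
    by (intro lin_sub_cod lin_sub_dom s1(1) sub) (auto simp: a_kernel_def' s1(2) z cl)
  moreover have "lin R ?N ?N2 j2"
    by (intro lin_sub_cod lin_sub_dom j2(1) sub) (auto simp: a_kernel_def' j2(2) z cl)
  moreover have "lin R ?N2 ?N s2"
    by (intro lin_sub_cod lin_sub_dom s2(1) sub) (auto simp: a_kernel_def' s2(2) z cl)
  moreover have "lin R ?N P (\<lambda>x. x)"
    by (intro lin_sub_dom lin_id sub)
  moreover have "lin R P ?N c"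
    using linD(1)[OF c] gc by (intro lin_sub_cod c) (auto simp: a_kernel_def')
  ultimately show ?thesis
    by (rule retract_of_sumI) (simp add: cs)
qed

section \<open>Projective dimension\<close>

text \<open>
  Each step of the recursion takes off the projective module next to \<open>M\<close> and goes on with the kernel.
  By the Schanuel lemma the choice of that projective module does not matter (\<open>pd_le_kernel\<close>).
\<close>

primrec pd_le :: "('a, 'b) ring_scheme \<Rightarrow> nat \<Rightarrow> 'a umod \<Rightarrow> bool" where
  "pd_le R 0 M \<longleftrightarrow> projective R M"
| "pd_le R (Suc n) M \<longleftrightarrow> fg_module R M \<and>
     (\<exists>P g. projective R P \<and> lin R P M g \<and> g ` carrier P = carrier M \<and> pd_le R n (ker_module P M g))"

lemma pd_le_fg: "pd_le R n M \<Longrightarrow> fg_module R M"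
  by (cases n) (auto simp: projective_fg)

text \<open>
  One induction gives that projective dimension passes to direct summands, to direct sums and along
  isomorphisms.  The projective summand \<open>Q\<close> has to be carried along because the Schanuel lemma
  introduces one in each step.
\<close>

lemma pd_le_retract_of_sum:
  fixes Q :: "'a umod"
  assumes "pd_le R n M1" "pd_le R n M2" "projective R Q" "right_module R M" "retract_of_sum R M M1 M2 Q"
  shows "pd_le R n M"
  using assms
proof (induction n arbitrary: M M1 M2 Q)
  case 0
  then show ?case using projective_retract_of_sum[of R M M1 M2 Q] by simp
next
  case (Suc n)
  obtain P1 g1 where P1: "projective R P1" "lin R P1 M1 g1" "g1 ` carrier P1 = carrier M1"
    "pd_le R n (ker_module P1 M1 g1)" using Suc.prems(1) by auto
  obtain P2 g2 where P2: "projective R P2" "lin R P2 M2 g2" "g2 ` carrier P2 = carrier M2"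
    "pd_le R n (ker_module P2 M2 g2)" using Suc.prems(2) by auto
  have fg: "fg_module R M1" "fg_module R M2" using Suc.prems by auto
  have M: "fg_module R M"
    by (rule fg_module_retract_of_sum[OF Suc.prems(4) fg projective_fg[OF Suc.prems(3)] Suc.prems(5)])
  obtain k p where p: "lin R (power_module k (regular R)) M p"
    "p ` carrier (power_module k (regular R)) = carrier M"
    using fg_module_free_cover[OF M] .
  let ?P = "power_module k (regular R)"
  have P: "projective R ?P" by (rule projective_free[OF right_moduleD(1)[OF Suc.prems(4)]])
  have "retract_of_sum R (ker_module ?P M p) (ker_module P1 M1 g1) (ker_module P2 M2 g2) ?P"
    by (rule kernel_retract_of_sum[OF M fg P P1(1) P2(1) Suc.prems(3) p P1(2,3) P2(2,3) Suc.prems(5)])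
  moreover have "right_module R (ker_module ?P M p)"
    by (rule right_module_ker[OF fg_moduleD(1)[OF projective_fg[OF P]] Suc.prems(4) p(1)])
  ultimately have "pd_le R n (ker_module ?P M p)"
    using Suc.IH[OF P1(4) P2(4) P] by simp
  then show ?case unfolding pd_le.simps(2) using M P p by blast
qed

lemma pd_le_retract:
  assumes M1: "pd_le R n M1" and M: "right_module R M" and i: "lin R M M1 i" and r: "lin R M1 M r"
    and ri: "\<And>x. x \<in> carrier M \<Longrightarrow> r (i x) = x"
  shows "pd_le R n M"
proof -
  have Q: "projective R (power_module 0 (regular R))"
    by (rule projective_free[OF right_moduleD(1)[OF M]])
  show ?thesis
    by (rule pd_le_retract_of_sum[OF M1 M1 Q M retract_of_sum_single[where i = i and r = r, OF M _ _ i r ri]])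
      (use pd_le_fg[OF M1] projective_fg[OF Q] in \<open>auto simp: fg_module_def\<close>)
qed

lemma pd_le_kernel:
  fixes P :: "'a umod"
  assumes M: "pd_le R (Suc n) M" and P: "projective R P" and p: "lin R P M p" "p ` carrier P = carrier M"
  shows "pd_le R n (ker_module P M p)"
proof -
  have fg: "fg_module R M" using M by simp
  note Mr = fg_moduleD(1)[OF fg] and Pr = fg_moduleD(1)[OF projective_fg[OF P]]
  obtain P1 g1 where P1: "projective R P1" "lin R P1 M g1" "g1 ` carrier P1 = carrier M"
    "pd_le R n (ker_module P1 M g1)" using M by auto
  have "retract_of_sum R M M M P"
    by (rule retract_of_sum_single[OF Mr Mr Pr lin_id lin_id refl])
  then have "retract_of_sum R (ker_module P M p) (ker_module P1 M g1) (ker_module P1 M g1) P"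
    by (rule kernel_retract_of_sum[OF fg fg fg P P1(1,1) P p P1(2,3,2,3)])
  then show ?thesis
    using pd_le_retract_of_sum[OF P1(4,4) P right_module_ker[OF Pr Mr p(1)]] by simp
qed

lemma pd_le_Suc: "pd_le R n M \<Longrightarrow> pd_le R (Suc n) M"
proof (induction n arbitrary: M)
  case 0
  then have P: "projective R M" by simp
  note fg = projective_fg[OF P] note rm = fg_moduleD(1)[OF fg]
  interpret M: abelian_group M by (rule right_moduleD(2)[OF rm])
  have k: "right_module R (ker_module M M (\<lambda>x. x))" by (rule right_module_ker[OF rm rm lin_id])
  have i: "lin R (ker_module M M (\<lambda>x. x)) M (\<lambda>x. x)"
    by (rule lin_sub_dom[OF lin_id]) (auto simp: a_kernel_def')
  have r: "lin R M (ker_module M M (\<lambda>x. x)) (\<lambda>_. \<zero>\<^bsub>M\<^esub>)"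
    using lin_zero_map[OF rm k] by simp
  have "pd_le R 0 (ker_module M M (\<lambda>x. x))"
    by (rule pd_le_retract[OF "0" k i r]) (simp add: a_kernel_def')
  then show ?case
    using fg P by (auto intro!: exI[of _ M] exI[of _ "\<lambda>x. x"] lin_id)
next
  case (Suc n)
  then obtain P g where "projective R P" "lin R P M g" "g ` carrier P = carrier M"
    "pd_le R n (ker_module P M g)" by auto
  then show ?case
    using Suc.IH[of "ker_module P M g"] Suc.prems unfolding pd_le.simps(2)[of R "Suc n"] by auto
qed

lemma pd_le_mono: "pd_le R n M \<Longrightarrow> n \<le> m \<Longrightarrow> pd_le R m M"
  by (induction m) (auto simp: le_Suc_eq simp del: pd_le.simps intro: pd_le_Suc)

lemma pd_le_if_proj_resolution:
  "proj_resolution R M n C d \<Longrightarrow> fg_module R M \<Longrightarrow> pd_le R n M"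
proof (induction n arbitrary: M C d)
  case 0
  then have P: "projective R (C 1)" and d: "lin R (C 1) M (d 0)" "d 0 ` carrier (C 1) = carrier M"
    and inj: "inj_on (d 0) (carrier (C 1))"
    unfolding proj_resolution_def by (auto simp: homs_lin)
  note M = fg_moduleD(1)[OF 0(2)]
  let ?i = "inv_into (carrier (C 1)) (d 0)"
  have di: "d 0 (?i x) = x" and ic: "?i x \<in> carrier (C 1)" if "x \<in> carrier M" for x
    using that d(2) by (auto simp: f_inv_into_f inv_into_into)
  have i: "lin R M (C 1) ?i"
    by (rule lin_inverse[OF fg_moduleD(1)[OF projective_fg[OF P]] d(1) ic di inj])
  show ?case
    by (rule pd_le_retract[where i = ?i and r = "d 0", OF _ M i d(1) di]) (use P in simp)
next
  case (Suc n)
  \<comment> \<open>Without the projective module next to \<open>M\<close>, what remains is a resolution of the kernel.\<close>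
  let ?N = "ker_module (C 1) M (d 0)"
  define C' where "C' = (\<lambda>i. if i = 0 then ?N else C (Suc i))"
  define d' where "d' = (\<lambda>i. d (Suc i))"
  have C0: "C 0 = M" and P: "\<And>i. i \<le> Suc n \<Longrightarrow> projective R (C (Suc i))"
    and dh: "\<And>i. i \<le> Suc n \<Longrightarrow> d i \<in> homs R (C (Suc i)) (C i)"
    and s0: "d 0 ` carrier (C 1) = carrier M"
    and ex: "\<And>i. i < Suc n \<Longrightarrow> d (Suc i) ` carrier (C (Suc (Suc i))) = a_kernel (C (Suc i)) (C i) (d i)"
    and inj: "inj_on (d (Suc n)) (carrier (C (Suc (Suc n))))"
    using Suc.prems(1) unfolding proj_resolution_def by auto
  have l0: "lin R (C 1) M (d 0)" using dh[of 0] C0 by (simp add: homs_lin)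
  have e0: "d 1 ` carrier (C 2) = a_kernel (C 1) M (d 0)" using ex[of 0] C0 by (simp add: numeral_2_eq_2)
  have d1: "d 1 \<in> homs R (C 2) ?N"
    using dh[of 1] e0 by (auto simp: homs_def numeral_2_eq_2 PiE_iff)
  have C1: "right_module R (C 1)" using fg_moduleD(1)[OF projective_fg[OF P[of 0]]] by simp
  have N: "right_module R ?N"
    by (rule right_module_ker[OF C1 fg_moduleD(1)[OF Suc.prems(2)] l0])
  have "fg_module R ?N"
    using fg_module_image[OF projective_fg[OF P[of 1]] N homs_lin] d1 e0 by (simp add: numeral_2_eq_2)
  moreover have "proj_resolution R ?N n C' d'"
    unfolding proj_resolution_def
  proof (intro conjI allI impI)
    show "C' 0 = ?N" by (simp add: C'_def)
    show "projective R (C' (Suc i))" if "i \<le> n" for i using P[of "Suc i"] that by (simp add: C'_def)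
    show "d' i \<in> homs R (C' (Suc i)) (C' i)" if "i \<le> n" for i
      using d1 dh[of "Suc i"] that by (cases i) (simp_all add: C'_def d'_def numeral_2_eq_2)
    show "d' 0 ` carrier (C' 1) = carrier ?N" using e0 by (simp add: C'_def d'_def numeral_2_eq_2)
    show "d' (Suc i) ` carrier (C' (Suc (Suc i))) = a_kernel (C' (Suc i)) (C' i) (d' i)" if "i < n" for i
      using ex[of "Suc i"] that by (cases i) (simp_all add: C'_def d'_def a_kernel_def')
    show "inj_on (d' n) (carrier (C' (Suc n)))" using inj by (simp add: C'_def d'_def)
  qed
  ultimately have "pd_le R n ?N" using Suc.IH by blast
  then show ?case using Suc.prems(2) P[of 0] l0 s0 by auto
qed

lemma proj_resolution_if_pd_le:
  "pd_le R n M \<Longrightarrow> \<exists>C d. proj_resolution R M n C d"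
proof (induction n arbitrary: M)
  case 0
  then have P: "projective R M" by simp
  note rm = fg_moduleD(1)[OF projective_fg[OF P]]
  let ?id = "restrict (\<lambda>x. x) (carrier M)"
  have "?id \<in> homs R M M" by (rule restrict_in_homs[OF rm lin_id])
  then have "proj_resolution R M 0 (\<lambda>_. M) (\<lambda>_. ?id)"
    using P unfolding proj_resolution_def by (auto simp: inj_on_def)
  then show ?case by blast
next
  case (Suc n)
  then obtain P g where P: "projective R P" "lin R P M g" "g ` carrier P = carrier M"
    "pd_le R n (ker_module P M g)" by auto
  let ?N = "ker_module P M g"
  obtain C d where "proj_resolution R ?N n C d" using Suc.IH[OF P(4)] by auto
  then have C0: "C 0 = ?N" and Pr: "\<And>i. i \<le> n \<Longrightarrow> projective R (C (Suc i))"
    and dh: "\<And>i. i \<le> n \<Longrightarrow> d i \<in> homs R (C (Suc i)) (C i)"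
    and s0: "d 0 ` carrier (C 1) = carrier ?N"
    and ex: "\<And>i. i < n \<Longrightarrow> d (Suc i) ` carrier (C (Suc (Suc i))) = a_kernel (C (Suc i)) (C i) (d i)"
    and inj: "inj_on (d n) (carrier (C (Suc n)))"
    unfolding proj_resolution_def by auto
  let ?g = "restrict g (carrier P)"
  define C' where "C' = (\<lambda>i. case i of 0 \<Rightarrow> M | Suc 0 \<Rightarrow> P | Suc (Suc i) \<Rightarrow> C (Suc i))"
  define d' where "d' = (\<lambda>i. case i of 0 \<Rightarrow> ?g | Suc i \<Rightarrow> d i)"
  have g: "?g \<in> homs R P M" by (rule restrict_in_homs[OF fg_moduleD(1)[OF projective_fg[OF P(1)]] P(2)])
  have d0: "d 0 \<in> homs R (C 1) P"
    using dh[of 0] C0 by (auto simp: homs_def PiE_iff a_kernel_def')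
  have ker: "a_kernel P M ?g = a_kernel P M g" by (auto simp: a_kernel_def')
  have "proj_resolution R M (Suc n) C' d'"
    unfolding proj_resolution_def
  proof (intro conjI allI impI)
    show "C' 0 = M" by (simp add: C'_def)
    show "projective R (C' (Suc i))" if "i \<le> Suc n" for i
      using P(1) Pr that by (cases i) (simp_all add: C'_def)
    show "d' i \<in> homs R (C' (Suc i)) (C' i)" if "i \<le> Suc n" for i
      using g d0 dh[of "i - 1"] that by (auto simp: C'_def d'_def split: nat.splits)
    show "d' 0 ` carrier (C' 1) = carrier M" using P(3) by (simp add: C'_def d'_def)
    show "d' (Suc i) ` carrier (C' (Suc (Suc i))) = a_kernel (C' (Suc i)) (C' i) (d' i)" if "i < Suc n" for i
    proof (cases i)
      case 0
      then show ?thesis using s0 by (simp add: C'_def d'_def ker)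
    next
      case (Suc j)
      then show ?thesis using ex[of j] that C0 by (cases j) (simp_all add: C'_def d'_def a_kernel_def')
    qed
    show "inj_on (d' (Suc n)) (carrier (C' (Suc (Suc n))))" using inj by (simp add: C'_def d'_def)
  qed
  then show ?case by blast
qed

lemma findim_le:
  fixes R :: "('a, 'b) ring_scheme"
  assumes bound: "\<And>(M :: 'a umod) n. pd_le R n M \<Longrightarrow> pd_le R N M"
  shows "findim R \<le> enat N"
  unfolding findim_def
proof (rule SUP_least)
  fix M :: "'a umod"
  assume "M \<in> {M. fg_module R M \<and> pd R M < \<infinity>}"
  then have fg: "fg_module R M" and fin: "pd R M < \<infinity>" by auto
  have "\<exists>n C d. proj_resolution R M n C d"
  proof (rule ccontr)
    assume "\<nexists>n C d. proj_resolution R M n C d"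
    then have e: "{n. \<exists>C d. proj_resolution R M n C d} = {}" by simp
    have "pd R M = \<infinity>" unfolding pd_def e by (simp add: top_enat_def)
    then show False using fin by simp
  qed
  then obtain C d where "proj_resolution R M N C d"
    using proj_resolution_if_pd_le bound pd_le_if_proj_resolution[OF _ fg] by metis
  then show "pd R M \<le> enat N" unfolding pd_def by (intro INF_lower) auto
qed

section \<open>Dimension over the ground field\<close>

text \<open>Lists rather than sets, since the induction below peels off one generator at a time.\<close>

primrec list_span :: "('k, 'a) ring_scheme \<Rightarrow> ('k, 'm, 'c) module_scheme \<Rightarrow> 'm list \<Rightarrow> 'm set" where
  "list_span K V [] = {\<zero>\<^bsub>V\<^esub>}"
| "list_span K V (x # xs) = {c \<odot>\<^bsub>V\<^esub> x \<oplus>\<^bsub>V\<^esub> y | c y. c \<in> carrier K \<and> y \<in> list_span K V xs}"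

lemma submodule_list_span:
  assumes K: "field K" and V: "right_module K V" and "set xs \<subseteq> carrier V"
  shows "submodule (list_span K V xs) K V"
  using assms(3)
proof (induction xs)
  case Nil
  interpret V: right_module K V by fact
  show ?case by (rule rm_submoduleI[OF V]) (auto simp: rm_smult_zero[OF V])
next
  case (Cons x xs)
  interpret K: field K by fact
  interpret V: right_module K V by fact
  have x: "x \<in> carrier V" using Cons.prems by simp
  have sub: "submodule (list_span K V xs) K V" using Cons by simp
  note s = rm_submoduleD[OF V sub]
  have c: "y \<in> carrier V" if "y \<in> list_span K V xs" for y using that s(1) by auto
  show ?case
  proof (rule rm_submoduleI[OF V])
    show "list_span K V (x # xs) \<subseteq> carrier V" using x c by (auto simp: V.smult_closed)
    show "\<zero>\<^bsub>V\<^esub> \<in> list_span K V (x # xs)"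
      using s(2) x by (auto simp: rm_zero_smult[OF V] intro!: exI[of _ "\<zero>\<^bsub>K\<^esub>"] exI[of _ "\<zero>\<^bsub>V\<^esub>"])
  next
    fix u w assume "u \<in> list_span K V (x # xs)" "w \<in> list_span K V (x # xs)"
    then obtain a y b z where u: "u = a \<odot>\<^bsub>V\<^esub> x \<oplus>\<^bsub>V\<^esub> y" "a \<in> carrier K" "y \<in> list_span K V xs"
      and w: "w = b \<odot>\<^bsub>V\<^esub> x \<oplus>\<^bsub>V\<^esub> z" "b \<in> carrier K" "z \<in> list_span K V xs" by auto
    have "u \<oplus>\<^bsub>V\<^esub> w = (a \<oplus>\<^bsub>K\<^esub> b) \<odot>\<^bsub>V\<^esub> x \<oplus>\<^bsub>V\<^esub> (y \<oplus>\<^bsub>V\<^esub> z)"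
      using u w x c[OF u(3)] c[OF w(3)] by (simp add: V.smult_l_distr V.smult_closed V.M.a_ac)
    moreover have "y \<oplus>\<^bsub>V\<^esub> z \<in> list_span K V xs" using s(3) u w by blast
    ultimately show "u \<oplus>\<^bsub>V\<^esub> w \<in> list_span K V (x # xs)" using u(2) w(2) K.a_closed by force
  next
    fix a u assume a: "a \<in> carrier K" and "u \<in> list_span K V (x # xs)"
    then obtain b y where u: "u = b \<odot>\<^bsub>V\<^esub> x \<oplus>\<^bsub>V\<^esub> y" "b \<in> carrier K" "y \<in> list_span K V xs" by auto
    have "a \<odot>\<^bsub>V\<^esub> u = (b \<otimes>\<^bsub>K\<^esub> a) \<odot>\<^bsub>V\<^esub> x \<oplus>\<^bsub>V\<^esub> a \<odot>\<^bsub>V\<^esub> y"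
      using u a x c[OF u(3)] by (simp add: V.smult_r_distr V.smult_closed V.smult_assoc)
    moreover have "a \<odot>\<^bsub>V\<^esub> y \<in> list_span K V xs" using s(5) a u by blast
    ultimately show "a \<odot>\<^bsub>V\<^esub> u \<in> list_span K V (x # xs)" using u(2) a K.m_closed by force
  qed
qed

lemma set_subset_list_span:
  assumes K: "field K" and V: "right_module K V"
  shows "set xs \<subseteq> carrier V \<Longrightarrow> set xs \<subseteq> list_span K V xs"
proof (induction xs)
  case (Cons x xs)
  interpret K: field K by fact
  interpret V: right_module K V by fact
  have x: "x \<in> carrier V" "set xs \<subseteq> carrier V" using Cons.prems by auto
  note s = rm_submoduleD[OF V submodule_list_span[OF K V x(2)]]
  have "x = \<one>\<^bsub>K\<^esub> \<odot>\<^bsub>V\<^esub> x \<oplus>\<^bsub>V\<^esub> \<zero>\<^bsub>V\<^esub>" using x by (simp add: V.smult_one)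
  then have "x \<in> list_span K V (x # xs)" using s(2) by force
  moreover have "y \<in> list_span K V (x # xs)" if "y \<in> set xs" for y
  proof -
    have "y = \<zero>\<^bsub>K\<^esub> \<odot>\<^bsub>V\<^esub> x \<oplus>\<^bsub>V\<^esub> y" using x that by (auto simp: rm_zero_smult[OF V])
    moreover have "y \<in> list_span K V xs" using that Cons by auto
    ultimately show ?thesis by force
  qed
  ultimately show ?case by auto
qed simp

text \<open>
  The part of dimension theory that is needed: a proper subspace is spanned by fewer vectors.  Let
  \<open>L\<close> be the span of all generators but the first.  Either \<open>U\<close> lies in \<open>L\<close>, or \<open>U\<close> is spanned by
  one vector outside \<open>L\<close> together with \<open>U \<inter> L\<close>; if in the second case \<open>U\<close> contained \<open>L\<close>, it would
  be the whole space.
\<close>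

lemma subspace_list_span:
  assumes K: "field K" and V: "right_module K V"
    and "set xs \<subseteq> carrier V" "submodule U K V" "U \<subseteq> list_span K V xs"
  shows "\<exists>ys. set ys \<subseteq> U \<and> U = list_span K V ys \<and> length ys \<le> length xs \<and>
    (U \<noteq> list_span K V xs \<longrightarrow> length ys < length xs)"
  using assms(3-5)
proof (induction xs arbitrary: U)
  case Nil
  then have "U = {\<zero>\<^bsub>V\<^esub>}" using rm_submoduleD(2)[OF V Nil(2)] by auto
  then show ?case by (auto intro!: exI[of _ "[]"])
next
  case (Cons x xs)
  interpret K: field K by fact
  interpret V: right_module K V by fact
  let ?L = "list_span K V xs"
  have x: "x \<in> carrier V" "set xs \<subseteq> carrier V" using Cons.prems by auto
  note L = rm_submoduleD[OF V submodule_list_span[OF K V x(2)]]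
  note u = rm_submoduleD[OF V Cons.prems(2)]
  have Lc: "y \<in> carrier V" if "y \<in> ?L" for y using that L(1) by auto
  have Uc: "y \<in> carrier V" if "y \<in> U" for y using that u(1) by auto
  have sub: "submodule (U \<inter> ?L) K V"
    using u L by (intro rm_submoduleI[OF V]) auto
  obtain ys where ys: "set ys \<subseteq> U \<inter> ?L" "U \<inter> ?L = list_span K V ys" "length ys \<le> length xs"
    "U \<inter> ?L \<noteq> ?L \<Longrightarrow> length ys < length xs"
    using Cons.IH[OF x(2) sub] by blast
  show ?case
  proof (cases "U \<subseteq> ?L")
    case True
    then have "U \<inter> ?L = U" by auto
    then show ?thesis using ys by (intro exI[of _ ys]) auto
  next
    case False
    then obtain w where w: "w \<in> U" "w \<notin> ?L" by auto
    then obtain c y where cy: "w = c \<odot>\<^bsub>V\<^esub> x \<oplus>\<^bsub>V\<^esub> y" "c \<in> carrier K" "y \<in> ?L"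
      using Cons.prems(3) by auto
    have c0: "c \<noteq> \<zero>\<^bsub>K\<^esub>"
      using w(2) cy x Lc[OF cy(3)] by (auto simp: rm_zero_smult[OF V])
    let ?c' = "inv\<^bsub>K\<^esub> c"
    have c': "?c' \<in> carrier K" "c \<otimes>\<^bsub>K\<^esub> ?c' = \<one>\<^bsub>K\<^esub>"
      using c0 cy(2) K.field_Units by auto
    have cx: "c \<odot>\<^bsub>V\<^esub> x = w \<oplus>\<^bsub>V\<^esub> \<ominus>\<^bsub>V\<^esub> y"
      using cy x Lc[OF cy(3)] by (simp add: V.smult_closed V.M.a_assoc V.M.r_neg)
    have xw: "x = ?c' \<odot>\<^bsub>V\<^esub> (w \<oplus>\<^bsub>V\<^esub> \<ominus>\<^bsub>V\<^esub> y)"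
      using V.smult_assoc[OF cy(2) c'(1) x(1)] by (simp add: c' cx V.smult_one[OF x(1)])
    have Uw: "U = list_span K V (w # ys)"
    proof
      show "list_span K V (w # ys) \<subseteq> U"
      proof -
        have "list_span K V ys \<subseteq> U" using ys(2) by blast
        then show ?thesis using w(1) u(3,5) by auto
      qed
      show "U \<subseteq> list_span K V (w # ys)"
      proof
        fix z assume z: "z \<in> U"
        then obtain d y' where d: "z = d \<odot>\<^bsub>V\<^esub> x \<oplus>\<^bsub>V\<^esub> y'" "d \<in> carrier K" "y' \<in> ?L"
          using Cons.prems(3) by auto
        let ?e = "?c' \<otimes>\<^bsub>K\<^esub> d"
        have e: "?e \<in> carrier K" using d c' by simp
        have "d \<odot>\<^bsub>V\<^esub> x = ?e \<odot>\<^bsub>V\<^esub> (w \<oplus>\<^bsub>V\<^esub> \<ominus>\<^bsub>V\<^esub> y)"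
          using V.smult_assoc[OF c'(1) d(2)] Uc[OF w(1)] Lc[OF cy(3)] xw by simp
        also have "\<dots> = ?e \<odot>\<^bsub>V\<^esub> w \<oplus>\<^bsub>V\<^esub> ?e \<odot>\<^bsub>V\<^esub> (\<ominus>\<^bsub>V\<^esub> y)"
          using e Uc[OF w(1)] Lc[OF cy(3)] by (simp add: V.smult_r_distr)
        finally have zz: "z = ?e \<odot>\<^bsub>V\<^esub> w \<oplus>\<^bsub>V\<^esub> (?e \<odot>\<^bsub>V\<^esub> (\<ominus>\<^bsub>V\<^esub> y) \<oplus>\<^bsub>V\<^esub> y')"
          using d(1) e Uc[OF w(1)] Lc[OF cy(3)] Lc[OF d(3)] by (simp add: V.smult_closed V.M.a_assoc)
        let ?v = "?e \<odot>\<^bsub>V\<^esub> (\<ominus>\<^bsub>V\<^esub> y) \<oplus>\<^bsub>V\<^esub> y'"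
        have vL: "?v \<in> ?L" using L(3,4,5) e cy(3) d(3) by blast
        have ew: "?e \<odot>\<^bsub>V\<^esub> w \<in> U" using u(5) e w(1) by blast
        have "?v = \<ominus>\<^bsub>V\<^esub> (?e \<odot>\<^bsub>V\<^esub> w) \<oplus>\<^bsub>V\<^esub> z"
          using Uc[OF ew] Lc[OF vL] by (subst zz) (simp add: V.M.r_neg1)
        then have "?v \<in> U" using u(3,4) ew z by simp
        then have "?v \<in> list_span K V ys" using vL ys(2) by auto
        then show "z \<in> list_span K V (w # ys)" using zz e by auto
      qed
    qed
    have "length (w # ys) < length (x # xs)" if ne: "U \<noteq> list_span K V (x # xs)"
    proof -
      have "U \<inter> ?L \<noteq> ?L"
      proof
        assume "U \<inter> ?L = ?L"
        then have LU: "?L \<subseteq> U" by auto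
        then have "y \<in> U" using cy(3) by auto
        then have "w \<oplus>\<^bsub>V\<^esub> \<ominus>\<^bsub>V\<^esub> y \<in> U" using u(3,4) w(1) by simp
        then have "x \<in> U" using u(5)[OF c'(1)] xw by simp
        then have "list_span K V (x # xs) \<subseteq> U" using LU u(3,5) by auto
        then show False using ne Cons.prems(3) by auto
      qed
      then show ?thesis using ys(4) by simp
    qed
    then show ?thesis using Uw w(1) ys(1,3) by (intro exI[of _ "w # ys"]) auto
  qed
qed

definition underlying_space ::
  "('k, 'a, 'd) module_scheme \<Rightarrow> ('a, 'm, 'c) module_scheme \<Rightarrow> ('k, 'm) module" where
  "underlying_space A M = \<lparr>carrier = carrier M, monoid.mult = undefined, one = undefined,
     zero = zero M, add = add M, smult = (\<lambda>c x. (c \<odot>\<^bsub>A\<^esub> \<one>\<^bsub>A\<^esub>) \<odot>\<^bsub>M\<^esub> x)\<rparr>"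

lemma underlying_space_simps [simp]:
  "carrier (underlying_space A M) = carrier M"
  "\<zero>\<^bsub>underlying_space A M\<^esub> = \<zero>\<^bsub>M\<^esub>"
  "x \<oplus>\<^bsub>underlying_space A M\<^esub> y = x \<oplus>\<^bsub>M\<^esub> y"
  "c \<odot>\<^bsub>underlying_space A M\<^esub> x = (c \<odot>\<^bsub>A\<^esub> \<one>\<^bsub>A\<^esub>) \<odot>\<^bsub>M\<^esub> x"
  by (simp_all add: underlying_space_def)

lemma underlying_space_sub [simp]:
  "underlying_space A (M\<lparr>carrier := U\<rparr>) = (underlying_space A M)\<lparr>carrier := U\<rparr>"
  by (simp add: underlying_space_def)

context fd_algebra
begin

lemma right_module_K_A: "right_module K A"
  by (intro right_module.intro right_module_axioms.intro ring.axioms(1)[OF A.ring_axioms] ring_axioms)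
    (auto simp: K.smult_l_distr K.smult_r_distr K.smult_assoc1[symmetric] m_comm)

lemma smult_as_mult:
  assumes "c \<in> carrier K" "a \<in> carrier A"
  shows "a \<otimes>\<^bsub>A\<^esub> (c \<odot>\<^bsub>A\<^esub> \<one>\<^bsub>A\<^esub>) = c \<odot>\<^bsub>A\<^esub> a" "(c \<odot>\<^bsub>A\<^esub> \<one>\<^bsub>A\<^esub>) \<otimes>\<^bsub>A\<^esub> a = c \<odot>\<^bsub>A\<^esub> a"
  using assms by (simp_all add: smult_mult_left smult_mult_right)

lemma right_module_underlying_space:
  assumes "right_module A M"
  shows "right_module K (underlying_space A M)"
proof -
  interpret M: right_module A M by fact
  have "abelian_group (underlying_space A M)"
    by (rule abelian_groupI) (auto simp: M.M.a_ac intro: M.M.l_neg)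
  moreover have "((a \<otimes>\<^bsub>K\<^esub> b) \<odot>\<^bsub>A\<^esub> \<one>\<^bsub>A\<^esub>) \<odot>\<^bsub>M\<^esub> x = (b \<odot>\<^bsub>A\<^esub> \<one>\<^bsub>A\<^esub>) \<odot>\<^bsub>M\<^esub> ((a \<odot>\<^bsub>A\<^esub> \<one>\<^bsub>A\<^esub>) \<odot>\<^bsub>M\<^esub> x)"
    if "a \<in> carrier K" "b \<in> carrier K" "x \<in> carrier M" for a b x
    using that by (simp add: M.smult_assoc[symmetric] smult_as_mult K.smult_assoc1[symmetric] m_comm)
  ultimately show ?thesis
    using ring_axioms
    by (intro right_module.intro right_module_axioms.intro)
      (simp_all add: M.smult_closed M.smult_l_distr M.smult_r_distr M.smult_one K.smult_l_distr)
qed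

lemma submodule_underlying_space:
  assumes M: "right_module A M" and U: "submodule U A M"
  shows "submodule U K (underlying_space A M)"
  using rm_submoduleD[OF M U]
  by (intro rm_submoduleI[OF right_module_underlying_space[OF M]]) auto

text \<open>The products of generators of \<open>A\<close> over \<open>K\<close> with generators of \<open>M\<close> over \<open>A\<close> span \<open>M\<close>.\<close>

lemma fg_module_list_span:
  assumes fg: "fg_module A M"
  obtains xs where "set xs \<subseteq> carrier M" "list_span K (underlying_space A M) xs = carrier M"
proof -
  note rm = fg_moduleD(1)[OF fg]
  interpret M: right_module A M by (rule rm)
  let ?V = "underlying_space A M"
  note V = right_module_underlying_space[OF rm]
  obtain S where S: "finite S" "S \<subseteq> carrier A" "\<And>U. submodule U K A \<Longrightarrow> S \<subseteq> U \<Longrightarrow> U = carrier A"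
    using finite_dim finitely_generated_iff[OF right_module_K_A] by metis
  obtain G where G: "finite G" "G \<subseteq> carrier M" "\<And>U. submodule U A M \<Longrightarrow> G \<subseteq> U \<Longrightarrow> U = carrier M"
    using fg_moduleD(2)[OF fg] finitely_generated_iff[OF rm] by metis
  obtain xs where xs: "set xs = (\<lambda>(a, g). a \<odot>\<^bsub>M\<^esub> g) ` (S \<times> G)"
    using finite_list[of "(\<lambda>(a, g). a \<odot>\<^bsub>M\<^esub> g) ` (S \<times> G)"] S(1) G(1) by auto
  have xc: "set xs \<subseteq> carrier M" using S(2) G(2) by (auto simp: xs intro!: M.smult_closed)
  let ?L = "list_span K ?V xs"
  have sub: "submodule ?L K ?V"
    by (rule submodule_list_span[OF field_axioms V]) (use xc in simp)
  note L = rm_submoduleD[OF V sub, simplified]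
  have xL: "set xs \<subseteq> ?L" by (rule set_subset_list_span[OF field_axioms V]) (use xc in simp)
  have aL: "a \<odot>\<^bsub>M\<^esub> g \<in> ?L" if a: "a \<in> carrier A" and g: "g \<in> G" for a g
  proof -
    have gc: "g \<in> carrier M" using g G(2) by auto
    have "{a \<in> carrier A. a \<odot>\<^bsub>M\<^esub> g \<in> ?L} = carrier A"
    proof (rule S(3))
      show "S \<subseteq> {a \<in> carrier A. a \<odot>\<^bsub>M\<^esub> g \<in> ?L}" using S(2) xL g by (auto simp: xs)
      have "(c \<odot>\<^bsub>A\<^esub> a) \<odot>\<^bsub>M\<^esub> g = (c \<odot>\<^bsub>A\<^esub> \<one>\<^bsub>A\<^esub>) \<odot>\<^bsub>M\<^esub> (a \<odot>\<^bsub>M\<^esub> g)"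
        if "c \<in> carrier K" "a \<in> carrier A" for c a
        using that gc by (simp add: M.smult_assoc[symmetric] smult_as_mult)
      then show "submodule {a \<in> carrier A. a \<odot>\<^bsub>M\<^esub> g \<in> ?L} K A"
        using L gc
        by (intro rm_submoduleI[OF right_module_K_A]) (auto simp: rm_zero_smult[OF rm] M.smult_l_distr)
    qed
    then show ?thesis using a by auto
  qed
  have "{x \<in> carrier M. \<forall>a\<in>carrier A. a \<odot>\<^bsub>M\<^esub> x \<in> ?L} = carrier M"
  proof (rule G(3))
    show "G \<subseteq> {x \<in> carrier M. \<forall>a\<in>carrier A. a \<odot>\<^bsub>M\<^esub> x \<in> ?L}" using G(2) aL by auto
    show "submodule {x \<in> carrier M. \<forall>a\<in>carrier A. a \<odot>\<^bsub>M\<^esub> x \<in> ?L} A M"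
      using L by (intro rm_submoduleI[OF rm])
        (auto simp: rm_smult_zero[OF rm] M.smult_r_distr M.smult_closed M.smult_assoc[symmetric])
  qed
  then have "carrier M \<subseteq> ?L" using M.smult_one A.one_closed by (metis (no_types, lifting) mem_Collect_eq subsetI)
  then show ?thesis using that xc L(1) by blast
qed

end

section \<open>Direct decompositions\<close>

lemma complementary_projections:
  assumes M: "right_module R M" and c: "complementary R M U V"
  obtains p q where "lin R M (M\<lparr>carrier := U\<rparr>) p" "lin R M (M\<lparr>carrier := V\<rparr>) q"
    "\<And>x. x \<in> carrier M \<Longrightarrow> p x \<oplus>\<^bsub>M\<^esub> q x = x"
    "\<And>x. x \<in> U \<Longrightarrow> p x = x" "\<And>x. x \<in> V \<Longrightarrow> q x = x"
proof -
  interpret M: right_module R M by fact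
  have U: "submodule U R M" and V: "submodule V R M" and s: "U <+>\<^bsub>M\<^esub> V = carrier M"
    and i: "U \<inter> V = {\<zero>\<^bsub>M\<^esub>}" using c by (auto simp: complementary_def)
  note u = rm_submoduleD[OF M U] and v = rm_submoduleD[OF M V]
  have ex: "\<exists>p q. p \<in> U \<and> q \<in> V \<and> x = p \<oplus>\<^bsub>M\<^esub> q" if "x \<in> carrier M" for x
    using that unfolding s[symmetric] by (auto simp: set_add_defs set_mult_def)
  then obtain p q where pq: "\<And>x. x \<in> carrier M \<Longrightarrow> p x \<in> U" "\<And>x. x \<in> carrier M \<Longrightarrow> q x \<in> V"
    "\<And>x. x \<in> carrier M \<Longrightarrow> x = p x \<oplus>\<^bsub>M\<^esub> q x" by metis
  have uni: "a = a' \<and> b = b'" if "a \<in> U" "a' \<in> U" "b \<in> V" "b' \<in> V" "a \<oplus>\<^bsub>M\<^esub> b = a' \<oplus>\<^bsub>M\<^esub> b'" for a a' b b'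
  proof -
    have cl: "a \<in> carrier M" "a' \<in> carrier M" "b \<in> carrier M" "b' \<in> carrier M" using that u(1) v(1) by auto
    have "(a \<oplus>\<^bsub>M\<^esub> b) \<oplus>\<^bsub>M\<^esub> \<ominus>\<^bsub>M\<^esub> b = a"
      using cl by (simp add: M.M.a_assoc M.M.r_neg)
    then have "a \<oplus>\<^bsub>M\<^esub> \<ominus>\<^bsub>M\<^esub> a' = \<ominus>\<^bsub>M\<^esub> a' \<oplus>\<^bsub>M\<^esub> ((a \<oplus>\<^bsub>M\<^esub> b) \<oplus>\<^bsub>M\<^esub> \<ominus>\<^bsub>M\<^esub> b)"
      using cl by (simp only: M.M.a_comm M.M.a_inv_closed)
    also have "\<dots> = b' \<oplus>\<^bsub>M\<^esub> \<ominus>\<^bsub>M\<^esub> b"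
      unfolding that(5) using cl by (simp add: M.M.a_assoc M.M.r_neg1)
    finally have e: "a \<oplus>\<^bsub>M\<^esub> \<ominus>\<^bsub>M\<^esub> a' = b' \<oplus>\<^bsub>M\<^esub> \<ominus>\<^bsub>M\<^esub> b" .
    have "a \<oplus>\<^bsub>M\<^esub> \<ominus>\<^bsub>M\<^esub> a' \<in> U" using u(3,4) that(1,2) by simp
    moreover have "a \<oplus>\<^bsub>M\<^esub> \<ominus>\<^bsub>M\<^esub> a' \<in> V" unfolding e using v(3,4) that(3,4) by simp
    ultimately have "a \<oplus>\<^bsub>M\<^esub> \<ominus>\<^bsub>M\<^esub> a' = \<zero>\<^bsub>M\<^esub>" using i by auto
    then have "a = a'" using cl by (metis M.M.minus_equality M.M.minus_minus M.M.a_inv_closed)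
    then show ?thesis using that(5) cl M.M.add.l_cancel by metis
  qed
  have z: "\<zero>\<^bsub>M\<^esub> \<in> U" "\<zero>\<^bsub>M\<^esub> \<in> V" using u(2) v(2) .
  have l: "p (x \<oplus>\<^bsub>M\<^esub> y) = p x \<oplus>\<^bsub>M\<^esub> p y \<and> q (x \<oplus>\<^bsub>M\<^esub> y) = q x \<oplus>\<^bsub>M\<^esub> q y"
    if xy: "x \<in> carrier M" "y \<in> carrier M" for x y
  proof (rule uni)
    have cl: "p x \<in> carrier M" "p y \<in> carrier M" "q x \<in> carrier M" "q y \<in> carrier M"
      using pq(1,2) xy u(1) v(1) by auto
    have "p (x \<oplus>\<^bsub>M\<^esub> y) \<oplus>\<^bsub>M\<^esub> q (x \<oplus>\<^bsub>M\<^esub> y) = (p x \<oplus>\<^bsub>M\<^esub> q x) \<oplus>\<^bsub>M\<^esub> (p y \<oplus>\<^bsub>M\<^esub> q y)"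
      using pq(3)[OF xy(1)] pq(3)[OF xy(2)] pq(3)[of "x \<oplus>\<^bsub>M\<^esub> y"] xy by simp
    also have "\<dots> = p x \<oplus>\<^bsub>M\<^esub> p y \<oplus>\<^bsub>M\<^esub> (q x \<oplus>\<^bsub>M\<^esub> q y)"
      using cl by (simp add: M.M.a_ac)
    finally show "p (x \<oplus>\<^bsub>M\<^esub> y) \<oplus>\<^bsub>M\<^esub> q (x \<oplus>\<^bsub>M\<^esub> y) = p x \<oplus>\<^bsub>M\<^esub> p y \<oplus>\<^bsub>M\<^esub> (q x \<oplus>\<^bsub>M\<^esub> q y)" .
  qed (use pq xy u(3) v(3) in auto)
  have sm: "p (a \<odot>\<^bsub>M\<^esub> x) = a \<odot>\<^bsub>M\<^esub> p x \<and> q (a \<odot>\<^bsub>M\<^esub> x) = a \<odot>\<^bsub>M\<^esub> q x"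
    if xa: "a \<in> carrier R" "x \<in> carrier M" for a x
  proof (rule uni)
    have cl: "p x \<in> carrier M" "q x \<in> carrier M"
      using pq(1,2) xa u(1) v(1) by auto
    have "p (a \<odot>\<^bsub>M\<^esub> x) \<oplus>\<^bsub>M\<^esub> q (a \<odot>\<^bsub>M\<^esub> x) = a \<odot>\<^bsub>M\<^esub> (p x \<oplus>\<^bsub>M\<^esub> q x)"
      using pq(3)[OF xa(2)] pq(3)[of "a \<odot>\<^bsub>M\<^esub> x"] xa by (simp add: M.smult_closed)
    then show "p (a \<odot>\<^bsub>M\<^esub> x) \<oplus>\<^bsub>M\<^esub> q (a \<odot>\<^bsub>M\<^esub> x) = a \<odot>\<^bsub>M\<^esub> p x \<oplus>\<^bsub>M\<^esub> a \<odot>\<^bsub>M\<^esub> q x"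
      using xa cl by (simp add: M.smult_r_distr)
  qed (use pq xa u(5) v(5) M.smult_closed in auto)
  have "lin R M (M\<lparr>carrier := U\<rparr>) p" "lin R M (M\<lparr>carrier := V\<rparr>) q"
    by (rule linI; use pq l sm in simp)+
  moreover have "p x = x" if "x \<in> U" for x
    using that uni[of "p x" x "q x" "\<zero>\<^bsub>M\<^esub>"] pq[of x] u(1) z by auto
  moreover have "q x = x" if "x \<in> V" for x
    using that uni[of "p x" "\<zero>\<^bsub>M\<^esub>" "q x" x] pq[of x] v(1) z by auto
  ultimately show ?thesis using that pq(3) by metis
qed

section \<open>The contravariant functor into a fixed module\<close>

text \<open>
  \<open>Hom\<^sub>A(C,T)\<close> as a left module over \<open>End T\<close>, that is, as a right module over its opposite, which
  acts by composition.
\<close>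

definition hom_module ::
  "('a, 'b) ring_scheme \<Rightarrow> ('a, 'n, 'c) module_scheme \<Rightarrow> ('a, 'm, 'd) module_scheme \<Rightarrow>
    ('m \<Rightarrow> 'm, 'n \<Rightarrow> 'm) module"
where
  "hom_module A C T = \<lparr>carrier = homs A C T, monoid.mult = undefined, one = undefined,
     zero = (\<lambda>x\<in>carrier C. \<zero>\<^bsub>T\<^esub>), add = (\<lambda>\<phi> \<psi>. \<lambda>x\<in>carrier C. \<phi> x \<oplus>\<^bsub>T\<^esub> \<psi> x),
     smult = (\<lambda>b \<phi>. compose (carrier C) b \<phi>)\<rparr>"

abbreviation End_op ::
  "('k, 'a, 'd) module_scheme \<Rightarrow> ('a, 'm, 'c) module_scheme \<Rightarrow> ('k, 'm \<Rightarrow> 'm) module" where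
  "End_op A T \<equiv> opposite (End_algebra A T)"

lemma homs_iff: "f \<in> homs R M N \<longleftrightarrow> lin R M N f \<and> f \<in> extensional (carrier M)"
  by (auto simp: homs_def lin_def PiE_def)

lemma homs_eqI:
  assumes "f \<in> homs R M N" "g \<in> homs R M N" "\<And>x. x \<in> carrier M \<Longrightarrow> f x = g x"
  shows "f = g"
  using assms by (intro extensionalityI[of f "carrier M" g]) (auto simp: homs_iff)

lemma hom_module_simps:
  "carrier (hom_module A C T) = homs A C T"
  "\<zero>\<^bsub>hom_module A C T\<^esub> = (\<lambda>x\<in>carrier C. \<zero>\<^bsub>T\<^esub>)"
  "\<phi> \<oplus>\<^bsub>hom_module A C T\<^esub> \<psi> = (\<lambda>x\<in>carrier C. \<phi> x \<oplus>\<^bsub>T\<^esub> \<psi> x)"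
  "b \<odot>\<^bsub>hom_module A C T\<^esub> \<phi> = (\<lambda>x\<in>carrier C. b (\<phi> x))"
  by (simp_all add: hom_module_def compose_def)

lemma End_op_simps:
  "carrier (End_op A T) = homs A T T"
  "\<zero>\<^bsub>End_op A T\<^esub> = (\<lambda>x\<in>carrier T. \<zero>\<^bsub>T\<^esub>)"
  "\<one>\<^bsub>End_op A T\<^esub> = (\<lambda>x\<in>carrier T. x)"
  "f \<oplus>\<^bsub>End_op A T\<^esub> g = (\<lambda>x\<in>carrier T. f x \<oplus>\<^bsub>T\<^esub> g x)"
  "f \<otimes>\<^bsub>End_op A T\<^esub> g = (\<lambda>x\<in>carrier T. g (f x))"
  by (simp_all add: opposite_def End_algebra_def compose_def)

lemma abelian_group_hom_module:
  assumes C: "right_module A C" and T: "right_module A T"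
  shows "abelian_group (hom_module A C T)"
proof -
  interpret T: right_module A T by fact
  have cl: "f x \<in> carrier T" if "f \<in> homs A C T" "x \<in> carrier C" for f x
    using linD(1)[OF homs_lin[OF that(1)] that(2)] .
  have add: "(\<lambda>x\<in>carrier C. f x \<oplus>\<^bsub>T\<^esub> g x) \<in> homs A C T" if "f \<in> homs A C T" "g \<in> homs A C T" for f g
    using restrict_in_homs[OF C lin_add_map[OF C T that[THEN homs_lin]]] .
  have zero: "(\<lambda>x\<in>carrier C. \<zero>\<^bsub>T\<^esub>) \<in> homs A C T"
    using restrict_in_homs[OF C lin_zero_map[OF C T]] .
  show ?thesis
  proof (rule abelian_groupI, unfold hom_module_simps)
    fix f assume f: "f \<in> homs A C T"
    show "(\<lambda>x\<in>carrier C. (\<lambda>x\<in>carrier C. \<zero>\<^bsub>T\<^esub>) x \<oplus>\<^bsub>T\<^esub> f x) = f"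
      by (rule homs_eqI[OF add[OF zero f] f]) (simp add: cl[OF f])
    show "\<exists>g\<in>homs A C T. (\<lambda>x\<in>carrier C. g x \<oplus>\<^bsub>T\<^esub> f x) = (\<lambda>x\<in>carrier C. \<zero>\<^bsub>T\<^esub>)"
      using restrict_in_homs[OF C lin_minus_map[OF C T homs_lin[OF f]]]
      by (rule rev_bexI) (auto intro!: restrict_ext simp: T.M.l_neg cl[OF f])
  next
    fix f g assume fg: "f \<in> homs A C T" "g \<in> homs A C T"
    show "(\<lambda>x\<in>carrier C. f x \<oplus>\<^bsub>T\<^esub> g x) \<in> homs A C T" by (rule add[OF fg])
    show "(\<lambda>x\<in>carrier C. f x \<oplus>\<^bsub>T\<^esub> g x) = (\<lambda>x\<in>carrier C. g x \<oplus>\<^bsub>T\<^esub> f x)"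
      by (rule restrict_ext) (simp add: T.M.a_comm cl fg)
    fix h assume h: "h \<in> homs A C T"
    show "(\<lambda>x\<in>carrier C. (\<lambda>x\<in>carrier C. f x \<oplus>\<^bsub>T\<^esub> g x) x \<oplus>\<^bsub>T\<^esub> h x) =
      (\<lambda>x\<in>carrier C. f x \<oplus>\<^bsub>T\<^esub> (\<lambda>x\<in>carrier C. g x \<oplus>\<^bsub>T\<^esub> h x) x)"
      by (rule restrict_ext) (simp add: T.M.a_assoc cl fg h)
  qed (rule zero)
qed

lemma comp_in_homs:
  assumes "right_module A C" "f \<in> homs A C D" "g \<in> homs A D E"
  shows "(\<lambda>x\<in>carrier C. g (f x)) \<in> homs A C E"
  using restrict_in_homs[OF assms(1) lin_comp[OF assms(2,3)[THEN homs_lin]]] .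

lemma ring_End_op:
  assumes T: "right_module A T"
  shows "ring (End_op A T)"
proof -
  note g = abelian_group_hom_module[OF T T]
  note gE = abelian_groupE[OF g, unfolded hom_module_simps]
  have cl: "f x \<in> carrier T" if "f \<in> homs A T T" "x \<in> carrier T" for f x
    using linD(1)[OF homs_lin[OF that(1)] that(2)] .
  have one: "(\<lambda>x\<in>carrier T. x) \<in> homs A T T"
    by (rule restrict_in_homs[OF T lin_id])
  show ?thesis
  proof (rule ringI)
    show "abelian_group (End_op A T)"
      by (rule abelian_groupI, unfold End_op_simps) (rule gE; assumption)+
    show "monoid (End_op A T)"
    proof (rule monoidI, unfold End_op_simps)
      fix f assume f: "f \<in> homs A T T"
      show "(\<lambda>x\<in>carrier T. f ((\<lambda>x\<in>carrier T. x) x)) = f"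
        "(\<lambda>x\<in>carrier T. (\<lambda>x\<in>carrier T. x) (f x)) = f"
        using homs_eqI[OF comp_in_homs[OF T one f] f] homs_eqI[OF comp_in_homs[OF T f one] f]
        by (simp_all add: cl[OF f])
    next
      fix f g h assume fgh: "f \<in> homs A T T" "g \<in> homs A T T" "h \<in> homs A T T"
      show "(\<lambda>x\<in>carrier T. h ((\<lambda>x\<in>carrier T. g (f x)) x)) =
        (\<lambda>x\<in>carrier T. (\<lambda>x\<in>carrier T. h (g x)) (f x))"
        by (rule restrict_ext) (simp add: cl fgh)
    qed (use one comp_in_homs[OF T] in auto)
  next
    fix f g h assume "f \<in> carrier (End_op A T)" "g \<in> carrier (End_op A T)" "h \<in> carrier (End_op A T)"
    then have fgh: "f \<in> homs A T T" "g \<in> homs A T T" "h \<in> homs A T T" by (simp_all add: End_op_simps)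
    show "(f \<oplus>\<^bsub>End_op A T\<^esub> g) \<otimes>\<^bsub>End_op A T\<^esub> h =
      f \<otimes>\<^bsub>End_op A T\<^esub> h \<oplus>\<^bsub>End_op A T\<^esub> g \<otimes>\<^bsub>End_op A T\<^esub> h"
      unfolding End_op_simps
      by (rule restrict_ext) (simp add: linD(2)[OF homs_lin[OF fgh(3)]] cl fgh)
    show "h \<otimes>\<^bsub>End_op A T\<^esub> (f \<oplus>\<^bsub>End_op A T\<^esub> g) =
      h \<otimes>\<^bsub>End_op A T\<^esub> f \<oplus>\<^bsub>End_op A T\<^esub> h \<otimes>\<^bsub>End_op A T\<^esub> g"
      unfolding End_op_simps
      by (rule restrict_ext) (simp add: cl fgh)
  qed
qed

lemma right_module_hom_module:
  assumes C: "right_module A C" and T: "right_module A T"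
  shows "right_module (End_op A T) (hom_module A C T)"
proof -
  have cl: "f x \<in> carrier T" if "f \<in> homs A C T" "x \<in> carrier C" for f x
    using linD(1)[OF homs_lin[OF that(1)] that(2)] .
  show ?thesis
  proof (intro right_module.intro right_module_axioms.intro ring_End_op[OF T]
      abelian_group_hom_module[OF C T], unfold hom_module_simps End_op_simps)
    fix b \<phi> assume b: "b \<in> homs A T T" and \<phi>: "\<phi> \<in> homs A C T"
    show "(\<lambda>x\<in>carrier C. b (\<phi> x)) \<in> homs A C T" by (rule comp_in_homs[OF C \<phi> b])
    { fix \<psi> assume \<psi>: "\<psi> \<in> homs A C T"
      show "(\<lambda>x\<in>carrier C. b ((\<lambda>x\<in>carrier C. \<phi> x \<oplus>\<^bsub>T\<^esub> \<psi> x) x)) =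
        (\<lambda>x\<in>carrier C. (\<lambda>x\<in>carrier C. b (\<phi> x)) x \<oplus>\<^bsub>T\<^esub> (\<lambda>x\<in>carrier C. b (\<psi> x)) x)"
        by (rule restrict_ext) (simp add: cl \<phi> \<psi> linD(2)[OF homs_lin[OF b]]) }
    fix d assume d: "d \<in> homs A T T"
    show "(\<lambda>x\<in>carrier C. (\<lambda>x\<in>carrier T. b x \<oplus>\<^bsub>T\<^esub> d x) (\<phi> x)) =
      (\<lambda>x\<in>carrier C. (\<lambda>x\<in>carrier C. b (\<phi> x)) x \<oplus>\<^bsub>T\<^esub> (\<lambda>x\<in>carrier C. d (\<phi> x)) x)"
      by (rule restrict_ext) (simp add: cl \<phi>)
    show "(\<lambda>x\<in>carrier C. (\<lambda>x\<in>carrier T. d (b x)) (\<phi> x)) =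
      (\<lambda>x\<in>carrier C. d ((\<lambda>x\<in>carrier C. b (\<phi> x)) x))"
      by (rule restrict_ext) (simp add: cl \<phi>)
  next
    fix \<phi> assume \<phi>: "\<phi> \<in> homs A C T"
    have "(\<lambda>x\<in>carrier T. x) \<in> homs A T T" by (rule restrict_in_homs[OF T lin_id])
    from homs_eqI[OF comp_in_homs[OF C \<phi> this] \<phi>]
    show "(\<lambda>x\<in>carrier C. (\<lambda>x\<in>carrier T. x) (\<phi> x)) = \<phi>" by (simp add: cl[OF \<phi>])
  qed
qed

lemma lin_precomp:
  assumes D: "right_module A D" and \<alpha>: "lin A D C \<alpha>"
  shows "lin (End_op A T) (hom_module A C T) (hom_module A D T) (\<lambda>\<phi>. \<lambda>x\<in>carrier D. \<phi> (\<alpha> x))"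
  using linD(1)[OF \<alpha>] restrict_in_homs[OF D lin_comp[OF \<alpha> homs_lin]]
  by (intro linI) (auto simp: hom_module_simps intro!: restrict_ext)

section \<open>Kernels between free modules over the endomorphism ring\<close>

text \<open>\<open>T\<close> as a left module over its endomorphism ring.\<close>

definition eval_module :: "('a, 'm, 'c) module_scheme \<Rightarrow> ('m \<Rightarrow> 'm, 'm) module" where
  "eval_module T = \<lparr>carrier = carrier T, monoid.mult = undefined, one = undefined,
     zero = zero T, add = add T, smult = (\<lambda>f t. f t)\<rparr>"

lemma eval_module_simps [simp]:
  "carrier (eval_module T) = carrier T"
  "\<zero>\<^bsub>eval_module T\<^esub> = \<zero>\<^bsub>T\<^esub>"
  "x \<oplus>\<^bsub>eval_module T\<^esub> y = x \<oplus>\<^bsub>T\<^esub> y"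
  "f \<odot>\<^bsub>eval_module T\<^esub> x = f x"
  by (simp_all add: eval_module_def)

lemma right_module_eval:
  assumes T: "right_module A T"
  shows "right_module (End_op A T) (eval_module T)"
proof -
  interpret T: right_module A T by fact
  have cl: "f x \<in> carrier T" if "f \<in> homs A T T" "x \<in> carrier T" for f x
    using linD(1)[OF homs_lin[OF that(1)] that(2)] .
  have "abelian_group (eval_module T)"
    by (rule abelian_groupI) (auto simp: T.M.a_ac intro: T.M.l_neg)
  then show ?thesis
    by (intro right_module.intro right_module_axioms.intro ring_End_op[OF T])
      (simp_all add: End_op_simps cl linD(2)[OF homs_lin])
qed

lemma finsum_eval_module:
  fixes A :: "('k, 'a, 'd) module_scheme"
  assumes T: "right_module A T" and "finite S" "f \<in> S \<rightarrow> carrier T"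
  shows "finsum (eval_module T) f S = finsum T f S"
  using assms(2,3)
proof (induction S)
  interpret T: abelian_group T by (rule right_moduleD(2)[OF T])
  interpret E: abelian_group "eval_module T" by (rule right_moduleD(2)[OF right_module_eval[OF T]])
  { case empty
    show ?case by simp
  next
    case (insert s S)
    then have "f \<in> S \<rightarrow> carrier T" "f s \<in> carrier T" by auto
    then show ?case
      using insert T.finsum_insert[of S s f] E.finsum_insert[of S s f] by simp }
qed

text \<open>
  A linear map \<open>q\<close> between free modules over the opposite of \<open>End T\<close> is a matrix of endomorphisms
  of \<open>T\<close>, hence also a map \<open>T\<^sup>n \<rightarrow> T\<^sup>m\<close>.  The elements of the kernel of \<open>q\<close> are the linear maps
  \<open>T\<^sup>m \<rightarrow> T\<close> that vanish on the image of \<open>T\<^sup>n\<close>.  Let \<open>W\<close> be the set of common zeros of all these maps.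
  It contains the image, so a map vanishes on \<open>W\<close> if and only if it belongs to the kernel, and
  \<open>C = T\<^sup>m / W\<close> does what is asked.
\<close>

lemma kernel_is_hom_module:
  fixes A :: "('k, 'a, 'd) module_scheme" and T :: "('a, 'm, 'c) module_scheme"
  defines "R \<equiv> End_op A T"
  assumes T: "fg_module A T"
    and q: "lin R (power_module m (regular R)) (power_module n (regular R)) q"
  shows "\<exists>(C :: 'a umod) f g. fg_module A C \<and>
    lin R (ker_module (power_module m (regular R)) (power_module n (regular R)) q) (hom_module A C T) f \<and>
    lin R (hom_module A C T) (ker_module (power_module m (regular R)) (power_module n (regular R)) q) g \<and>
    (\<forall>a\<in>a_kernel (power_module m (regular R)) (power_module n (regular R)) q. g (f a) = a) \<and>
    (\<forall>\<phi>\<in>homs A C T. f (g \<phi>) = \<phi>)"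
proof -
  note Tr = fg_moduleD(1)[OF T]
  interpret T: right_module A T by (rule Tr)
  have R: "ring R" unfolding R_def by (rule ring_End_op[OF Tr])
  note reg = right_module_regular[OF R]
  let ?F = "power_module m (regular R)" and ?G = "power_module n (regular R)"
  note F = right_module_power[OF reg, of m] and G = right_module_power[OF reg, of n]
  let ?E = "eval_module T"
  have E: "right_module R ?E" unfolding R_def by (rule right_module_eval[OF Tr])
  have cR: "carrier R = homs A T T" by (simp add: R_def End_op_simps)
  have creg: "carrier (regular R) = homs A T T" by (simp add: regular_def cR)
  have smult_reg: "a \<odot>\<^bsub>regular R\<^esub> x = (\<lambda>t\<in>carrier T. a (x t))" for a x
    by (simp add: regular_def R_def End_op_simps)
  have zero_reg: "\<zero>\<^bsub>regular R\<^esub> = (\<lambda>t\<in>carrier T. \<zero>\<^bsub>T\<^esub>)"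
    by (simp add: regular_def R_def End_op_simps)
  have one: "\<one>\<^bsub>R\<^esub> \<in> homs A T T" using ring.ring_simprules(6)[OF R] cR by simp
  have one_app: "\<one>\<^bsub>R\<^esub> t = t" if "t \<in> carrier T" for t
    using that by (simp add: R_def End_op_simps)
  have cl: "x t \<in> carrier T" if "x \<in> homs A T T" "t \<in> carrier T" for x t
    using linD(1)[OF homs_lin[OF that(1)] that(2)] .
  have ev: "lin R (regular R) ?E (\<lambda>a. a t)" if t: "t \<in> carrier T" for t
    by (rule linI) (use t in \<open>auto simp: creg cR cl smult_reg, simp add: regular_def R_def End_op_simps\<close>)
  \<comment> \<open>The pairing of a family of endomorphisms with a family of elements, linear in each argument.\<close>
  define pairing where "pairing a t = (\<Oplus>\<^bsub>T\<^esub>i\<in>{..<m}. a i (t i))" for a :: "nat \<Rightarrow> 'm \<Rightarrow> 'm" and t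
  have Fmem: "a i \<in> homs A T T" if "a \<in> carrier ?F" "i < m" for a i
    using that creg by auto
  have Gmem: "a i \<in> homs A T T" if "a \<in> carrier ?G" "i < n" for a i
    using that creg by auto
  have pairing_R: "pairing a t = copair m ?E (\<lambda>i a. a (t i)) a"
    if "a \<in> carrier ?F" "\<And>i. i < m \<Longrightarrow> t i \<in> carrier T" for a t
    unfolding pairing_def copair_def
    by (rule finsum_eval_module[OF Tr, symmetric]) (use that Fmem cl in auto)
  have pairing_lin: "lin A (power_module m T) T (pairing a)" if a: "a \<in> carrier ?F" for a
    using lin_copair[OF Tr Tr, of m a] homs_lin[OF Fmem[OF a]] by (simp add: pairing_def[abs_def] copair_def[abs_def])
  have pairing_inj_at: "pairing a (inj_at m T i t) = a i t" if "a \<in> carrier ?F" "i < m" "t \<in> carrier T" for a i t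
    using copair_inj_at[OF Tr Tr homs_lin[OF Fmem[OF that(1)]] that(2,3)]
    by (simp add: pairing_def copair_def)
  \<comment> \<open>The entries \<open>col i j\<close> of the matrix are read off from the images of the unit vectors.\<close>
  define col where "col i = q (inj_at m (regular R) i \<one>\<^bsub>R\<^esub>)" for i
  have unit: "inj_at m (regular R) i \<one>\<^bsub>R\<^esub> \<in> carrier ?F" for i
    by (rule linD(1)[OF lin_inj_at[OF reg]]) (simp add: creg one)
  have col: "col i \<in> carrier ?G" for i
    unfolding col_def by (rule linD(1)[OF q unit])
  have q_entry: "q a j t = pairing a (\<lambda>i\<in>{..<m}. col i j t)"
    if a: "a \<in> carrier ?F" and j: "j < n" and t: "t \<in> carrier T" for a j t
  proof -
    have ct: "col i j t \<in> carrier T" for i by (rule cl[OF Gmem[OF col j] t])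
    let ?h = "copair m ?E (\<lambda>i a. a (col i j t))"
    have "q a j t = ?h a"
    proof (rule lin_power_eq[OF reg E _ _ _ a])
      show "lin R ?F ?E (\<lambda>a. q a j t)"
        by (rule lin_comp[OF lin_comp[OF q lin_component[OF reg j]] ev[OF t]])
      show "lin R ?F ?E ?h" by (rule lin_copair[OF reg E ev[OF ct]])
      fix i b assume i: "i < m" and b: "b \<in> carrier (regular R)"
      have bR: "b \<in> carrier R" and bh: "b \<in> homs A T T" using b by (simp_all add: creg cR)
      have b1: "b \<odot>\<^bsub>regular R\<^esub> \<one>\<^bsub>R\<^esub> = b"
        using ring.ring_simprules(12)[OF R] bR by (simp add: regular_def ring.is_monoid[OF R] monoid.l_one)
      have "q (inj_at m (regular R) i b) = b \<odot>\<^bsub>?G\<^esub> col i"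
        using linD(3)[OF lin_inj_at[OF reg, of m i] bR, of "\<one>\<^bsub>R\<^esub>"] linD(3)[OF q bR unit[of i]]
        by (simp only: creg one b1 col_def)
      then have "q (inj_at m (regular R) i b) j t = b (col i j t)"
        using j t by (simp add: smult_reg)
      then show "q (inj_at m (regular R) i b) j t = ?h (inj_at m (regular R) i b)"
        using copair_inj_at[OF reg E ev[OF ct] i b] by simp
    qed
    also have "\<dots> = pairing a (\<lambda>i\<in>{..<m}. col i j t)"
      unfolding copair_def pairing_def
      by (subst finsum_eval_module[OF Tr])
        (use a ct Fmem cl in \<open>auto intro!: T.M.finsum_cong' simp: cl\<close>)
    finally show ?thesis .
  qed
  let ?N = "a_kernel ?F ?G q"
  have Nc: "a \<in> carrier ?F" if "a \<in> ?N" for a using that by (simp add: a_kernel_def')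
  define W where "W = {t \<in> carrier (power_module m T). \<forall>a\<in>?N. pairing a t = \<zero>\<^bsub>T\<^esub>}"
  note P = right_module_power[OF Tr, of m]
  interpret P: right_module A "power_module m T" by (rule P)
  have "submodule W A (power_module m T)"
  proof (rule rm_submoduleI[OF P])
    show "W \<subseteq> carrier (power_module m T)" by (auto simp: W_def)
    show "\<zero>\<^bsub>power_module m T\<^esub> \<in> W"
      unfolding W_def using lin_zero[OF P Tr pairing_lin[OF Nc]] P.M.zero_closed by blast
    show "x \<oplus>\<^bsub>power_module m T\<^esub> y \<in> W" if "x \<in> W" "y \<in> W" for x y
    proof -
      have "x \<in> carrier (power_module m T)" "y \<in> carrier (power_module m T)"
        using that by (simp_all only: W_def mem_Collect_eq)
      then show ?thesis
        using that P.M.a_closed linD(2)[OF pairing_lin[OF Nc]]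
        by (simp only: W_def mem_Collect_eq) (simp del: power_module_simps)
    qed
    show "a \<odot>\<^bsub>power_module m T\<^esub> x \<in> W" if "a \<in> carrier A" "x \<in> W" for a x
    proof -
      have "x \<in> carrier (power_module m T)"
        using that by (simp only: W_def mem_Collect_eq)
      then show ?thesis
        using that P.smult_closed linD(3)[OF pairing_lin[OF Nc]]
        by (simp only: W_def mem_Collect_eq) (simp del: power_module_simps add: rm_smult_zero[OF Tr])
    qed
  qed
  then obtain C :: "'a umod" and p where C: "fg_module A C" and p: "lin A (power_module m T) C p"
    "p ` carrier (power_module m T) = carrier C"
    and pW: "\<And>x. x \<in> carrier (power_module m T) \<Longrightarrow> p x = \<zero>\<^bsub>C\<^esub> \<longleftrightarrow> x \<in> W"
    using fg_module_quotient_umod[OF fg_module_power[OF Tr fg_moduleD(2)[OF T]]] by metis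
  note Cr = fg_moduleD(1)[OF C]
  interpret C: right_module A C by (rule Cr)
  define s where "s = inv_into (carrier (power_module m T)) p"
  have s: "s c \<in> carrier (power_module m T)" "p (s c) = c" if "c \<in> carrier C" for c
    using that p(2) by (auto simp only: s_def inv_into_into f_inv_into_f)
  have pairing_s: "pairing a (s (p t)) = pairing a t" if a: "a \<in> ?N" and t: "t \<in> carrier (power_module m T)" for a t
  proof -
    have pt: "p t \<in> carrier C" by (rule linD(1)[OF p(1) t])
    let ?d = "s (p t) \<oplus>\<^bsub>power_module m T\<^esub> \<ominus>\<^bsub>power_module m T\<^esub> t"
    have d: "?d \<in> carrier (power_module m T)" using s(1)[OF pt] t P.M.a_closed P.M.a_inv_closed by blast
    have "p ?d = p (s (p t)) \<oplus>\<^bsub>C\<^esub> \<ominus>\<^bsub>C\<^esub> p t"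
      by (simp only: linD(2)[OF p(1) s(1)[OF pt] P.M.a_inv_closed[OF t]] lin_minus[OF P Cr p(1) t])
    then have "p ?d = \<zero>\<^bsub>C\<^esub>" using pt by (simp only: s(2)[OF pt] C.M.r_neg)
    then have "pairing a ?d = \<zero>\<^bsub>T\<^esub>" using pW[OF d] a by (simp only: W_def mem_Collect_eq)
    then have "pairing a (s (p t)) \<oplus>\<^bsub>T\<^esub> \<ominus>\<^bsub>T\<^esub> pairing a t = \<zero>\<^bsub>T\<^esub>"
      by (simp only: linD(2)[OF pairing_lin[OF Nc[OF a]] s(1)[OF pt] P.M.a_inv_closed[OF t]]
        lin_minus[OF P Tr pairing_lin[OF Nc[OF a]] t])
    then show ?thesis
      using linD(1)[OF pairing_lin[OF Nc[OF a]]] s(1)[OF pt] t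
      by (metis T.M.minus_equality T.M.minus_minus T.M.a_inv_closed)
  qed
  define f where "f a = (\<lambda>c\<in>carrier C. pairing a (s c))" for a
  define g where "g \<phi> = (\<lambda>i\<in>{..<m}. \<lambda>t\<in>carrier T. \<phi> (p (inj_at m T i t)))" for \<phi> :: "(nat \<Rightarrow> 'a) \<Rightarrow> 'm"
  have fp: "f a (p t) = pairing a t" if "a \<in> ?N" "t \<in> carrier (power_module m T)" for a t
    using pairing_s[OF that] linD(1)[OF p(1) that(2)] by (simp add: f_def)
  have f_hom: "f a \<in> homs A C T" if a: "a \<in> ?N" for a
  proof -
    note l = linD[OF pairing_lin[OF Nc[OF a]]]
    have "lin A C T (\<lambda>c. pairing a (s c))"
    proof (rule linI)
      fix x assume x: "x \<in> carrier C"
      show "pairing a (s x) \<in> carrier T" by (rule l(1)[OF s(1)[OF x]])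
      { fix y assume y: "y \<in> carrier C"
        have xy: "s x \<oplus>\<^bsub>power_module m T\<^esub> s y \<in> carrier (power_module m T)"
          by (rule P.M.a_closed[OF s(1)[OF x] s(1)[OF y]])
        show "pairing a (s (x \<oplus>\<^bsub>C\<^esub> y)) = pairing a (s x) \<oplus>\<^bsub>T\<^esub> pairing a (s y)"
          using pairing_s[OF a xy]
          by (simp only: linD(2)[OF p(1) s(1)[OF x] s(1)[OF y]] s(2)[OF x] s(2)[OF y] l(2)[OF s(1)[OF x] s(1)[OF y]]) }
      fix b assume b: "b \<in> carrier A"
      have bx: "b \<odot>\<^bsub>power_module m T\<^esub> s x \<in> carrier (power_module m T)"
        by (rule P.smult_closed[OF b s(1)[OF x]])
      show "pairing a (s (b \<odot>\<^bsub>C\<^esub> x)) = b \<odot>\<^bsub>T\<^esub> pairing a (s x)"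
        using pairing_s[OF a bx] by (simp only: linD(3)[OF p(1) b s(1)[OF x]] s(2)[OF x] l(3)[OF b s(1)[OF x]])
    qed
    then show ?thesis unfolding f_def by (rule restrict_in_homs[OF Cr])
  qed
  have g_F: "g \<phi> \<in> carrier ?F" if "\<phi> \<in> homs A C T" for \<phi>
    unfolding g_def power_module_simps creg
    using restrict_in_homs[OF Tr lin_comp[OF lin_comp[OF lin_inj_at[OF Tr] p(1)] homs_lin[OF that]]]
    by (simp add: restrict_PiE_iff)
  have pairing_g: "pairing (g \<phi>) t = \<phi> (p t)" if \<phi>: "\<phi> \<in> homs A C T" and t: "t \<in> carrier (power_module m T)" for \<phi> t
  proof (rule lin_power_eq[OF Tr Tr pairing_lin[OF g_F[OF \<phi>]] lin_comp[OF p(1) homs_lin[OF \<phi>]] _ t])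
    fix i x assume "i < m" "x \<in> carrier T"
    then show "pairing (g \<phi>) (inj_at m T i x) = \<phi> (p (inj_at m T i x))"
      using pairing_inj_at[OF g_F[OF \<phi>]] by (simp add: g_def)
  qed
  have g_N: "g \<phi> \<in> ?N" if \<phi>: "\<phi> \<in> homs A C T" for \<phi>
  proof -
    have qg: "q (g \<phi>) \<in> carrier ?G" by (rule linD(1)[OF q g_F[OF \<phi>]])
    have "q (g \<phi>) j t = \<zero>\<^bsub>T\<^esub>" if j: "j < n" and t: "t \<in> carrier T" for j t
    proof -
      let ?w = "\<lambda>i\<in>{..<m}. col i j t"
      have w: "?w \<in> carrier (power_module m T)"
        using cl[OF Gmem[OF col j] t] by (simp add: restrict_PiE_iff)
      have "pairing a ?w = \<zero>\<^bsub>T\<^esub>" if a: "a \<in> ?N" for a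
      proof -
        have "q a = \<zero>\<^bsub>?G\<^esub>" using a by (simp only: a_kernel_def' mem_Collect_eq)
        then have "q a j t = \<zero>\<^bsub>T\<^esub>" using j t by (simp add: zero_reg)
        then show ?thesis using q_entry[OF Nc[OF a] j t] by simp
      qed
      then have "?w \<in> W" using w by (simp only: W_def mem_Collect_eq) blast
      then have "p ?w = \<zero>\<^bsub>C\<^esub>" using pW[OF w] by simp
      then show ?thesis
        using q_entry[OF g_F[OF \<phi>] j t] pairing_g[OF \<phi> w] lin_zero[OF Cr Tr homs_lin[OF \<phi>]] by simp
    qed
    then have "q (g \<phi>) j = \<zero>\<^bsub>regular R\<^esub>" if "j < n" for j
      using that Gmem[OF qg that]
      by (intro extensionalityI[of _ "carrier T"]) (auto simp: zero_reg homs_iff)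
    then have "q (g \<phi>) = \<zero>\<^bsub>?G\<^esub>"
      using qg by (intro extensionalityI[of _ "{..<n}"]) (auto simp: PiE_def)
    then show ?thesis using g_F[OF \<phi>] by (simp only: a_kernel_def' mem_Collect_eq)
  qed
  have gf: "g (f a) = a" if a: "a \<in> ?N" for a
  proof (rule extensionalityI[of _ "{..<m}"])
    show "g (f a) \<in> extensional {..<m}" by (simp add: g_def)
    show "a \<in> extensional {..<m}" using Nc[OF a] by (simp add: PiE_def)
    fix i assume "i \<in> {..<m}"
    then have i: "i < m" by simp
    show "g (f a) i = a i"
    proof (rule homs_eqI[OF Fmem[OF g_F[OF f_hom[OF a]] i] Fmem[OF Nc[OF a] i]])
      fix t assume t: "t \<in> carrier T"
      have "inj_at m T i t \<in> carrier (power_module m T)" by (rule linD(1)[OF lin_inj_at[OF Tr] t])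
      then show "g (f a) i t = a i t"
        using fp[OF a] pairing_inj_at[OF Nc[OF a] i t] i t by (simp add: g_def)
    qed
  qed
  have fg: "f (g \<phi>) = \<phi>" if \<phi>: "\<phi> \<in> homs A C T" for \<phi>
  proof (rule homs_eqI[OF f_hom[OF g_N[OF \<phi>]] \<phi>])
    fix c assume c: "c \<in> carrier C"
    show "f (g \<phi>) c = \<phi> c" using pairing_g[OF \<phi> s(1)[OF c]] s(2)[OF c] c by (simp add: f_def)
  qed
  have lin_f: "lin R (ker_module ?F ?G q) (hom_module A C T) f"
  proof (rule linI)
    fix a assume "a \<in> carrier (ker_module ?F ?G q)"
    then have a: "a \<in> ?N" by simp
    show "f a \<in> carrier (hom_module A C T)" using f_hom[OF a] by (simp add: hom_module_simps)
    have sc: "s c i \<in> carrier T" if "c \<in> carrier C" "i < m" for c i using s(1)[OF that(1)] that(2) by auto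
    have lin_c: "lin R ?F ?E (copair m ?E (\<lambda>i a. a (s c i)))" if "c \<in> carrier C" for c
      by (rule lin_copair[OF reg E ev[OF sc[OF that]]])
    have pc: "pairing a (s c) = copair m ?E (\<lambda>i a. a (s c i)) a" if "c \<in> carrier C" "a \<in> carrier ?F" for c a
      by (rule pairing_R[OF that(2) sc[OF that(1)]])
    { fix b assume "b \<in> carrier (ker_module ?F ?G q)"
      then have b: "b \<in> ?N" by simp
      have ab: "a \<oplus>\<^bsub>?F\<^esub> b \<in> carrier ?F"
        by (rule abelian_groupE(1)[OF right_moduleD(2)[OF F] Nc[OF a] Nc[OF b]])
      have "pairing (a \<oplus>\<^bsub>?F\<^esub> b) (s c) = pairing a (s c) \<oplus>\<^bsub>T\<^esub> pairing b (s c)" if c: "c \<in> carrier C" for c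
        using linD(2)[OF lin_c[OF c] Nc[OF a] Nc[OF b]]
        by (simp only: pc[OF c ab] pc[OF c Nc[OF a]] pc[OF c Nc[OF b]] eval_module_simps)
      then have "f (a \<oplus>\<^bsub>?F\<^esub> b) = f a \<oplus>\<^bsub>hom_module A C T\<^esub> f b"
        unfolding f_def hom_module_simps by (intro restrict_ext) simp
      then show "f (a \<oplus>\<^bsub>ker_module ?F ?G q\<^esub> b) = f a \<oplus>\<^bsub>hom_module A C T\<^esub> f b" by simp }
    fix r assume r: "r \<in> carrier R"
    have ra: "r \<odot>\<^bsub>?F\<^esub> a \<in> carrier ?F"
      by (rule right_module.smult_closed[OF F r Nc[OF a]])
    have "pairing (r \<odot>\<^bsub>?F\<^esub> a) (s c) = r (pairing a (s c))" if c: "c \<in> carrier C" for c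
      using linD(3)[OF lin_c[OF c] r Nc[OF a]]
      by (simp only: pc[OF c ra] pc[OF c Nc[OF a]] eval_module_simps)
    then have "f (r \<odot>\<^bsub>?F\<^esub> a) = r \<odot>\<^bsub>hom_module A C T\<^esub> f a"
      unfolding f_def hom_module_simps by (intro restrict_ext) simp
    then show "f (r \<odot>\<^bsub>ker_module ?F ?G q\<^esub> a) = r \<odot>\<^bsub>hom_module A C T\<^esub> f a" by simp
  qed
  have lin_g: "lin R (hom_module A C T) (ker_module ?F ?G q) g"
    by (rule lin_inverse[OF right_module_ker[OF F G q] lin_f])
      (auto simp: hom_module_simps g_N fg gf intro!: inj_on_inverseI[of _ g])
  show ?thesis
    by (rule exI[of _ C], rule exI[of _ f], rule exI[of _ g]) (intro conjI ballI C lin_f lin_g gf fg)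
qed

section \<open>Bounding the projective dimension of the modules of maps\<close>

text \<open>
  The elements of \<open>Hom\<^sub>A(C,T)\<close> are not of the type on which \<open>pd_le\<close> is defined.  Asking for a direct
  summand of a module of bounded projective dimension instead of a copy makes the notion pass to
  direct summands of \<open>C\<close> at once.
\<close>

definition hom_pd_le ::
  "('k, 'a, 'd) module_scheme \<Rightarrow> ('a, 'm, 'c) module_scheme \<Rightarrow> nat \<Rightarrow> 'a umod \<Rightarrow> bool" where
  "hom_pd_le A T n C \<longleftrightarrow> (\<exists>H i r. pd_le (End_op A T) n H \<and>
     lin (End_op A T) (hom_module A C T) H i \<and> lin (End_op A T) H (hom_module A C T) r \<and>
     (\<forall>\<phi>\<in>homs A C T. r (i \<phi>) = \<phi>))"

lemma hom_pd_leI: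
  assumes "pd_le (End_op A T) n H"
    "lin (End_op A T) (hom_module A C T) H i" "lin (End_op A T) H (hom_module A C T) r"
    "\<And>\<phi>. \<phi> \<in> homs A C T \<Longrightarrow> r (i \<phi>) = \<phi>"
  shows "hom_pd_le A T n C"
  using assms unfolding hom_pd_le_def by blast

lemma hom_pd_le_mono: "hom_pd_le A T n C \<Longrightarrow> n \<le> m \<Longrightarrow> hom_pd_le A T m C"
  unfolding hom_pd_le_def using pd_le_mono by blast

text \<open>The functor is contravariant, so \<open>\<beta>\<close> induces the inclusion and \<open>\<alpha>\<close> the projection.\<close>

lemma hom_pd_le_retract:
  assumes D: "hom_pd_le A T n D" and Cr: "right_module A C" and Dr: "right_module A D"
    and \<alpha>: "lin A C D \<alpha>" and \<beta>: "lin A D C \<beta>" and \<beta>\<alpha>: "\<And>x. x \<in> carrier C \<Longrightarrow> \<beta> (\<alpha> x) = x"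
  shows "hom_pd_le A T n C"
proof -
  obtain H i r where H: "pd_le (End_op A T) n H"
    "lin (End_op A T) (hom_module A D T) H i" "lin (End_op A T) H (hom_module A D T) r"
    "\<And>\<phi>. \<phi> \<in> homs A D T \<Longrightarrow> r (i \<phi>) = \<phi>"
    using D unfolding hom_pd_le_def by blast
  note b = lin_precomp[OF Dr \<beta>, of T] and a = lin_precomp[OF Cr \<alpha>, of T]
  show ?thesis
  proof (rule hom_pd_leI[OF H(1) lin_comp[OF b H(2)] lin_comp[OF H(3) a]])
    fix \<phi> assume \<phi>: "\<phi> \<in> homs A C T"
    have "(\<lambda>x\<in>carrier D. \<phi> (\<beta> x)) \<in> homs A D T"
      using linD(1)[OF b] \<phi> by (simp add: hom_module_simps)
    moreover have "(\<lambda>x\<in>carrier C. (\<lambda>x\<in>carrier D. \<phi> (\<beta> x)) (\<alpha> x)) = \<phi>"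
      using \<phi> linD(1)[OF \<alpha>] \<beta>\<alpha> by (intro extensionalityI[of _ "carrier C"]) (auto simp: homs_iff)
    ultimately show "(\<lambda>x\<in>carrier C. r (i (\<lambda>x\<in>carrier D. \<phi> (\<beta> x))) (\<alpha> x)) = \<phi>"
      by (simp only: H(4))
  qed
qed

lemma hom_pd_le_zero:
  assumes Cr: "right_module A C" and T: "right_module A T" and C: "carrier C = {\<zero>\<^bsub>C\<^esub>}"
  shows "hom_pd_le A T n C"
proof -
  let ?R = "End_op A T"
  let ?H = "power_module 0 (regular ?R)"
  have R: "ring ?R" by (rule ring_End_op[OF T])
  have H: "pd_le ?R n ?H" by (rule pd_le_mono[of _ 0]) (simp_all add: projective_free[OF R])
  note Hr = fg_moduleD(1)[OF pd_le_fg[OF H]] and Fr = right_module_hom_module[OF Cr T]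
  show ?thesis
  proof (rule hom_pd_leI[OF H lin_zero_map[OF Fr Hr] lin_zero_map[OF Hr Fr]])
    fix \<phi> assume \<phi>: "\<phi> \<in> homs A C T"
    then show "\<zero>\<^bsub>hom_module A C T\<^esub> = \<phi>"
      using C lin_zero[OF Cr T homs_lin[OF \<phi>]]
      by (intro extensionalityI[of _ "carrier C"]) (auto simp: hom_module_simps homs_iff)
  qed
qed

lemma hom_pd_le_complementary:
  fixes C :: "'a umod" and T :: "('a, 'm, 'c) module_scheme"
  assumes Cr: "right_module A C" and T: "right_module A T" and c: "complementary A C U V"
    and U: "hom_pd_le A T n (C\<lparr>carrier := U\<rparr>)" and V: "hom_pd_le A T n (C\<lparr>carrier := V\<rparr>)"
  shows "hom_pd_le A T n C"
proof -
  let ?R = "End_op A T"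
  let ?U = "C\<lparr>carrier := U\<rparr>" and ?V = "C\<lparr>carrier := V\<rparr>"
  obtain p q where pq: "lin A C ?U p" "lin A C ?V q" "\<And>x. x \<in> carrier C \<Longrightarrow> p x \<oplus>\<^bsub>C\<^esub> q x = x"
    by (rule complementary_projections[OF Cr c]) (rule that)
  have sub: "submodule U A C" "submodule V A C" using c by (auto simp: complementary_def)
  note Ur = right_module_submodule[OF Cr sub(1)] and Vr = right_module_submodule[OF Cr sub(2)]
  have UVc: "U \<subseteq> carrier C" "V \<subseteq> carrier C" using rm_submoduleD(1)[OF Cr] sub by auto
  have incl: "lin A ?U C (\<lambda>x. x)" "lin A ?V C (\<lambda>x. x)"
    by (rule lin_sub_dom[OF lin_id UVc(1)], rule lin_sub_dom[OF lin_id UVc(2)])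
  obtain HU iU rU where HU: "pd_le ?R n HU" "lin ?R (hom_module A ?U T) HU iU" "lin ?R HU (hom_module A ?U T) rU"
    "\<And>\<phi>. \<phi> \<in> homs A ?U T \<Longrightarrow> rU (iU \<phi>) = \<phi>"
    using U unfolding hom_pd_le_def by blast
  obtain HV iV rV where HV: "pd_le ?R n HV" "lin ?R (hom_module A ?V T) HV iV" "lin ?R HV (hom_module A ?V T) rV"
    "\<And>\<phi>. \<phi> \<in> homs A ?V T \<Longrightarrow> rV (iV \<phi>) = \<phi>"
    using V unfolding hom_pd_le_def by blast
  let ?F = "hom_module A C T"
  let ?Q = "power_module 0 (regular ?R)"
  note F = right_module_hom_module[OF Cr T]
  interpret F: right_module ?R ?F by (rule F)
  have Q: "projective ?R ?Q" by (rule projective_free[OF ring_End_op[OF T]])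
  note Qr = fg_moduleD(1)[OF projective_fg[OF Q]]
  note resU = lin_precomp[OF Ur incl(1), of T] and resV = lin_precomp[OF Vr incl(2), of T]
  note extU = lin_precomp[OF Cr pq(1), of T] and extV = lin_precomp[OF Cr pq(2), of T]
  note i1 = lin_comp[OF resU HU(2)] and r1 = lin_comp[OF HU(3) extU]
  note i2 = lin_comp[OF resV HV(2)] and r2 = lin_comp[OF HV(3) extV]
  have sum: "(\<lambda>x\<in>carrier C. rU (iU (\<lambda>x\<in>U. \<phi> x)) (p x)) \<oplus>\<^bsub>?F\<^esub>
      (\<lambda>x\<in>carrier C. rV (iV (\<lambda>x\<in>V. \<phi> x)) (q x)) = \<phi>" if \<phi>: "\<phi> \<in> homs A C T" for \<phi>
  proof -
    have "(\<lambda>x\<in>U. \<phi> x) \<in> homs A ?U T" "(\<lambda>x\<in>V. \<phi> x) \<in> homs A ?V T"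
      using linD(1)[OF resU, of \<phi>] linD(1)[OF resV, of \<phi>] \<phi> by (simp_all add: hom_module_simps)
    then have "rU (iU (\<lambda>x\<in>U. \<phi> x)) = (\<lambda>x\<in>U. \<phi> x)" "rV (iV (\<lambda>x\<in>V. \<phi> x)) = (\<lambda>x\<in>V. \<phi> x)"
      by (simp_all only: HU(4) HV(4))
    moreover have "\<phi> (p x) \<oplus>\<^bsub>T\<^esub> \<phi> (q x) = \<phi> x" "p x \<in> U" "q x \<in> V" if x: "x \<in> carrier C" for x
    proof -
      show pU: "p x \<in> U" and qV: "q x \<in> V" using linD(1)[OF pq(1) x] linD(1)[OF pq(2) x] by simp_all
      then have "p x \<in> carrier C" "q x \<in> carrier C" using UVc by auto
      then show "\<phi> (p x) \<oplus>\<^bsub>T\<^esub> \<phi> (q x) = \<phi> x"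
        using linD(2)[OF homs_lin[OF \<phi>], of "p x" "q x"] pq(3)[OF x] by simp
    qed
    ultimately show ?thesis
      using \<phi> unfolding hom_module_simps
      by (intro extensionalityI[of _ "carrier C"]) (auto simp: homs_iff)
  qed
  have F_ret: "retract_of_sum ?R ?F HU HV ?Q"
  proof (rule retract_of_sumI[OF i1 r1 i2 r2 lin_zero_map[OF F Qr] lin_zero_map[OF Qr F]])
    fix \<phi> assume \<phi>: "\<phi> \<in> carrier ?F"
    have carr: "carrier ?U = U" "carrier ?V = V" by simp_all
    have "(\<lambda>x\<in>carrier C. rU (iU (\<lambda>x\<in>U. \<phi> x)) (p x)) \<oplus>\<^bsub>?F\<^esub>
      (\<lambda>x\<in>carrier C. rV (iV (\<lambda>x\<in>V. \<phi> x)) (q x)) = \<phi>"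
      using sum \<phi> by (simp only: hom_module_simps)
    then show "(\<lambda>x\<in>carrier C. rU (iU (\<lambda>x\<in>carrier ?U. \<phi> x)) (p x)) \<oplus>\<^bsub>?F\<^esub>
      (\<lambda>x\<in>carrier C. rV (iV (\<lambda>x\<in>carrier ?V. \<phi> x)) (q x)) \<oplus>\<^bsub>?F\<^esub> \<zero>\<^bsub>?F\<^esub> = \<phi>"
      using F.M.r_zero[OF \<phi>] by (simp only: carr)
  qed
  have fgF: "fg_module ?R ?F"
    by (rule fg_module_retract_of_sum[OF F pd_le_fg[OF HU(1)] pd_le_fg[OF HV(1)] projective_fg[OF Q] F_ret])
  obtain H :: "('m \<Rightarrow> 'm) umod" and i r where H: "fg_module ?R H" "lin ?R ?F H i" "lin ?R H ?F r"
    "\<And>x. x \<in> carrier ?F \<Longrightarrow> r (i x) = x" "\<And>y. y \<in> carrier H \<Longrightarrow> i (r y) = y"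
    using fg_module_umod_copy[OF fgF] by metis
  have "retract_of_sum ?R H HU HV ?Q"
  proof -
    obtain i1 r1 i2 r2 i3 r3 where l: "lin ?R ?F HU i1" "lin ?R HU ?F r1" "lin ?R ?F HV i2" "lin ?R HV ?F r2"
      "lin ?R ?F ?Q i3" "lin ?R ?Q ?F r3"
      "\<And>x. x \<in> carrier ?F \<Longrightarrow> r1 (i1 x) \<oplus>\<^bsub>?F\<^esub> r2 (i2 x) \<oplus>\<^bsub>?F\<^esub> r3 (i3 x) = x"
      using F_ret unfolding retract_of_sum_def by metis
    show ?thesis
    proof (rule retract_of_sumI[OF lin_comp[OF H(3) l(1)] lin_comp[OF l(2) H(2)] lin_comp[OF H(3) l(3)]
          lin_comp[OF l(4) H(2)] lin_comp[OF H(3) l(5)] lin_comp[OF l(6) H(2)]])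
      fix y assume y: "y \<in> carrier H"
      note ry = linD(1)[OF H(3) y]
      note c = linD(1)[OF l(2) linD(1)[OF l(1) ry]] linD(1)[OF l(4) linD(1)[OF l(3) ry]]
        linD(1)[OF l(6) linD(1)[OF l(5) ry]]
      have "i (r1 (i1 (r y)) \<oplus>\<^bsub>?F\<^esub> r2 (i2 (r y)) \<oplus>\<^bsub>?F\<^esub> r3 (i3 (r y))) =
        i (r1 (i1 (r y))) \<oplus>\<^bsub>H\<^esub> i (r2 (i2 (r y))) \<oplus>\<^bsub>H\<^esub> i (r3 (i3 (r y)))"
        by (simp only: linD(2)[OF H(2) F.M.a_closed[OF c(1,2)] c(3)] linD(2)[OF H(2) c(1,2)])
      then show "i (r1 (i1 (r y))) \<oplus>\<^bsub>H\<^esub> i (r2 (i2 (r y))) \<oplus>\<^bsub>H\<^esub> i (r3 (i3 (r y))) = y"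
        by (simp only: l(7)[OF ry] H(5)[OF y])
    qed
  qed
  then have "pd_le ?R n H"
    by (rule pd_le_retract_of_sum[OF HU(1) HV(1) Q fg_moduleD(1)[OF H(1)]])
  then show ?thesis
    by (rule hom_pd_leI[OF _ H(2,3)]) (use H(4) in \<open>simp add: hom_module_simps\<close>)
qed

text \<open>
  Splitting a module into indecomposable summands strictly lowers the number of vectors that
  span it over the field, so a bound for the indecomposable modules is a bound for all of them.
\<close>

lemma (in fd_algebra) hom_pd_le_if_indecomposable:
  fixes T :: "('a, 'm, 'e) module_scheme"
  assumes T: "right_module A T"
    and indec: "\<And>M n. fg_module A M \<Longrightarrow> indecomposable A M \<Longrightarrow> hom_pd_le A T n M \<Longrightarrow> hom_pd_le A T N M"
    and C: "fg_module A C" and n: "hom_pd_le A T n C"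
  shows "hom_pd_le A T N C"
proof -
  obtain xs where "set xs \<subseteq> carrier C" "list_span K (underlying_space A C) xs = carrier C"
    using fg_module_list_span[OF C] by blast
  then show ?thesis
    using C n
  proof (induction "length xs" arbitrary: xs C rule: less_induct)
    case less
    note Cr = fg_moduleD(1)[OF less.prems(3)]
    note V = right_module_underlying_space[OF Cr]
    show ?case
    proof (cases "carrier C = {\<zero>\<^bsub>C\<^esub>} \<or> indecomposable A C")
      case True
      then show ?thesis using hom_pd_le_zero[OF Cr T] indec less.prems(3,4) by blast
    next
      case False
      then obtain U U' where c: "complementary A C U U'" "U \<noteq> {\<zero>\<^bsub>C\<^esub>}" "U' \<noteq> {\<zero>\<^bsub>C\<^esub>}"
        unfolding indecomposable_def by blast
      have c': "complementary A C U' U"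
      proof -
        interpret C: right_module A C by (rule Cr)
        have sub: "submodule U A C" "submodule U' A C" using c(1) by (auto simp: complementary_def)
        have "U' <+>\<^bsub>C\<^esub> U = U <+>\<^bsub>C\<^esub> U'"
          using rm_submoduleD(1)[OF Cr sub(1)] rm_submoduleD(1)[OF Cr sub(2)]
          unfolding set_add_defs set_mult_def by (auto simp: C.M.a_comm subset_iff) (metis C.M.a_comm)+
        then show ?thesis using c(1) by (auto simp: complementary_def)
      qed
      have step: "hom_pd_le A T N (C\<lparr>carrier := W\<rparr>)"
        if W: "complementary A C W W'" "W' \<noteq> {\<zero>\<^bsub>C\<^esub>}" for W W'
      proof -
        obtain p q where p: "lin A C (C\<lparr>carrier := W\<rparr>) p" "\<And>x. x \<in> W \<Longrightarrow> p x = x"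
          by (rule complementary_projections[OF Cr W(1)]) (rule that)
        have sub: "submodule W A C" "W \<inter> W' = {\<zero>\<^bsub>C\<^esub>}" "submodule W' A C"
          using W(1) by (auto simp: complementary_def)
        note w = rm_submoduleD[OF Cr sub(1)]
        note Wr = right_module_submodule[OF Cr sub(1)]
        have "carrier (C\<lparr>carrier := W\<rparr>) \<subseteq> p ` carrier C" using p(2) w(1) by force
        then have surj: "p ` carrier C = carrier (C\<lparr>carrier := W\<rparr>)" using linD(1)[OF p(1)] by blast
        have fgW: "fg_module A (C\<lparr>carrier := W\<rparr>)"
          by (rule fg_module_image[OF less.prems(3) Wr p(1) surj])
        have "W \<noteq> carrier C" using sub W(2) rm_submoduleD(1)[OF Cr sub(3)] by blast
        then obtain ys where ys: "set ys \<subseteq> W" "W = list_span K (underlying_space A C) ys"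
          "length ys < length xs"
          using subspace_list_span[OF field_axioms V _ submodule_underlying_space[OF Cr sub(1)], of xs]
            less.prems(1,2) w(1) by auto
        have "list_span K (underlying_space A (C\<lparr>carrier := W\<rparr>)) ys = list_span K (underlying_space A C) ys"
          by (induction ys) simp_all
        then have span: "list_span K (underlying_space A (C\<lparr>carrier := W\<rparr>)) ys = carrier (C\<lparr>carrier := W\<rparr>)"
          using ys(2) by simp
        have "hom_pd_le A T n (C\<lparr>carrier := W\<rparr>)"
          by (rule hom_pd_le_retract[OF less.prems(4) Wr Cr lin_sub_dom[OF lin_id w(1)] p(1)])
            (simp add: p(2))
        then show ?thesis
          using ys(1,3) by (intro less.hyps[OF ys(3) _ span fgW]) simp_all
      qed
      show ?thesis
        by (rule hom_pd_le_complementary[OF Cr T c(1) step[OF c(1,3)] step[OF c' c(2)]])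
    qed
  qed
qed

text \<open>
  The representatives that witness finite representation type are arbitrary records and need not be
  modules.  Two modules with the same representative are therefore compared with each other.
\<close>

lemma isomorphic_common_target:
  assumes M: "right_module R M" and M0: "right_module R M0"
    and i: "isomorphic R M N" and i0: "isomorphic R M0 N"
  obtains f g where "lin R M M0 f" "lin R M0 M g" "\<And>x. x \<in> carrier M \<Longrightarrow> g (f x) = x"
proof -
  obtain a where a: "lin R M N a" "bij_betw a (carrier M) (carrier N)"
    using i homs_lin unfolding isomorphic_def by blast
  obtain b where b: "lin R M0 N b" "bij_betw b (carrier M0) (carrier N)"
    using i0 homs_lin unfolding isomorphic_def by blast
  define a' where "a' = inv_into (carrier M) a"
  define b' where "b' = inv_into (carrier M0) b"
  have a': "a' y \<in> carrier M" "a (a' y) = y" if "y \<in> carrier N" for y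
    using that a(2) by (auto simp: a'_def bij_betw_def inv_into_into f_inv_into_f)
  have b': "b' y \<in> carrier M0" "b (b' y) = y" if "y \<in> carrier N" for y
    using that b(2) by (auto simp: b'_def bij_betw_def inv_into_into f_inv_into_f)
  have la: "lin R N M a'" using a(2) by (intro lin_inverse[OF M a(1) a']) (auto simp: bij_betw_def)
  have lb: "lin R N M0 b'" using b(2) by (intro lin_inverse[OF M0 b(1) b']) (auto simp: bij_betw_def)
  have "a' (b (b' (a x))) = x" if x: "x \<in> carrier M" for x
    using b'(2)[OF linD(1)[OF a(1) x]] a(2) x by (simp add: a'_def bij_betw_def inv_into_f_f)
  then show ?thesis using that lin_comp[OF a(1) lb] lin_comp[OF b(1) la] by blast
qed

text \<open>
  Each representative \<open>L\<close> contributes one bound \<open>b L\<close>, taken from any module isomorphic to \<open>L\<close> for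
  which some bound exists; \<open>N\<close> is the largest of these finitely many numbers.
\<close>

lemma finite_rep_type_hom_pd_bound:
  fixes T :: "('a, 'm, 'c) module_scheme"
  assumes A: "finite_rep_type A" and T: "right_module A T"
  obtains N where "\<And>M n. fg_module A M \<Longrightarrow> indecomposable A M \<Longrightarrow> hom_pd_le A T n M \<Longrightarrow> hom_pd_le A T N M"
proof -
  obtain S :: "'a umod set" where S: "finite S"
    "\<And>M :: 'a umod. fg_module A M \<Longrightarrow> indecomposable A M \<Longrightarrow> \<exists>L\<in>S. isomorphic A M L"
    using A unfolding finite_rep_type_def by blast
  define good where "good L n \<longleftrightarrow> (\<exists>M. fg_module A M \<and> isomorphic A M L \<and> hom_pd_le A T n M)" for L :: "'a umod" and n
  define b where "b L = (SOME n. good L n)" for L :: "'a umod"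
  have bN: "b L \<le> Max (b ` S)" if "L \<in> S" for L using S(1) that by simp
  show ?thesis
  proof (rule that)
    fix M :: "'a umod" and n
    assume M: "fg_module A M" "indecomposable A M" "hom_pd_le A T n M"
    obtain L where L: "L \<in> S" "isomorphic A M L" using S(2)[OF M(1,2)] by auto
    have "good L n" unfolding good_def using M L by blast
    then have "good L (b L)" unfolding b_def by (rule someI)
    then obtain M0 where M0: "fg_module A M0" "isomorphic A M0 L" "hom_pd_le A T (b L) M0"
      unfolding good_def by blast
    note Mr = fg_moduleD(1)[OF M(1)] and M0r = fg_moduleD(1)[OF M0(1)]
    obtain f g where fg: "lin A M M0 f" "lin A M0 M g" "\<And>x. x \<in> carrier M \<Longrightarrow> g (f x) = x"
      using isomorphic_common_target[OF Mr M0r L(2) M0(2)] by metis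
    have "hom_pd_le A T (b L) M" by (rule hom_pd_le_retract[OF M0(3) Mr M0r fg])
    then show "hom_pd_le A T (Max (b ` S)) M" using bN[OF L(1)] by (rule hom_pd_le_mono)
  qed
qed

text \<open>
  The second syzygy \<open>L\<close> of a module of finite projective dimension is \<open>Hom\<^sub>A(C,T)\<close> and again of finite
  projective dimension, hence of projective dimension at most \<open>N\<close>.
\<close>

theorem (in fd_algebra) findim_End_op_le:
  fixes T :: "('a, 'm, 'e) module_scheme"
  assumes A: "finite_rep_type A" and T: "fg_module A T"
  shows "\<exists>N. findim (End_op A T) \<le> enat N"
proof -
  let ?R = "End_op A T"
  note Tr = fg_moduleD(1)[OF T]
  obtain N where N: "\<And>M n. fg_module A M \<Longrightarrow> indecomposable A M \<Longrightarrow> hom_pd_le A T n M \<Longrightarrow> hom_pd_le A T N M"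
    using finite_rep_type_hom_pd_bound[OF A Tr] by metis
  have R: "ring ?R" by (rule ring_End_op[OF Tr])
  have "pd_le ?R (Suc (Suc N)) M" if M: "pd_le ?R n M" for M :: "('m \<Rightarrow> 'm) umod" and n
  proof -
    \<comment> \<open>Raising the bound by two lets two syzygies be taken even if \<open>M\<close> is projective.\<close>
    have M2: "pd_le ?R (Suc (Suc n)) M" by (intro pd_le_Suc M)
    note fgM = pd_le_fg[OF M]
    obtain k p where p: "lin ?R (power_module k (regular ?R)) M p"
      "p ` carrier (power_module k (regular ?R)) = carrier M"
      using fg_module_free_cover[OF fgM] by metis
    let ?G = "power_module k (regular ?R)"
    let ?K = "ker_module ?G M p"
    have G: "projective ?R ?G" by (rule projective_free[OF R])
    have K: "pd_le ?R (Suc n) ?K" by (rule pd_le_kernel[OF M2 G p])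
    note fgK = pd_le_fg[OF K]
    obtain m q where q: "lin ?R (power_module m (regular ?R)) ?K q"
      "q ` carrier (power_module m (regular ?R)) = carrier ?K"
      using fg_module_free_cover[OF fgK] by metis
    let ?F = "power_module m (regular ?R)"
    have F: "projective ?R ?F" by (rule projective_free[OF R])
    note Fr = fg_moduleD(1)[OF projective_fg[OF F]] and Gr = fg_moduleD(1)[OF projective_fg[OF G]]
    have qG: "lin ?R ?F ?G q"
      using q(1) by (auto simp: lin_def a_kernel_def' simp del: power_module_simps)
    have ker: "a_kernel ?F ?G q = a_kernel ?F ?K q"
      by (simp add: a_kernel_def')
    let ?L = "ker_module ?F ?K q"
    have L: "pd_le ?R n ?L" by (rule pd_le_kernel[OF K F q])
    have Lr: "right_module ?R ?L" by (rule fg_moduleD(1)[OF pd_le_fg[OF L]])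
    obtain C :: "'a umod" and f g where C: "fg_module A C"
      and f: "lin ?R ?L (hom_module A C T) f" and g: "lin ?R (hom_module A C T) ?L g"
      and gf: "\<forall>a\<in>a_kernel ?F ?K q. g (f a) = a"
      and fg: "\<forall>\<phi>\<in>homs A C T. f (g \<phi>) = \<phi>"
      using kernel_is_hom_module[OF T qG] unfolding ker by blast
    have CT: "hom_pd_le A T n C" by (rule hom_pd_leI[OF L g f]) (use fg in blast)
    have "hom_pd_le A T N C"
      by (rule hom_pd_le_if_indecomposable[OF Tr _ C CT]) (rule N)
    then obtain H i r where H: "pd_le ?R N H" "lin ?R (hom_module A C T) H i" "lin ?R H (hom_module A C T) r"
      "\<And>\<phi>. \<phi> \<in> homs A C T \<Longrightarrow> r (i \<phi>) = \<phi>"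
      unfolding hom_pd_le_def by blast
    have "g (r (i (f x))) = x" if x: "x \<in> carrier ?L" for x
      using H(4)[of "f x"] linD(1)[OF f x] gf x by (simp add: hom_module_simps)
    then have "pd_le ?R N ?L"
      by (rule pd_le_retract[OF H(1) Lr lin_comp[OF f H(2)] lin_comp[OF H(3) g]])
    then have "pd_le ?R (Suc N) ?K"
      unfolding pd_le.simps(2) using fgK F q by blast
    then show ?thesis
      unfolding pd_le.simps(2)[of _ "Suc N"] using fgM G p by blast
  qed
  then show ?thesis using findim_le by blast
qed

theorem corollary1p6:
  fixes K :: "'k ring"
    and A :: "('k, 'a) module"
    and T :: "('a, 'm) module"
  assumes "algebraically_closed K"
    and "fd_algebra K A"
    and "basic A"
    and "finite_rep_type A"
    and "support_tau_tilting K A T"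
    and "basic (End_algebra A T)"
  shows "findim (opposite (End_algebra A T)) < \<infinity>"
proof -
  have "fg_module A T"
    using assms(5) by (simp add: support_tau_tilting_def)
  then obtain N where "findim (opposite (End_algebra A T)) \<le> enat N"
    using fd_algebra.findim_End_op_le[OF assms(2,4)] by blast
  also have "\<dots> < \<infinity>" by simp
  finally show ?thesis .
qed

end
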